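(* Let $M>0$ and let $\Phi\in C^1([0,\infty[)\cap C^2(]0,\infty[)$ satisfy $\Phi(0)=0=\Phi'(0)$, $\Phi$ strictly convex, $\Phi(\rho)\ge C\rho^{1+1/n}$ for all sufficiently large $\rho$ (some $C>0$, $0<n<3$), and $\Phi(\rho)\le C\rho^{1+1/n'}$ for all sufficiently small $\rho\ge0$ (some $C>0$, $0<n'<3$). Let $\rho_0\in\mathcal F_M$ be a minimizer of $\mathcal H_r$ over $\mathcal F_M$ with induced potential $V_0=V_{\rho_0}$, and assume it is unique up to spatial shifts, i.e. every minimizer of $\mathcal H_r$ over $\mathcal F_M$ equals $T^a\rho_0$ for some $a\in\mathbb R^3$. Let $E_0\le0$ be the constant (Lagrange multiplier) such that $\rho_0=(\Phi')^{-1}(E_0-V_0)$ where $V_0<E_0$ and $\rho_0=0$ where $V_0\ge E_0$. Then for every $\epsilon>0$ there is $\delta>0$ such that the following holds: for every solution $t\mapsto(\rho(t),u(t))$ of the Euler–Poisson system \[ \partial_t\rho+\nabla\cdot(\rho u)=0,\quad \rho\partial_t u+\rho(u\cdot\nabla)u=-\nabla p-\rho\nabla V,\quad \Delta V=4\pi\rho,\ \lim_{|x|\to\infty}V(t,x)=0,\quad p=P(\rho), \] with $P(\rho)=\int_0^\rho\sigma\Phi''(\sigma)\,d\sigma$, with $\rho(0)\in\mathcal F_M$, which preserves mass and energy, the initial estimate \[ d(\rho(0),\rho_0)+\frac1{8\pi}\|\nabla V_{\rho(0)}-\nabla V_0\|_2^2+\frac12\int|u(0)|^2\rho(0)\,dx<\delta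 \] implies that for every $t\ge0$ for which the solution still exists there is a shift vector $a\in\mathbb R^3$ such that \[ d(\rho(t),T^a\rho_0)+\frac1{8\pi}\|\nabla V_{\rho(t)}-\nabla V_{T^a\rho_0}\|_2^2+\frac12\int|u(t)|^2\rho(t)\,dx<\epsilon . \]
   Context: For a function $\rho$ on $\mathbb R^3$: $V_\rho(x):=-\int\frac{\rho(y)}{|x-y|}dy$, $E_{\rm pot}(\rho):=-\frac12\iint\frac{\rho(x)\rho(y)}{|x-y|}dy\,dx$, $\mathcal H_r(\rho):=\int\Phi(\rho)\,dx+E_{\rm pot}(\rho)$, and $\mathcal F_M:=\{\rho\in L^1(\mathbb R^3)\mid\rho\ge0,\ \int\Phi(\rho)<\infty,\ \int\rho=M\}$. For $a\in\mathbb R^3$, $T^a\rho:=\rho(\cdot+a)$. The energy of a state $(\rho,u)$ is $\mathcal H(\rho,u):=\frac12\int|u|^2\rho\,dx+\int\Phi(\rho)\,dx-\frac12\iint\frac{\rho(x)\rho(y)}{|x-y|}dy\,dx$; a solution "preserves mass and energy" if $\int\rho(t)\,dx$ and $\mathcal H(\rho(t),u(t))$ are independent of $t$ on its interval of existence. For a shift $\sigma=T^a\rho_0$ of the minimizer and $\rho\in\mathcal F_M$, $d(\rho,\sigma):=\int\big[\Phi(\rho)-\Phi(\sigma)+(V_\sigma-E_0)(\rho-\sigma)\big]dx$ (with $E_0$ the Lagrange multiplier of $\rho_0$). $\|\cdot\|_2$ is the $L^2(\mathbb R^3)$ norm. *)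

theory Defs
  imports "HOL-Analysis.Analysis"
begin

definition strictly_convex_on :: "real set \<Rightarrow> (real \<Rightarrow> real) \<Rightarrow> bool" where
  "strictly_convex_on S f \<longleftrightarrow>
     (\<forall>x\<in>S. \<forall>y\<in>S. \<forall>t. x \<noteq> y \<and> 0 < t \<and> t < 1 \<longrightarrow>
        f ((1 - t) * x + t * y) < (1 - t) * f x + t * f y)"

definition Vpot :: "(real^3 \<Rightarrow> real) \<Rightarrow> real^3 \<Rightarrow> real" where
  "Vpot \<rho> x = - (\<integral>y. \<rho> y / dist x y \<partial>lebesgue)"

definition Epot :: "(real^3 \<Rightarrow> real) \<Rightarrow> real" where
  "Epot \<rho> = - (1/2) * (\<integral>x. (\<integral>y. \<rho> x * \<rho> y / dist x y \<partial>lebesgue) \<partial>lebesgue)"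

definition Hr :: "(real \<Rightarrow> real) \<Rightarrow> (real^3 \<Rightarrow> real) \<Rightarrow> real" where
  "Hr \<Phi> \<rho> = (\<integral>x. \<Phi> (\<rho> x) \<partial>lebesgue) + Epot \<rho>"

text \<open>The admissible class F_M (Phi >= 0 here, so int Phi(rho) < oo is integrability).\<close>
definition FM :: "(real \<Rightarrow> real) \<Rightarrow> real \<Rightarrow> (real^3 \<Rightarrow> real) set" where
  "FM \<Phi> M = {\<rho>. integrable lebesgue \<rho> \<and> (\<forall>x. 0 \<le> \<rho> x)
                  \<and> integrable lebesgue (\<lambda>x. \<Phi> (\<rho> x))
                  \<and> (\<integral>x. \<rho> x \<partial>lebesgue) = M}"

definition shift :: "real^3 \<Rightarrow> (real^3 \<Rightarrow> real) \<Rightarrow> real^3 \<Rightarrow> real" where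
  "shift a \<rho> = (\<lambda>x. \<rho> (x + a))"

definition Ekin :: "(real^3 \<Rightarrow> real) \<Rightarrow> (real^3 \<Rightarrow> real^3) \<Rightarrow> real" where
  "Ekin \<rho> u = (1/2) * (\<integral>x. (norm (u x))\<^sup>2 * \<rho> x \<partial>lebesgue)"

definition Henergy :: "(real \<Rightarrow> real) \<Rightarrow> (real^3 \<Rightarrow> real) \<Rightarrow> (real^3 \<Rightarrow> real^3) \<Rightarrow> real" where
  "Henergy \<Phi> \<rho> u = Ekin \<rho> u + (\<integral>x. \<Phi> (\<rho> x) \<partial>lebesgue) + Epot \<rho>"

definition grad :: "(real^3 \<Rightarrow> real) \<Rightarrow> real^3 \<Rightarrow> real^3" where
  "grad f x = (\<chi> i. deriv (\<lambda>h. f (x + h *\<^sub>R axis i 1)) 0)"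

definition L2sq :: "(real^3 \<Rightarrow> real^3) \<Rightarrow> real" where
  "L2sq F = (\<integral>x. (norm (F x))\<^sup>2 \<partial>lebesgue)"

definition dfun :: "(real \<Rightarrow> real) \<Rightarrow> real \<Rightarrow> (real^3 \<Rightarrow> real) \<Rightarrow> (real^3 \<Rightarrow> real) \<Rightarrow> real" where
  "dfun \<Phi> E0 \<rho> \<sigma> =
     (\<integral>x. \<Phi> (\<rho> x) - \<Phi> (\<sigma> x) + (Vpot \<sigma> x - E0) * (\<rho> x - \<sigma> x) \<partial>lebesgue)"

definition stabq :: "(real \<Rightarrow> real) \<Rightarrow> real \<Rightarrow> (real^3 \<Rightarrow> real) \<Rightarrow> (real^3 \<Rightarrow> real)
                      \<Rightarrow> (real^3 \<Rightarrow> real^3) \<Rightarrow> real" where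
  "stabq \<Phi> E0 \<sigma> \<rho> u =
     dfun \<Phi> E0 \<rho> \<sigma> + 1 / (8 * pi) * L2sq (\<lambda>x. grad (Vpot \<rho>) x - grad (Vpot \<sigma>) x)
     + Ekin \<rho> u"

definition pressure :: "(real \<Rightarrow> real) \<Rightarrow> real \<Rightarrow> real" where
  "pressure \<Phi>'' r = integral {0..r} (\<lambda>s. s * \<Phi>'' s)"

definition test_fun :: "real set \<Rightarrow> (real \<times> (real^3) \<Rightarrow> 'b::real_normed_vector) \<Rightarrow> bool" where
  "test_fun I \<phi> \<longleftrightarrow>
     (\<forall>z. \<phi> differentiable (at z))
     \<and> (\<forall>w. continuous_on UNIV (\<lambda>z. frechet_derivative \<phi> (at z) w))
     \<and> (\<exists>K. compact K \<and> K \<subseteq> interior I \<times> UNIV \<and> (\<forall>z. z \<notin> K \<longrightarrow> \<phi> z = 0))"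

text \<open>Weak (distributional) solution of the Euler--Poisson system on the time interval I,
  with V(t) = V_{rho(t)} (the decaying solution of Delta V = 4 pi rho) and p = P(rho).\<close>
definition EP_solution ::
  "(real \<Rightarrow> real) \<Rightarrow> real set \<Rightarrow> (real \<Rightarrow> real^3 \<Rightarrow> real) \<Rightarrow> (real \<Rightarrow> real^3 \<Rightarrow> real^3) \<Rightarrow> bool" where
  "EP_solution \<Phi>'' I \<rho> u \<longleftrightarrow>
     (\<forall>\<phi>::real \<times> (real^3) \<Rightarrow> real. test_fun I \<phi> \<longrightarrow>
        (let f = (\<lambda>(t,x). \<rho> t x * frechet_derivative \<phi> (at (t,x)) (1, 0)
                    + \<rho> t x * frechet_derivative \<phi> (at (t,x)) (0, u t x))
         in integrable lebesgue f \<and> integral\<^sup>L lebesgue f = 0))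
   \<and> (\<forall>\<psi>::real \<times> (real^3) \<Rightarrow> real^3. test_fun I \<psi> \<longrightarrow>
        (let f = (\<lambda>(t,x). \<rho> t x * (u t x \<bullet> frechet_derivative \<psi> (at (t,x)) (1, 0))
                    + \<rho> t x * (u t x \<bullet> frechet_derivative \<psi> (at (t,x)) (0, u t x))
                    + pressure \<Phi>'' (\<rho> t x) *
                        (\<Sum>i\<in>UNIV. frechet_derivative \<psi> (at (t,x)) (0, axis i 1) $ i)
                    - \<rho> t x * (grad (Vpot (\<rho> t)) x \<bullet> \<psi> (t,x)))
         in integrable lebesgue f \<and> integral\<^sup>L lebesgue f = 0))"

definition preserves_mass_energy ::
  "(real \<Rightarrow> real) \<Rightarrow> real set \<Rightarrow> (real \<Rightarrow> real^3 \<Rightarrow> real) \<Rightarrow> (real \<Rightarrow> real^3 \<Rightarrow> real^3) \<Rightarrow> bool" where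
  "preserves_mass_energy \<Phi> I \<rho> u \<longleftrightarrow>
     (\<forall>t\<in>I. (\<forall>x. 0 \<le> \<rho> t x) \<and> integrable lebesgue (\<rho> t)
        \<and> integrable lebesgue (\<lambda>x. \<Phi> (\<rho> t x))
        \<and> integrable lebesgue (\<lambda>x. (norm (u t x))\<^sup>2 * \<rho> t x)
        \<and> (\<integral>x. \<rho> t x \<partial>lebesgue) = (\<integral>x. \<rho> 0 x \<partial>lebesgue)
        \<and> Henergy \<Phi> (\<rho> t) (u t) = Henergy \<Phi> (\<rho> 0) (u 0))"

end

theory Submission
  imports Defs "HOL-Complex_Analysis.Great_Picard" "HOL-Real_Asymp.Real_Asymp" "HOL-Library.Diagonal_Subsequence"
begin

text \<open>
  The energy of a state exceeds that of a shift \<open>\<sigma>\<close> of the minimizer by \<open>d(\<rho>, \<sigma>) + Ekin - D(\<rho> - \<sigma>) / 2\<close>,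
  where \<open>D(f)\<close> is the double integral of \<open>f(x) f(y) / dist x y\<close>. The form \<open>D\<close> is nonnegative. Since
  the potential has almost everywhere the expected gradient, the squared \<open>L\<^sup>2\<close> norm of the difference
  of the fields is a constant multiple of \<open>D(\<rho> - \<sigma>)\<close>. As mass and energy are conserved, it therefore
  suffices that every minimizing sequence of the reduced energy has, up to shifts, a subsequence
  that converges to the minimizer with respect to \<open>D\<close>.

  Minimizing sequences do not vanish because the infimum is negative, and they do not split because
  the infimum over mass \<open>m \<le> M\<close> is at least \<open>(m / M) powr (5/3)\<close> times the one over mass \<open>M\<close>; hence they are tight
  after shifts. Tight sequences bounded in \<open>L\<^sup>1\<close> and in \<open>L\<close> with exponent \<open>4/3\<close> have \<open>D\<close>-Cauchy subsequences, by
  Arzela-Ascoli for truncated potentials. Testing the energy at midpoints then forces the convexity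
  gap of \<open>\<Phi>\<close> along the sequence to zero. This gives strong \<open>L\<^sup>1\<close> convergence, so the limit is a
  minimizer, that is, a shift of the given one.
\<close>

section \<open>Singular integrals of powers of the distance\<close>

text \<open>Two obstacles shape the proof. The kernel is singular on the diagonal, and each
  compactness step needs the energy of pairs within distance \<open>t\<close> to be small uniformly
  in the densities. A Young inequality with cube roots achieves this: the squared kernel is locally
  integrable in dimension three and is paired with the powers \<open>4/3\<close> of the densities.
  That exponent, \<open>1 + 1/n\<close> at the limiting value \<open>n = 3\<close>, is dominated by
  a small multiple of \<open>\<Phi>\<close> because \<open>n < 3\<close>, which also makes the
  energy coercive. The second obstacle is that \<open>L2sq\<close> contains pointwise gradients of
  potentials that need not be differentiable everywhere. They are identified through Lebesgue
  differentiation on almost every line parallel to an axis. The field energy then becomes an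
  integral over pairs of a kernel that a similarity reduces to one constant. The limit density is
  constructed only once \<open>L\<^sup>1\<close> convergence is known, so Fatou's lemma provides the
  lower semicontinuity of the internal energy.\<close>

lemma distr_lborel_orthogonal:
  fixes T :: "real^3 \<Rightarrow> real^3"
  assumes T: "orthogonal_transformation T"
  shows "distr lborel borel T = lborel"
proof (rule lborel_eqI[symmetric])
  have lin: "linear T" using T by (rule orthogonal_transformation_linear)
  then have meas[measurable]: "T \<in> borel \<rightarrow>\<^sub>M borel"
    by (intro borel_measurable_continuous_onI linear_continuous_on linear_conv_bounded_linear[THEN iffD1])
  fix l u :: "real^3" assume le: "\<And>b. b \<in> Basis \<Longrightarrow> l \<bullet> b \<le> u \<bullet> b"
  have inv: "orthogonal_transformation (inv T)"
    using T by (rule orthogonal_transformation_inv)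
  have eq: "T -` box l u = inv T ` box l u"
    using bij_vimage_eq_inv_image[OF orthogonal_transformation_bij[OF T]] .
  have box: "box l u \<in> lmeasurable" by simp
  have "emeasure (distr lborel borel T) (box l u) = emeasure lborel (T -` box l u)"
    by (subst emeasure_distr) auto
  also have "\<dots> = emeasure lebesgue (T -` box l u)"
    using measurable_sets[OF meas, of "box l u"] by simp
  also have "\<dots> = ennreal (measure lebesgue (inv T ` box l u))"
    unfolding eq by (rule emeasure_eq_measure2) (use measurable_orthogonal_image[OF inv box] in auto)
  also have "\<dots> = ennreal (measure lebesgue (box l u))"
    using measure_orthogonal_image[OF inv box] by simp
  also have "\<dots> = (\<Prod>b\<in>Basis. (u - l) \<bullet> b)"
    using le by (simp add: measure_lborel_box_eq)
  finally show "emeasure (distr lborel borel T) (box l u) = (\<Prod>b\<in>Basis. (u - l) \<bullet> b)" .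
qed simp

lemma nn_integral_lborel_affine:
  fixes f :: "real^3 \<Rightarrow> ennreal"
  assumes [measurable]: "f \<in> borel_measurable borel" and "c \<noteq> 0"
  shows "(\<integral>\<^sup>+x. f x \<partial>lborel) = ennreal (\<bar>c\<bar>^3) * (\<integral>\<^sup>+x. f (t + c *\<^sub>R x) \<partial>lborel)"
  by (subst lborel_affine[OF \<open>c \<noteq> 0\<close>, of t])
    (simp add: nn_integral_density nn_integral_distr nn_integral_cmult)

lemma integral_lborel_affine:
  fixes f :: "real^3 \<Rightarrow> real"
  assumes [measurable]: "f \<in> borel_measurable borel" and "c \<noteq> 0"
  shows "(\<integral>x. f x \<partial>lborel) = \<bar>c\<bar>^3 * (\<integral>x. f (t + c *\<^sub>R x) \<partial>lborel)"
  by (subst lborel_affine[OF \<open>c \<noteq> 0\<close>, of t])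
    (simp add: integral_density integral_distr)

lemma integrable_lborel_affine:
  fixes f :: "real^3 \<Rightarrow> real"
  assumes [measurable]: "f \<in> borel_measurable borel" and "c \<noteq> 0"
  shows "integrable lborel (\<lambda>x. f (t + c *\<^sub>R x)) \<longleftrightarrow> integrable lborel f"
  using \<open>c \<noteq> 0\<close>
  by (subst (2) lborel_affine[OF \<open>c \<noteq> 0\<close>, of t])
    (simp add: integrable_density integrable_distr_eq)

lemma integral_lborel_shift:
  fixes f :: "real^3 \<Rightarrow> real"
  assumes [measurable]: "f \<in> borel_measurable borel"
  shows "(\<integral>x. f (x + a) \<partial>lborel) = (\<integral>x. f x \<partial>lborel)"
  using integral_lborel_affine[OF assms, of 1 a] by (simp add: add.commute)

lemma integrable_lborel_shift:
  fixes f :: "real^3 \<Rightarrow> real"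
  assumes [measurable]: "f \<in> borel_measurable borel"
  shows "integrable lborel (\<lambda>x. f (x + a)) \<longleftrightarrow> integrable lborel f"
  using integrable_lborel_affine[OF assms, of 1 a] by (simp add: add.commute)

lemma nn_integral_lborel_shift:
  fixes f :: "real^3 \<Rightarrow> ennreal"
  assumes [measurable]: "f \<in> borel_measurable borel"
  shows "(\<integral>\<^sup>+x. f (x + a) \<partial>lborel) = (\<integral>\<^sup>+x. f x \<partial>lborel)"
  using nn_integral_lborel_affine[OF assms, of 1 a] by (simp add: add.commute)

lemma nn_integral_lborel_reflect:
  fixes f :: "real^3 \<Rightarrow> ennreal"
  assumes [measurable]: "f \<in> borel_measurable borel"
  shows "(\<integral>\<^sup>+y. f (x - y) \<partial>lborel) = (\<integral>\<^sup>+y. f y \<partial>lborel)"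
  using nn_integral_lborel_affine[OF assms, of "-1" x] by simp

text \<open>The reference pair is \<open>0\<close> and \<open>e1\<close>: every two-point integral
  below is carried to it by a similarity and so becomes a constant times a power of the
  distance.\<close>

definition e1 :: "real^3" where "e1 = axis 1 1"

lemma norm_e1 [simp]: "norm e1 = 1"
  by (simp add: e1_def)

text \<open>A rotation carries \<open>e1\<close> to the direction of \<open>v\<close>, and scaling
  by \<open>norm v\<close> follows. The density is the Jacobian of this similarity in dimension
  three.\<close>

lemma lborel_rotate_scale:
  fixes v :: "real^3"
  assumes "v \<noteq> 0"
  obtains S where "S \<in> borel \<rightarrow>\<^sub>M borel" "\<And>z. norm (S z) = norm v * norm z"
    "\<And>z. norm (S z - v) = norm v * norm (z - e1)"
    "lborel = density (distr lborel borel S) (\<lambda>_. ennreal (norm v ^ 3))"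
proof -
  obtain T where T: "orthogonal_transformation T" and Tv: "T e1 = v /\<^sub>R norm v"
    using rotation_exists[of e1 "v /\<^sub>R norm v"] assms by auto
  have lin: "linear T" using T by (rule orthogonal_transformation_linear)
  have meas[measurable]: "T \<in> borel \<rightarrow>\<^sub>M borel"
    by (intro borel_measurable_continuous_onI linear_continuous_on linear_conv_bounded_linear[THEN iffD1] lin)
  define S where "S z = norm v *\<^sub>R T z" for z
  have SS: "S = (\<lambda>x. 0 + norm v *\<^sub>R x) \<circ> T" by (auto simp: S_def)
  show ?thesis
  proof
    show "S \<in> borel \<rightarrow>\<^sub>M borel" unfolding S_def[abs_def] by measurable
    show "norm (S z) = norm v * norm z" for z
      by (simp add: S_def orthogonal_transformation_norm[OF T])
    show "norm (S z - v) = norm v * norm (z - e1)" for z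
    proof -
      have "S z - v = norm v *\<^sub>R T (z - e1)"
        using assms by (simp add: S_def linear_diff[OF lin] Tv scaleR_diff_right)
      then show ?thesis by (simp add: orthogonal_transformation_norm[OF T])
    qed
    have "distr lborel borel S = distr (distr lborel borel T) borel (\<lambda>x. 0 + norm v *\<^sub>R x)"
      unfolding SS by (subst distr_distr) auto
    also have "\<dots> = distr lborel borel (\<lambda>x. 0 + norm v *\<^sub>R x)"
      by (simp add: distr_lborel_orthogonal[OF T])
    finally show "lborel = density (distr lborel borel S) (\<lambda>_. ennreal (norm v ^ 3))"
      using lborel_affine[of "norm v" "0 :: real^3"] assms by simp
  qed
qed

abbreviation vol1 :: real where "vol1 \<equiv> unit_ball_vol (real DIM(real^3))"

lemma emeasure_ball3: "r \<ge> 0 \<Longrightarrow> emeasure lborel (ball (c::real^3) r) = ennreal (vol1 * r ^ 3)"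
  by (simp add: emeasure_ball)

lemma emeasure_norm_less:
  assumes "t \<ge> 0" shows "(\<integral>\<^sup>+z. indicator {z::real^3. norm z < t} z \<partial>lborel) = ennreal (vol1 * t ^ 3)"
proof -
  have "{z::real^3. norm z < t} = ball 0 t" by auto
  then show ?thesis using emeasure_ball3[OF assms, of 0] by simp
qed

section \<open>Radial singularities by the layer-cake formula\<close>

text \<open>For \<open>0 < r < t\<close> the value \<open>1 / r\<^sup>2\<close> is
  \<open>1 / t\<^sup>2\<close> plus the integral of \<open>2 / s^3\<close> over \<open>s\<close>
  from \<open>r\<close> to \<open>t\<close>. Swapping the integrals leaves ball volumes
  \<open>vol1 * s^3\<close>; the two parts contribute \<open>vol1 * t\<close> and
  \<open>2 * vol1 * t\<close>.\<close>

lemma nn_integral_inverse_square_near: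
  assumes t: "t > 0"
  shows "(\<integral>\<^sup>+z. ennreal (1 / (norm (z::real^3))\<^sup>2) * indicator {z. norm z < t} z \<partial>lborel)
           \<le> ennreal (3 * vol1 * t)"
proof -
  have pt: "ennreal (1 / (norm z)\<^sup>2) * indicator {z. norm z < t} z \<le>
     ennreal (1 / t\<^sup>2) * indicator {z. norm z < t} z +
     (\<integral>\<^sup>+s. ennreal (2 / s^3) * indicator {0<..<t} s * indicator {z. norm z < s} z \<partial>lborel)" for z :: "real^3"
  proof (cases "z = 0 \<or> norm z \<ge> t")
    case True then show ?thesis by auto
  next
    case False
    define r where "r = norm z"
    have r: "0 < r" "r < t" using False by (auto simp: r_def)
    have "(\<integral>\<^sup>+s. ennreal (2 / s^3) * indicator {r..t} s \<partial>lborel) = ennreal (- 1 / t^2 - - 1 / r^2)"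
      using r by (intro nn_integral_FTC_Icc)
       (auto intro!: derivative_eq_intros simp: power2_eq_square power3_eq_cube field_simps)
    moreover have "(\<integral>\<^sup>+s. ennreal (2 / s^3) * indicator {r..t} s \<partial>lborel)
       = (\<integral>\<^sup>+s. ennreal (2 / s^3) * indicator {0<..<t} s * indicator {z. norm z < s} z \<partial>lborel)"
    proof (rule nn_integral_cong_AE)
      show "AE s in lborel. ennreal (2 / s ^ 3) * indicator {r..t} s =
        ennreal (2 / s ^ 3) * indicator {0<..<t} s * indicator {z. norm z < s} z"
        using AE_lborel_singleton[of r] AE_lborel_singleton[of t]
      proof eventually_elim
        case (elim s) then show ?case using r
          by (auto simp: r_def[symmetric] indicator_def)
      qed
    qed
    ultimately have "(\<integral>\<^sup>+s. ennreal (2 / s^3) * indicator {0<..<t} s * indicator {z. norm z < s} z \<partial>lborel)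
       = ennreal (1 / r^2 - 1 / t^2)" by simp
    moreover have "1 / t^2 \<le> 1 / r^2" using r by (intro divide_left_mono) (auto simp: power_mono)
    ultimately show ?thesis using r False by (simp add: r_def[symmetric] ennreal_plus[symmetric] del: ennreal_plus)
  qed
  have m1 [measurable]: "(\<lambda>(z::real^3, s). indicator {z. norm z < s} z :: ennreal) \<in> borel_measurable (lborel \<Otimes>\<^sub>M lborel)"
  proof -
    have "(\<lambda>(z::real^3, s). indicator {z. norm z < s} z :: ennreal) = (\<lambda>p. indicator {p. norm (fst p) < snd p} p)"
      by (auto simp: indicator_def)
    moreover have "{p \<in> space (lborel \<Otimes>\<^sub>M lborel :: ((real^3)\<times>real) measure). norm (fst p) < snd p} \<in> sets (lborel \<Otimes>\<^sub>M lborel)"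
      by measurable
    then have "{p::(real^3)\<times>real. norm (fst p) < snd p} \<in> sets (lborel \<Otimes>\<^sub>M lborel)"
      by (simp add: space_pair_measure)
    ultimately show ?thesis by simp
  qed
  have "(\<integral>\<^sup>+z. ennreal (1 / (norm (z::real^3))\<^sup>2) * indicator {z. norm z < t} z \<partial>lborel) \<le>
     (\<integral>\<^sup>+z. ennreal (1 / t\<^sup>2) * indicator {z::real^3. norm z < t} z +
     (\<integral>\<^sup>+s. ennreal (2 / s^3) * indicator {0<..<t} s * indicator {z. norm z < s} z \<partial>lborel) \<partial>lborel)"
    by (intro nn_integral_mono pt)
  also have "\<dots> = (\<integral>\<^sup>+z. ennreal (1 / t\<^sup>2) * indicator {z::real^3. norm z < t} z \<partial>lborel) +
     (\<integral>\<^sup>+z. (\<integral>\<^sup>+s. ennreal (2 / s^3) * indicator {0<..<t} s * indicator {z::real^3. norm z < s} z \<partial>lborel) \<partial>lborel)"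
    by (intro nn_integral_add) measurable
  also have "(\<integral>\<^sup>+z. (\<integral>\<^sup>+s. ennreal (2 / s^3) * indicator {0<..<t} s * indicator {z::real^3. norm z < s} z \<partial>lborel) \<partial>lborel)
     = (\<integral>\<^sup>+s. (\<integral>\<^sup>+z. ennreal (2 / s^3) * indicator {0<..<t} s * indicator {z::real^3. norm z < s} z \<partial>lborel) \<partial>lborel)"
    by (rule lborel_pair.Fubini') measurable
  also have "\<dots> = (\<integral>\<^sup>+s. ennreal (2 * vol1) * indicator {0<..<t} s \<partial>lborel)"
  proof (rule nn_integral_cong)
    fix s :: real
    show "(\<integral>\<^sup>+z. ennreal (2 / s^3) * indicator {0<..<t} s * indicator {z::real^3. norm z < s} z \<partial>lborel)
       = ennreal (2 * vol1) * indicator {0<..<t} s"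
    proof (cases "0 < s \<and> s < t")
      case True
      then show ?thesis
        by (subst nn_integral_cmult) (auto simp: emeasure_norm_less ennreal_mult[symmetric] simp del: nn_integral_indicator)
    qed (auto simp: indicator_def)
  qed
  also have "\<dots> = ennreal (2 * vol1 * t)"
    using t by (subst nn_integral_cmult_indicator) (auto simp: ennreal_mult[symmetric])
  also have "(\<integral>\<^sup>+z. ennreal (1 / t\<^sup>2) * indicator {z::real^3. norm z < t} z \<partial>lborel) = ennreal (vol1 * t)"
    using t by (subst nn_integral_cmult)
     (auto simp: emeasure_norm_less ennreal_mult[symmetric] power2_eq_square power3_eq_cube simp del: nn_integral_indicator)
  finally show ?thesis using t by (simp add: ennreal_plus[symmetric] del: ennreal_plus) (simp add: algebra_simps)
qed

text \<open>Here \<open>1 / r^4\<close> is the integral of \<open>4 / s^5\<close> from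
  \<open>r\<close> to infinity, and the ball volumes leave the integrable
  \<open>4 * vol1 / s^2\<close>. The threshold is \<open>1/2\<close> because every point is at least
  that far from \<open>0\<close> or from \<open>e1\<close>.\<close>

lemma nn_integral_inverse_fourth_far:
  "(\<integral>\<^sup>+z. ennreal (1 / (norm (z::real^3))^4) * indicator {z. norm z \<ge> 1/2} z \<partial>lborel) < \<infinity>"
proof -
  have pt: "ennreal (1 / (norm z)^4) * indicator {z. norm z \<ge> 1/2} z \<le>
     (\<integral>\<^sup>+s. ennreal (4 / s^5) * indicator {1/2..} s * indicator {z. norm z \<le> s} z \<partial>lborel)" for z :: "real^3"
  proof (cases "norm z < 1/2")
    case True then show ?thesis by auto
  next
    case False
    define r where "r = norm z"
    have r: "1/2 \<le> r" using False by (auto simp: r_def)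
    have "(\<integral>\<^sup>+s. ennreal (4 / s^5) * indicator {r..} s \<partial>lborel) = ennreal (0 - - 1 / r^4)"
    proof (rule nn_integral_FTC_atLeast)
      show "((\<lambda>s::real. - 1 / s^4) \<longlongrightarrow> 0) at_top" by real_asymp
    qed (use r in \<open>auto intro!: derivative_eq_intros simp: field_simps eval_nat_numeral\<close>)
    moreover have "(\<integral>\<^sup>+s. ennreal (4 / s^5) * indicator {r..} s \<partial>lborel)
       = (\<integral>\<^sup>+s. ennreal (4 / s^5) * indicator {1/2..} s * indicator {z. norm z \<le> s} z \<partial>lborel)"
      using r by (intro nn_integral_cong) (auto simp: r_def[symmetric] indicator_def)
    ultimately show ?thesis using r by (simp add: r_def[symmetric])
  qed
  have m1 [measurable]: "(\<lambda>(z::real^3, s). indicator {z. norm z \<le> s} z :: ennreal) \<in> borel_measurable (lborel \<Otimes>\<^sub>M lborel)"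
  proof -
    have "(\<lambda>(z::real^3, s). indicator {z. norm z \<le> s} z :: ennreal) = (\<lambda>p. indicator {p. norm (fst p) \<le> snd p} p)"
      by (auto simp: indicator_def)
    moreover have "{p \<in> space (lborel \<Otimes>\<^sub>M lborel :: ((real^3)\<times>real) measure). norm (fst p) \<le> snd p} \<in> sets (lborel \<Otimes>\<^sub>M lborel)"
      by measurable
    then have "{p::(real^3)\<times>real. norm (fst p) \<le> snd p} \<in> sets (lborel \<Otimes>\<^sub>M lborel)"
      by (simp add: space_pair_measure)
    ultimately show ?thesis by simp
  qed
  have "(\<integral>\<^sup>+z. ennreal (1 / (norm (z::real^3))^4) * indicator {z. norm z \<ge> 1/2} z \<partial>lborel) \<le>
     (\<integral>\<^sup>+z. (\<integral>\<^sup>+s. ennreal (4 / s^5) * indicator {1/2..} s * indicator {z::real^3. norm z \<le> s} z \<partial>lborel) \<partial>lborel)"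
    by (intro nn_integral_mono pt)
  also have "\<dots> = (\<integral>\<^sup>+s. (\<integral>\<^sup>+z. ennreal (4 / s^5) * indicator {1/2..} s * indicator {z::real^3. norm z \<le> s} z \<partial>lborel) \<partial>lborel)"
    by (rule lborel_pair.Fubini') measurable
  also have "\<dots> = (\<integral>\<^sup>+s. ennreal (4 * vol1 / s^2) * indicator {1/2..} s \<partial>lborel)"
  proof (rule nn_integral_cong)
    fix s :: real
    show "(\<integral>\<^sup>+z. ennreal (4 / s^5) * indicator {1/2..} s * indicator {z::real^3. norm z \<le> s} z \<partial>lborel)
       = ennreal (4 * vol1 / s^2) * indicator {1/2..} s"
    proof (cases "1/2 \<le> s")
      case True
      have eq: "{z::real^3. norm z \<le> s} = cball 0 s" by auto
      show ?thesis unfolding eq using True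
        by (subst nn_integral_cmult)
          (auto simp: emeasure_cball ennreal_mult[symmetric] field_simps eval_nat_numeral intro!: borel_measurable_indicator)
    qed (auto simp: indicator_def)
  qed
  also have "\<dots> = ennreal (0 - - (4 * vol1) / (1/2))"
  proof (rule nn_integral_FTC_atLeast)
    show "((\<lambda>s::real. - (4 * vol1) / s) \<longlongrightarrow> 0) at_top" by real_asymp
  qed (auto intro!: derivative_eq_intros simp: field_simps eval_nat_numeral)
  finally show ?thesis by (auto simp: le_less_trans)
qed

text \<open>The singularities are separated: within \<open>1/2\<close> of one of the points
  \<open>0\<close>, \<open>e1\<close> the factor belonging to the other is at most \<open>4\<close>.
  Away from both, the inequality of arithmetic and geometric means splits the product into inverse
  fourth powers.\<close>

lemma nn_integral_riesz_square_finite: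
  "(\<integral>\<^sup>+z. ennreal (1 / ((norm z)\<^sup>2 * (norm (z - e1))\<^sup>2)) \<partial>lborel) < \<infinity>"
proof -
  let ?n = "\<lambda>z::real^3. ennreal (1 / (norm z)\<^sup>2) * indicator {z. norm z < 1} z"
  let ?f = "\<lambda>z::real^3. ennreal (1 / (norm z)^4) * indicator {z. norm z \<ge> 1/2} z"
  have pt: "ennreal (1 / ((norm z)\<^sup>2 * (norm (z - e1))\<^sup>2))
     \<le> 4 * ?n z + (4 * ?n (z - e1) + (?f z + ?f (z - e1)))" for z
  proof -
    let ?a = "norm z" and ?b = "norm (z - e1)"
    have ab: "1 \<le> ?a + ?b" using norm_triangle_ineq4[of z "z - e1"] by simp
    show ?thesis
    proof (cases "?a = 0 \<or> ?b = 0")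
      case True then show ?thesis by auto
    next
      case False
      then have pos: "?a > 0" "?b > 0" by auto
      consider "?a < 1/2" | "?b < 1/2" | "?a \<ge> 1/2" "?b \<ge> 1/2" by linarith
      then show ?thesis
      proof cases
        case 1
        then have "?b \<ge> 1/2" using ab by linarith
        then have "1 / 4 \<le> ?b\<^sup>2" using power_mono[of "1/2" ?b 2] by (simp add: power2_eq_square)
        then have "1 / (?a\<^sup>2 * ?b\<^sup>2) \<le> 1 / (?a\<^sup>2 * (1/4))"
          using pos by (intro divide_left_mono mult_left_mono) auto
        then have "1 / (?a\<^sup>2 * ?b\<^sup>2) \<le> 4 * (1 / ?a\<^sup>2)" by simp
        then have "ennreal (1 / (?a\<^sup>2 * ?b\<^sup>2)) \<le> 4 * ?n z"
          using 1 by (auto simp: ennreal_mult'[symmetric] ennreal_numeral[symmetric] simp del: ennreal_numeral)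
        then show ?thesis by (rule order_trans) simp
      next
        case 2
        then have "?a \<ge> 1/2" using ab by linarith
        then have "1 / 4 \<le> ?a\<^sup>2" using power_mono[of "1/2" ?a 2] by (simp add: power2_eq_square)
        then have "1 / (?a\<^sup>2 * ?b\<^sup>2) \<le> 1 / ((1/4) * ?b\<^sup>2)"
          using pos by (intro divide_left_mono mult_right_mono) auto
        then have "1 / (?a\<^sup>2 * ?b\<^sup>2) \<le> 4 * (1 / ?b\<^sup>2)" by simp
        then have "ennreal (1 / (?a\<^sup>2 * ?b\<^sup>2)) \<le> 4 * ?n (z - e1)"
          using 2 by (auto simp: ennreal_mult'[symmetric] ennreal_numeral[symmetric] simp del: ennreal_numeral)
        also have "\<dots> \<le> 4 * ?n (z - e1) + (?f z + ?f (z - e1))" by simp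
        also have "\<dots> \<le> 4 * ?n z + (4 * ?n (z - e1) + (?f z + ?f (z - e1)))" by (rule add_increasing) auto
        finally show ?thesis .
      next
        case 3
        have "2 * (1 / (?a\<^sup>2 * ?b\<^sup>2)) \<le> 1/?a^4 + 1/?b^4"
          using sum_squares_bound[of "1/?a^2" "1/?b^2"] by (simp add: power_divide flip: power_mult)
        moreover have "0 \<le> 1 / (?a\<^sup>2 * ?b\<^sup>2)" by simp
        ultimately have "1 / (?a\<^sup>2 * ?b\<^sup>2) \<le> 1/?a^4 + 1/?b^4" by linarith
        then have "ennreal (1 / (?a\<^sup>2 * ?b\<^sup>2)) \<le> ?f z + ?f (z - e1)"
          using 3 by (auto simp: ennreal_plus[symmetric] simp del: ennreal_plus)
        also have "\<dots> \<le> 4 * ?n (z - e1) + (?f z + ?f (z - e1))" by (rule add_increasing) auto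
        also have "\<dots> \<le> 4 * ?n z + (4 * ?n (z - e1) + (?f z + ?f (z - e1)))" by (rule add_increasing) auto
        finally show ?thesis .
      qed
    qed
  qed
  have n: "integral\<^sup>N lborel ?n < \<infinity>"
    using nn_integral_inverse_square_near[of 1] by (rule le_less_trans) auto
  have f: "integral\<^sup>N lborel ?f < \<infinity>" by (rule nn_integral_inverse_fourth_far)
  have sh: "(\<integral>\<^sup>+z. ?n (z - e1) \<partial>lborel) = integral\<^sup>N lborel ?n"
    "(\<integral>\<^sup>+z. ?f (z - e1) \<partial>lborel) = integral\<^sup>N lborel ?f"
    using nn_integral_lborel_shift[of ?n "- e1"] nn_integral_lborel_shift[of ?f "- e1"] by simp_all
  have "(\<integral>\<^sup>+z. ennreal (1 / ((norm z)\<^sup>2 * (norm (z - e1))\<^sup>2)) \<partial>lborel) \<le>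
    (\<integral>\<^sup>+z. 4 * ?n z + (4 * ?n (z - e1) + (?f z + ?f (z - e1))) \<partial>lborel)"
    by (intro nn_integral_mono pt)
  also have "\<dots> = 4 * integral\<^sup>N lborel ?n + (4 * integral\<^sup>N lborel ?n + (integral\<^sup>N lborel ?f + integral\<^sup>N lborel ?f))"
    by (simp add: nn_integral_add nn_integral_cmult sh[simplified])
  also have "\<dots> < \<infinity>" using n f by (simp add: ennreal_mult_less_top)
  finally show ?thesis .
qed

section \<open>Two-point integrals reduced to the reference pair\<close>

text \<open>Classically equal to \<open>pi^3\<close>; what enters later is that it is finite and
  positive.\<close>

definition rieszC :: real where
  "rieszC = (\<integral>z. 1 / ((norm z)\<^sup>2 * (norm (z - e1))\<^sup>2) \<partial>lborel)"

lemma integrable_riesz_e1: "integrable lborel (\<lambda>z. 1 / ((norm z)\<^sup>2 * (norm (z - e1))\<^sup>2))"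
  by (rule integrableI_nonneg) (use nn_integral_riesz_square_finite in auto)

lemma rieszC_pos: "rieszC > 0"
proof -
  have "rieszC \<ge> 0" unfolding rieszC_def by (intro Bochner_Integration.integral_nonneg) auto
  moreover have "rieszC \<noteq> 0"
  proof
    assume "rieszC = 0"
    then have "AE z in lborel. 1 / ((norm z)\<^sup>2 * (norm (z - e1))\<^sup>2) = 0"
      unfolding rieszC_def using integral_nonneg_eq_0_iff_AE[OF integrable_riesz_e1] by auto
    with AE_lborel_singleton[of "0::real^3"] AE_lborel_singleton[of e1]
    have "AE z::real^3 in lborel. False" by eventually_elim auto
    then show False by (simp add: eventually_False ae_filter_eq_bot_iff)
  qed
  ultimately show ?thesis by simp
qed

text \<open>The Riesz composition formula: under the similarity the integrand scales with exponent
  \<open>-4\<close> and the volume with exponent \<open>3\<close>, which leaves one inverse power of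
  the distance.\<close>

lemma nn_integral_riesz:
  fixes y z :: "real^3"
  assumes "y \<noteq> z"
  shows "(\<integral>\<^sup>+x. ennreal (1 / ((dist x y)\<^sup>2 * (dist x z)\<^sup>2)) \<partial>lborel) = ennreal (rieszC / dist y z)"
proof -
  define v where "v = z - y"
  have v: "v \<noteq> 0" using assms by (simp add: v_def)
  obtain S where S [measurable]: "S \<in> borel \<rightarrow>\<^sub>M borel" and n: "\<And>z. norm (S z) = norm v * norm z"
    "\<And>z. norm (S z - v) = norm v * norm (z - e1)"
    and L: "lborel = density (distr lborel borel S) (\<lambda>_. ennreal (norm v ^ 3))"
    using lborel_rotate_scale[OF v] by metis
  have "(\<integral>\<^sup>+x. ennreal (1 / ((dist x y)\<^sup>2 * (dist x z)\<^sup>2)) \<partial>lborel)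
     = (\<integral>\<^sup>+x. ennreal (1 / ((norm x)\<^sup>2 * (norm (x - v))\<^sup>2)) \<partial>lborel)"
    using nn_integral_lborel_shift[of "\<lambda>x. ennreal (1 / ((norm x)\<^sup>2 * (norm (x - v))\<^sup>2))" "-y"]
    by (simp add: dist_norm v_def)
  also have "\<dots> = ennreal (norm v ^ 3) * (\<integral>\<^sup>+x. ennreal (1 / ((norm v * norm x)\<^sup>2 * (norm v * norm (x - e1))\<^sup>2)) \<partial>lborel)"
    by (subst L) (simp add: nn_integral_density nn_integral_distr nn_integral_cmult n)
  also have "\<dots> = ennreal (norm v ^ 3) * (\<integral>\<^sup>+x. ennreal (1 / norm v ^ 4) * ennreal (1 / ((norm x)\<^sup>2 * (norm (x - e1))\<^sup>2)) \<partial>lborel)"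
    by (simp add: ennreal_mult'[symmetric] power_mult_distrib algebra_simps flip: power_add)
  also have "\<dots> = ennreal (norm v ^ 3 / norm v ^ 4) * ennreal rieszC"
    unfolding rieszC_def using v
    by (subst nn_integral_cmult) (auto simp: nn_integral_eq_integral[OF integrable_riesz_e1] ennreal_mult'[symmetric] mult.assoc[symmetric])
  also have "\<dots> = ennreal (rieszC / norm v)"
    using v by (simp add: ennreal_mult'[symmetric] divide_simps eval_nat_numeral)
  finally show ?thesis by (simp add: v_def dist_norm norm_minus_commute)
qed

text \<open>The integrand is the inner product of the gradients of \<open>1 / dist x y\<close> and
  \<open>1 / dist x z\<close> at the reference pair, so the classical value is
  \<open>4 * pi\<close>. The constant is kept abstract; its product with the form gets its sign from
  \<open>L2sq\<close> in the final proof.\<close>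

definition gradC :: real where
  "gradC = (\<integral>z. (z \<bullet> (z - e1)) / ((norm z)^3 * (norm (z - e1))^3) \<partial>lborel)"

text \<open>The similarity of \<open>lborel_rotate_scale\<close> is known only through norms, so the
  inner product is expressed through them.\<close>

lemma inner_diff_polar:
  fixes x v :: "'a::real_inner"
  shows "x \<bullet> (x - v) = ((norm x)\<^sup>2 + (norm (x - v))\<^sup>2 - (norm v)\<^sup>2) / 2"
  by (simp add: power2_norm_eq_inner inner_diff inner_commute)

lemma integral_grad_kernel:
  fixes y z :: "real^3"
  assumes "y \<noteq> z"
  shows "(\<integral>x. ((x - y) \<bullet> (x - z)) / ((dist x y)^3 * (dist x z)^3) \<partial>lborel) = gradC / dist y z"
proof -
  define v where "v = z - y"
  have v: "v \<noteq> 0" using assms by (simp add: v_def)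
  obtain S where S [measurable]: "S \<in> borel \<rightarrow>\<^sub>M borel" and n: "\<And>z. norm (S z) = norm v * norm z"
    "\<And>z. norm (S z - v) = norm v * norm (z - e1)"
    and L: "lborel = density (distr lborel borel S) (\<lambda>_. ennreal (norm v ^ 3))"
    using lborel_rotate_scale[OF v] by metis
  have inn: "S x \<bullet> (S x - v) = (norm v)\<^sup>2 * (x \<bullet> (x - e1))" for x
    unfolding inner_diff_polar n by (simp add: power_mult_distrib algebra_simps)
  have "(\<integral>x. ((x - y) \<bullet> (x - z)) / ((dist x y)^3 * (dist x z)^3) \<partial>lborel)
     = (\<integral>x. (x \<bullet> (x - v)) / ((norm x)^3 * (norm (x - v))^3) \<partial>lborel)"
    using integral_lborel_shift[of "\<lambda>x. (x \<bullet> (x - v)) / ((norm x)^3 * (norm (x - v))^3)" "-y"]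
    by (simp add: dist_norm v_def)
  also have "\<dots> = norm v ^ 3 * (\<integral>x. (S x \<bullet> (S x - v)) / ((norm (S x))^3 * (norm (S x - v))^3) \<partial>lborel)"
    by (subst L) (simp add: integral_density integral_distr flip: Bochner_Integration.integral_mult_right_zero)
  also have "\<dots> = norm v ^ 3 * (\<integral>x. ((norm v)\<^sup>2 * (x \<bullet> (x - e1))) / ((norm v * norm x)^3 * (norm v * norm (x - e1))^3) \<partial>lborel)"
    by (simp only: n inn)
  also have "\<dots> = norm v ^ 3 * (\<integral>x. (1 / norm v ^ 4) * ((x \<bullet> (x - e1)) / ((norm x)^3 * (norm (x - e1))^3)) \<partial>lborel)"
  proof -
    have "((norm v)\<^sup>2 * (x \<bullet> (x - e1))) / ((norm v * norm x)^3 * (norm v * norm (x - e1))^3)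
        = (1 / norm v ^ 4) * ((x \<bullet> (x - e1)) / ((norm x)^3 * (norm (x - e1))^3))" for x
      using v by (simp add: power_mult_distrib divide_simps eval_nat_numeral)
    then show ?thesis by simp
  qed
  also have "\<dots> = gradC / norm v"
    unfolding gradC_def using v
    by (subst Bochner_Integration.integral_mult_right_zero) (simp add: power3_eq_cube power4_eq_xxxx)
  finally show ?thesis by (simp add: v_def dist_norm norm_minus_commute)
qed

section \<open>The Coulomb form\<close>

abbreviation "R3R3 \<equiv> (lborel :: (real^3) measure) \<Otimes>\<^sub>M (lborel :: (real^3) measure)"

lemma integrable_prod_mult:
  fixes f g :: "real^3 \<Rightarrow> real"
  assumes f: "integrable lborel f" and g: "integrable lborel g"
  shows "integrable R3R3 (\<lambda>p. f (fst p) * g (snd p))"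
    and "(\<integral>p. f (fst p) * g (snd p) \<partial>R3R3) = (\<integral>x. f x \<partial>lborel) * (\<integral>x. g x \<partial>lborel)"
proof -
  have [measurable]: "f \<in> borel_measurable borel" "g \<in> borel_measurable borel" using f g by auto
  show int: "integrable R3R3 (\<lambda>p. f (fst p) * g (snd p))"
    by (rule lborel_pair.Fubini_integrable) (use f g in \<open>auto simp: abs_mult\<close>)
  show "(\<integral>p. f (fst p) * g (snd p) \<partial>R3R3) = (\<integral>x. f x \<partial>lborel) * (\<integral>x. g x \<partial>lborel)"
    using lborel_pair.integral_fst'[OF int] by simp
qed

definition near :: "real \<Rightarrow> real^3 \<Rightarrow> real^3 \<Rightarrow> real" where
  "near t x y = (if dist x y < t then 1 else 0)"

lemma near_measurable [measurable]: "(\<lambda>p. near t (fst p) (snd p)) \<in> borel_measurable (borel \<Otimes>\<^sub>M borel)"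
  unfolding near_def by measurable

text \<open>Tonelli, with the inner integral taken over \<open>x - y\<close>: it is at most
  \<open>3 * vol1 * t\<close> for every \<open>x\<close>. The versions with \<open>F (snd p)\<close>
  follow by swapping the coordinates.\<close>

lemma integrable_near_square:
  fixes F :: "real^3 \<Rightarrow> real"
  assumes t: "t > 0" and F: "integrable lborel F" and F0: "\<And>x. F x \<ge> 0"
  shows "integrable R3R3 (\<lambda>p. F (fst p) * (near t (fst p) (snd p) / (dist (fst p) (snd p))\<^sup>2))"
    and "(\<integral>p. F (fst p) * (near t (fst p) (snd p) / (dist (fst p) (snd p))\<^sup>2) \<partial>R3R3) \<le> 3 * vol1 * t * (\<integral>x. F x \<partial>lborel)"
    and "integrable R3R3 (\<lambda>p. F (snd p) * (near t (fst p) (snd p) / (dist (fst p) (snd p))\<^sup>2))"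
    and "(\<integral>p. F (snd p) * (near t (fst p) (snd p) / (dist (fst p) (snd p))\<^sup>2) \<partial>R3R3) \<le> 3 * vol1 * t * (\<integral>x. F x \<partial>lborel)"
proof -
  have [measurable]: "F \<in> borel_measurable borel" using F by auto
  let ?f = "\<lambda>p. F (fst p) * (near t (fst p) (snd p) / (dist (fst p) (snd p))\<^sup>2)"
  have inner: "(\<integral>\<^sup>+y. ennreal (near t x y / (dist x y)\<^sup>2) \<partial>lborel) \<le> ennreal (3 * vol1 * t)" for x
  proof -
    have "(\<integral>\<^sup>+y. ennreal (near t x y / (dist x y)\<^sup>2) \<partial>lborel)
       = (\<integral>\<^sup>+y. ennreal (1 / (norm (x - y))\<^sup>2) * indicator {z. norm z < t} (x - y) \<partial>lborel)"
      by (intro nn_integral_cong) (auto simp: near_def dist_norm)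
    also have "\<dots> = (\<integral>\<^sup>+z. ennreal (1 / (norm (z::real^3))\<^sup>2) * indicator {z. norm z < t} z \<partial>lborel)"
      by (rule nn_integral_lborel_reflect[of "\<lambda>z. ennreal (1 / (norm (z::real^3))\<^sup>2) * indicator {z. norm z < t} z"]) measurable
    finally show ?thesis using nn_integral_inverse_square_near[OF t] by simp
  qed
  have "(\<integral>\<^sup>+p. ennreal (?f p) \<partial>R3R3) = (\<integral>\<^sup>+x. (\<integral>\<^sup>+y. ennreal (?f (x, y)) \<partial>lborel) \<partial>lborel)"
    by (rule lborel.nn_integral_fst[symmetric]) measurable
  also have "\<dots> = (\<integral>\<^sup>+x. ennreal (F x) * (\<integral>\<^sup>+y. ennreal (near t x y / (dist x y)\<^sup>2) \<partial>lborel) \<partial>lborel)"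
  proof (rule nn_integral_cong)
    fix x
    have [measurable]: "(\<lambda>y. near t x y) \<in> borel_measurable borel" unfolding near_def by measurable
    show "(\<integral>\<^sup>+y. ennreal (?f (x, y)) \<partial>lborel) = ennreal (F x) * (\<integral>\<^sup>+y. ennreal (near t x y / (dist x y)\<^sup>2) \<partial>lborel)"
      by (subst nn_integral_cmult[symmetric]) (auto simp: ennreal_mult'[symmetric] F0)
  qed
  also have "\<dots> \<le> (\<integral>\<^sup>+x. ennreal (F x) * ennreal (3 * vol1 * t) \<partial>lborel)"
    by (intro nn_integral_mono mult_left_mono inner) auto
  also have "\<dots> = ennreal (3 * vol1 * t * (\<integral>x. F x \<partial>lborel))"
    using t by (subst nn_integral_multc)
      (auto simp: nn_integral_eq_integral[OF F] F0 ennreal_mult'[symmetric] mult.commute)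
  finally have nn: "(\<integral>\<^sup>+p. ennreal (?f p) \<partial>R3R3) \<le> ennreal (3 * vol1 * t * (\<integral>x. F x \<partial>lborel))" .
  have f0: "?f p \<ge> 0" for p using F0 by (auto simp: near_def)
  show int: "integrable R3R3 ?f"
    by (rule integrableI_nonneg) (use nn f0 in \<open>auto intro: le_less_trans\<close>)
  have c0: "0 \<le> 3 * vol1 * t * (\<integral>x. F x \<partial>lborel)"
    using t F0 by (intro mult_nonneg_nonneg Bochner_Integration.integral_nonneg) auto
  show b: "(\<integral>p. ?f p \<partial>R3R3) \<le> 3 * vol1 * t * (\<integral>x. F x \<partial>lborel)"
    using nn nn_integral_eq_integral[OF int] f0 c0 by simp
  show "integrable R3R3 (\<lambda>p. F (snd p) * (near t (fst p) (snd p) / (dist (fst p) (snd p))\<^sup>2))"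
    using lborel_pair.integrable_product_swap[OF int] by (simp add: near_def dist_commute split_beta')
  have "(\<integral>p. F (snd p) * (near t (fst p) (snd p) / (dist (fst p) (snd p))\<^sup>2) \<partial>R3R3) = (\<integral>p. ?f p \<partial>R3R3)"
    using lborel_pair.integral_product_swap[of ?f] by (simp add: near_def dist_commute split_beta')
  then show "(\<integral>p. F (snd p) * (near t (fst p) (snd p) / (dist (fst p) (snd p))\<^sup>2) \<partial>R3R3) \<le> 3 * vol1 * t * (\<integral>x. F x \<partial>lborel)"
    using b by simp
qed

text \<open>\<open>L\<^sup>1\<close> and \<open>L\<close> with exponent \<open>4/3\<close>
  interpolate to the exponent \<open>6/5\<close> of the Hardy-Littlewood-Sobolev inequality, so the
  Coulomb energy is finite. Borel rather than Lebesgue measurability keeps products measurable on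
  \<open>R3R3\<close>.\<close>

definition density_class :: "(real^3 \<Rightarrow> real) \<Rightarrow> bool" where
  "density_class f \<longleftrightarrow> f \<in> borel_measurable borel \<and> integrable lborel f \<and> integrable lborel (\<lambda>x. \<bar>f x\<bar> powr (4/3))"

definition N43 :: "(real^3 \<Rightarrow> real) \<Rightarrow> real" where
  "N43 f = (\<integral>x. \<bar>f x\<bar> powr (4/3) \<partial>lborel)"

text \<open>As one integral over the product space it can be iterated in either order. On the
  diagonal the kernel is \<open>0\<close> by the convention on division, which is harmless on a null
  set.\<close>

definition coulD :: "(real^3 \<Rightarrow> real) \<Rightarrow> (real^3 \<Rightarrow> real) \<Rightarrow> real" where
  "coulD f g = (\<integral>p. f (fst p) * g (snd p) / dist (fst p) (snd p) \<partial>R3R3)"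

lemma density_classD [measurable_dest]: "density_class f \<Longrightarrow> f \<in> borel_measurable borel"
  by (simp add: density_class_def)

lemma density_class_integrable: "density_class f \<Longrightarrow> integrable lborel f"
  by (simp add: density_class_def)

lemma density_class_integrable43: "density_class f \<Longrightarrow> integrable lborel (\<lambda>x. \<bar>f x\<bar> powr (4/3))"
  by (simp add: density_class_def)

lemma density_class_abs: "density_class f \<Longrightarrow> density_class (\<lambda>x. \<bar>f x\<bar>)"
  by (auto simp: density_class_def)

lemma N43_nonneg: "N43 f \<ge> 0"
  unfolding N43_def by (intro Bochner_Integration.integral_nonneg) auto

lemma powr43_add_le:
  fixes a b :: real
  shows "\<bar>a + b\<bar> powr (4/3) \<le> 4 * \<bar>a\<bar> powr (4/3) + 4 * \<bar>b\<bar> powr (4/3)"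
proof -
  have two: "(2::real) powr (4/3) \<le> 4"
    using powr_mono[of "4/3" 2 "2::real"] by simp
  have "\<bar>a + b\<bar> powr (4/3) \<le> (2 * max \<bar>a\<bar> \<bar>b\<bar>) powr (4/3)"
    by (intro powr_mono2) auto
  also have "\<dots> = 2 powr (4/3) * max \<bar>a\<bar> \<bar>b\<bar> powr (4/3)" by (simp add: powr_mult)
  also have "\<dots> \<le> 4 * max \<bar>a\<bar> \<bar>b\<bar> powr (4/3)" by (intro mult_right_mono two) auto
  also have "\<dots> \<le> 4 * \<bar>a\<bar> powr (4/3) + 4 * \<bar>b\<bar> powr (4/3)" by (auto simp: max_def)
  finally show ?thesis .
qed

lemma
  assumes f: "density_class f" and g: "density_class g"
  shows density_class_add: "density_class (\<lambda>x. f x + g x)"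
    and N43_add: "N43 (\<lambda>x. f x + g x) \<le> 4 * N43 f + 4 * N43 g"
proof -
  note [measurable] = density_classD[OF f] density_classD[OF g]
  note [simp] = density_class_integrable[OF f] density_class_integrable[OF g]
     density_class_integrable43[OF f] density_class_integrable43[OF g]
  have int: "integrable lborel (\<lambda>x. \<bar>f x + g x\<bar> powr (4/3))"
    by (rule Bochner_Integration.integrable_bound[where f = "\<lambda>x. 4 * \<bar>f x\<bar> powr (4/3) + 4 * \<bar>g x\<bar> powr (4/3)"])
      (auto intro: order_trans[OF powr43_add_le])
  then show "density_class (\<lambda>x. f x + g x)" by (simp add: density_class_def)
  have "N43 (\<lambda>x. f x + g x) \<le> (\<integral>x. 4 * \<bar>f x\<bar> powr (4/3) + 4 * \<bar>g x\<bar> powr (4/3) \<partial>lborel)"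
    unfolding N43_def by (intro integral_mono int powr43_add_le) auto
  then show "N43 (\<lambda>x. f x + g x) \<le> 4 * N43 f + 4 * N43 g" by (simp add: N43_def)
qed

lemma density_class_cmult:
  assumes f: "density_class f" shows "density_class (\<lambda>x. c * f x)"
  using f by (auto simp: density_class_def abs_mult powr_mult)

lemma N43_minus: "N43 (\<lambda>x. - f x) = N43 f"
  by (simp add: N43_def)

lemma density_class_uminus: "density_class f \<Longrightarrow> density_class (\<lambda>x. - f x)"
  using density_class_cmult[of f "-1"] by simp

lemma
  assumes f: "density_class f" and g: "density_class g"
  shows density_class_diff: "density_class (\<lambda>x. f x - g x)"
    and N43_diff: "N43 (\<lambda>x. f x - g x) \<le> 4 * N43 f + 4 * N43 g"
  using density_class_add[OF f density_class_uminus[OF g]] N43_add[OF f density_class_uminus[OF g]]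
  by (simp_all add: N43_minus)

lemma
  assumes f: "density_class f" and g [measurable]: "g \<in> borel_measurable borel" and le: "\<And>x. \<bar>g x\<bar> \<le> \<bar>f x\<bar>"
  shows density_class_bound: "density_class g" and N43_mono: "N43 g \<le> N43 f"
proof -
  note [measurable] = density_classD[OF f]
  have p: "\<bar>g x\<bar> powr (4/3) \<le> \<bar>f x\<bar> powr (4/3)" for x by (intro powr_mono2 le) auto
  have i: "integrable lborel g"
    by (rule Bochner_Integration.integrable_bound[OF density_class_integrable[OF f]]) (auto simp: le)
  have j: "integrable lborel (\<lambda>x. \<bar>g x\<bar> powr (4/3))"
    by (rule Bochner_Integration.integrable_bound[OF density_class_integrable43[OF f]]) (auto simp: p)
  show "density_class g" using i j by (simp add: density_class_def)
  show "N43 g \<le> N43 f" unfolding N43_def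
    by (intro integral_mono j density_class_integrable43 f p)
qed

text \<open>AM-GM for \<open>p\<^sup>2 q\<^sup>2\<close> and \<open>p q k\<close>, where \<open>p\<close>, \<open>q\<close> are the cube roots of \<open>a\<close>, \<open>b\<close>.\<close>

lemma young_near_pointwise:
  fixes a b k s :: real
  assumes "a \<ge> 0" "b \<ge> 0" "s > 0"
  shows "a * b * k \<le> s/2 * (a powr (4/3) * b powr (4/3)) + 1/(4 * s) * (a powr (4/3) * k\<^sup>2 + b powr (4/3) * k\<^sup>2)"
proof -
  define p q where "p = a powr (1/3)" and "q = b powr (1/3)"
  have a: "a = p^3" "a powr (4/3) = p^4" and b: "b = q^3" "b powr (4/3) = q^4"
    using assms unfolding p_def q_def by (cases "a = 0"; cases "b = 0"; simp add: powr_power)+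
  have "0 \<le> (s * p^2 * q^2 - p * q * k)\<^sup>2" by simp
  then have 1: "2 * s * (p^3 * q^3 * k) \<le> s^2 * (p^4 * q^4) + p^2*q^2*k^2"
    by (simp add: power2_diff power_mult_distrib algebra_simps flip: power_mult power_add)
       (simp add: eval_nat_numeral algebra_simps)
  have "2 * (p^2 * q^2) \<le> p^4 + q^4"
    using sum_squares_bound[of "p^2" "q^2"] by (simp flip: power_mult)
  then have "2 * (p^2 * q^2) * k^2 \<le> (p^4 + q^4) * k^2" by (rule mult_right_mono) simp
  with 1 have "4 * s * (p^3 * q^3 * k) \<le> 2 * s^2 * (p^4 * q^4) + (p^4 + q^4) * k^2" by linarith
  then have "p^3 * q^3 * k \<le> (2 * s^2 * (p^4 * q^4) + (p^4 + q^4) * k^2) / (4 * s)"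
    using assms by (simp add: pos_le_divide_eq mult.commute)
  also have "\<dots> = s/2 * (p^4 * q^4) + 1/(4 * s) * (p^4 * k^2 + q^4 * k^2)"
    using assms by (simp add: field_simps power2_eq_square)
  finally show ?thesis unfolding a(2) b(2) by (simp add: a(1) b(1))
qed


text \<open>The product term of \<open>young_near_pointwise\<close> carries \<open>s\<close> and the
  singular terms carry \<open>t / s\<close> after integration. A small \<open>s\<close> followed by
  a much smaller \<open>t\<close> thus makes the near-diagonal energy as small as desired.\<close>

lemma
  assumes f: "density_class f" and g: "density_class g"
    and f0: "\<And>x. f x \<ge> 0" and g0: "\<And>x. g x \<ge> 0" and t: "t > 0" and s: "s > 0"
  shows integrable_near: "integrable R3R3 (\<lambda>p. f (fst p) * g (snd p) * (near t (fst p) (snd p) / dist (fst p) (snd p)))"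
    and integral_near_le: "(\<integral>p. f (fst p) * g (snd p) * (near t (fst p) (snd p) / dist (fst p) (snd p)) \<partial>R3R3)
      \<le> s/2 * (N43 f * N43 g) + 3 * vol1 * t / (4 * s) * (N43 f + N43 g)"
proof -
  note [measurable] = density_classD[OF f] density_classD[OF g]
  let ?F = "\<lambda>x. f x powr (4/3)" and ?G = "\<lambda>x. g x powr (4/3)"
  let ?k2 = "\<lambda>p. near t (fst p) (snd p) / (dist (fst p) (snd p))\<^sup>2"
  have iF: "integrable lborel ?F" "integrable lborel ?G"
    using density_class_integrable43[OF f] density_class_integrable43[OF g] f0 g0 by simp_all
  have nF: "(\<integral>x. ?F x \<partial>lborel) = N43 f" "(\<integral>x. ?G x \<partial>lborel) = N43 g"
    using f0 g0 by (simp_all add: N43_def)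
  note i1 = integrable_prod_mult[OF iF]
  note i2 = integrable_near_square[OF t iF(1)]
  note i3 = integrable_near_square[OF t iF(2)]
  let ?R = "\<lambda>p. s/2 * (?F (fst p) * ?G (snd p)) + 1/(4 * s) * (?F (fst p) * ?k2 p + ?G (snd p) * ?k2 p)"
  have iR: "integrable R3R3 ?R" using i1(1) i2(1) i3(3) by simp
  have k2: "?k2 p = (near t (fst p) (snd p) / dist (fst p) (snd p))\<^sup>2" for p
    by (simp add: near_def power_divide)
  have le: "f (fst p) * g (snd p) * (near t (fst p) (snd p) / dist (fst p) (snd p)) \<le> ?R p" for p
    unfolding k2 using young_near_pointwise[OF f0 g0 s] by blast
  have nn: "0 \<le> f (fst p) * g (snd p) * (near t (fst p) (snd p) / dist (fst p) (snd p))" for p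
    using f0 g0 by (auto simp: near_def)
  show int: "integrable R3R3 (\<lambda>p. f (fst p) * g (snd p) * (near t (fst p) (snd p) / dist (fst p) (snd p)))"
  proof (rule Bochner_Integration.integrable_bound[OF iR])
    show "AE p in R3R3. norm (f (fst p) * g (snd p) * (near t (fst p) (snd p) / dist (fst p) (snd p))) \<le> norm (?R p)"
      using le nn by (intro AE_I2) (smt (verit) real_norm_def)
  qed measurable
  have "(\<integral>p. f (fst p) * g (snd p) * (near t (fst p) (snd p) / dist (fst p) (snd p)) \<partial>R3R3) \<le> (\<integral>p. ?R p \<partial>R3R3)"
    by (intro integral_mono int iR le)
  also have "\<dots> = s/2 * (\<integral>p. ?F (fst p) * ?G (snd p) \<partial>R3R3) +
      1/(4 * s) * ((\<integral>p. ?F (fst p) * ?k2 p \<partial>R3R3) + (\<integral>p. ?G (snd p) * ?k2 p \<partial>R3R3))"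
    using i1(1) i2(1) i3(3) by simp
  also have "\<dots> \<le> s/2 * (N43 f * N43 g) + 1/(4 * s) * (3 * vol1 * t * N43 f + 3 * vol1 * t * N43 g)"
    using i2(2) i3(4) s unfolding i1(2) nF
    by (intro add_mono mult_left_mono) (auto simp: N43_nonneg)
  also have "\<dots> = s/2 * (N43 f * N43 g) + 3 * vol1 * t / (4 * s) * (N43 f + N43 g)"
    by (simp add: algebra_simps add_divide_distrib)
  finally show "(\<integral>p. f (fst p) * g (snd p) * (near t (fst p) (snd p) / dist (fst p) (snd p)) \<partial>R3R3)
      \<le> s/2 * (N43 f * N43 g) + 3 * vol1 * t / (4 * s) * (N43 f + N43 g)" .
qed

lemma integrable_prod_bounded:
  fixes G :: "(real^3) \<times> (real^3) \<Rightarrow> real"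
  assumes f: "integrable lborel f" and g: "integrable lborel g"
    and [measurable]: "G \<in> borel_measurable R3R3" and B: "\<And>p. \<bar>G p\<bar> \<le> B"
  shows "integrable R3R3 (\<lambda>p. f (fst p) * g (snd p) * G p)"
proof (rule Bochner_Integration.integrable_bound)
  show "integrable R3R3 (\<lambda>p. B * (f (fst p) * g (snd p)))"
    using integrable_prod_mult(1)[OF f g] by simp
  show "AE p in R3R3. norm (f (fst p) * g (snd p) * G p) \<le> norm (B * (f (fst p) * g (snd p)))"
  proof (intro AE_I2)
    fix p
    have "\<bar>f (fst p) * g (snd p)\<bar> * \<bar>G p\<bar> \<le> \<bar>f (fst p) * g (snd p)\<bar> * \<bar>B\<bar>"
      using B[of p] by (intro mult_left_mono) auto
    then show "norm (f (fst p) * g (snd p) * G p) \<le> norm (B * (f (fst p) * g (snd p)))"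
      by (simp add: abs_mult mult_ac)
  qed
  have [measurable]: "f \<in> borel_measurable borel" "g \<in> borel_measurable borel" using f g by auto
  show "(\<lambda>p. f (fst p) * g (snd p) * G p) \<in> borel_measurable R3R3" by measurable
qed

text \<open>Within distance \<open>1\<close> this is \<open>integrable_near\<close>; beyond it the
  kernel is at most \<open>1\<close>, and the product of two \<open>L\<^sup>1\<close> functions
  dominates.\<close>

lemma integrable_coulD:
  assumes f: "density_class f" and g: "density_class g"
  shows "integrable R3R3 (\<lambda>p. f (fst p) * g (snd p) / dist (fst p) (snd p))"
proof -
  note [measurable] = density_classD[OF f] density_classD[OF g]
  let ?F = "\<lambda>x. \<bar>f x\<bar>" and ?G = "\<lambda>x. \<bar>g x\<bar>"
  have 1: "integrable R3R3 (\<lambda>p. ?F (fst p) * ?G (snd p) * (near 1 (fst p) (snd p) / dist (fst p) (snd p)))"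
    by (rule integrable_near[where s = 1]) (auto intro: density_class_abs f g)
  have 2: "integrable R3R3 (\<lambda>p. ?F (fst p) * ?G (snd p))"
    by (rule integrable_prod_mult) (auto intro: density_class_integrable f g)
  show ?thesis
  proof (rule Bochner_Integration.integrable_bound[OF Bochner_Integration.integrable_add[OF 1 2]])
    show "AE p in R3R3. norm (f (fst p) * g (snd p) / dist (fst p) (snd p)) \<le>
      norm (?F (fst p) * ?G (snd p) * (near 1 (fst p) (snd p) / dist (fst p) (snd p)) + ?F (fst p) * ?G (snd p))"
    proof (intro AE_I2)
      fix p :: "(real^3) \<times> (real^3)"
      have "?F (fst p) * ?G (snd p) * (1 / dist (fst p) (snd p)) \<le>
        ?F (fst p) * ?G (snd p) * (near 1 (fst p) (snd p) / dist (fst p) (snd p) + 1)"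
        by (intro mult_left_mono) (auto simp: near_def divide_simps)
      then show "norm (f (fst p) * g (snd p) / dist (fst p) (snd p)) \<le>
      norm (?F (fst p) * ?G (snd p) * (near 1 (fst p) (snd p) / dist (fst p) (snd p)) + ?F (fst p) * ?G (snd p))"
        by (simp add: abs_mult distrib_left near_def)
    qed
  qed measurable
qed

text \<open>\<open>G\<close> is left open because three bounded majorants of the far kernel are
  used: the constant \<open>1 / t\<close>, a two-level cutoff that sees the mass in balls, and the
  exact far kernel.\<close>

lemma coulD_split_le:
  assumes f: "density_class f" and g: "density_class g"
    and f0: "\<And>x. f x \<ge> 0" and g0: "\<And>x. g x \<ge> 0" and t: "t > 0" and s: "s > 0"
    and [measurable]: "G \<in> borel_measurable R3R3" and B: "\<And>p. \<bar>G p\<bar> \<le> B"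
    and G: "\<And>p. (1 - near t (fst p) (snd p)) / dist (fst p) (snd p) \<le> G p"
  shows "coulD f g \<le> s/2 * (N43 f * N43 g) + 3 * vol1 * t / (4 * s) * (N43 f + N43 g)
     + (\<integral>p. f (fst p) * g (snd p) * G p \<partial>R3R3)"
proof -
  let ?n = "\<lambda>p. f (fst p) * g (snd p) * (near t (fst p) (snd p) / dist (fst p) (snd p))"
  have i1: "integrable R3R3 ?n"
    using integrable_near[OF f g f0 g0 t s] .
  have i2: "integrable R3R3 (\<lambda>p. f (fst p) * g (snd p) * G p)"
    by (rule integrable_prod_bounded[OF _ _ _ B]) (auto intro: density_class_integrable f g)
  have "coulD f g \<le> (\<integral>p. ?n p + f (fst p) * g (snd p) * G p \<partial>R3R3)"
    unfolding coulD_def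
  proof (intro integral_mono integrable_coulD[OF f g] Bochner_Integration.integrable_add i1 i2)
    fix p
    have "f (fst p) * g (snd p) * ((1 - near t (fst p) (snd p)) / dist (fst p) (snd p)) \<le> f (fst p) * g (snd p) * G p"
      by (intro mult_left_mono G) (auto simp: f0 g0)
    then show "f (fst p) * g (snd p) / dist (fst p) (snd p) \<le> ?n p + f (fst p) * g (snd p) * G p"
      by (simp add: near_def split: if_splits)
  qed
  also have "\<dots> = (\<integral>p. ?n p \<partial>R3R3) + (\<integral>p. f (fst p) * g (snd p) * G p \<partial>R3R3)"
    using i1 i2 by simp
  finally show ?thesis using integral_near_le[OF f g f0 g0 t s] by simp
qed

lemma coulD_le:
  assumes f: "density_class f" and g: "density_class g"
    and f0: "\<And>x. f x \<ge> 0" and g0: "\<And>x. g x \<ge> 0" and t: "t > 0" and s: "s > 0"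
  shows "coulD f g \<le> s/2 * (N43 f * N43 g) + 3 * vol1 * t / (4 * s) * (N43 f + N43 g)
     + (\<integral>x. f x \<partial>lborel) * (\<integral>x. g x \<partial>lborel) / t"
proof -
  have "coulD f g \<le> s/2 * (N43 f * N43 g) + 3 * vol1 * t / (4 * s) * (N43 f + N43 g)
     + (\<integral>p. f (fst p) * g (snd p) * (1/t) \<partial>R3R3)"
    by (rule coulD_split_le[OF f g f0 g0 t s, where B = "1/t"]) (use t in \<open>auto simp: near_def divide_simps\<close>)
  also have "(\<integral>p. f (fst p) * g (snd p) * (1/t) \<partial>R3R3) = (\<integral>x. f x \<partial>lborel) * (\<integral>x. g x \<partial>lborel) / t"
    using integrable_prod_mult[OF density_class_integrable[OF f] density_class_integrable[OF g]] by simp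
  finally show ?thesis .
qed

section \<open>Bilinearity, symmetry and invariance of the form\<close>

lemma coulD_abs_le: "\<bar>coulD f g\<bar> \<le> coulD (\<lambda>x. \<bar>f x\<bar>) (\<lambda>x. \<bar>g x\<bar>)"
  unfolding coulD_def using integral_norm_bound[of R3R3 "\<lambda>p. f (fst p) * g (snd p) / dist (fst p) (snd p)"]
  by (simp add: abs_mult)

lemma coulD_nonneg: "(\<And>x. f x \<ge> 0) \<Longrightarrow> (\<And>x. g x \<ge> 0) \<Longrightarrow> coulD f g \<ge> 0"
  unfolding coulD_def by (intro Bochner_Integration.integral_nonneg) auto

lemma coulD_add_left:
  assumes "density_class f" "density_class g" "density_class h"
  shows "coulD (\<lambda>x. f x + g x) h = coulD f h + coulD g h"
  unfolding coulD_def using integrable_coulD[OF assms(1,3)] integrable_coulD[OF assms(2,3)]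
  by (simp add: distrib_right add_divide_distrib)

lemma coulD_diff_left:
  assumes "density_class f" "density_class g" "density_class h"
  shows "coulD (\<lambda>x. f x - g x) h = coulD f h - coulD g h"
  unfolding coulD_def using integrable_coulD[OF assms(1,3)] integrable_coulD[OF assms(2,3)]
  by (simp add: left_diff_distrib diff_divide_distrib)

lemma coulD_cmult_left: "coulD (\<lambda>x. c * f x) h = c * coulD f h"
  unfolding coulD_def by (simp add: mult.assoc flip: Bochner_Integration.integral_mult_right_zero)

lemma coulD_commute:
  assumes f: "density_class f" and g: "density_class g"
  shows "coulD f g = coulD g f"
proof -
  note [measurable] = density_classD[OF f] density_classD[OF g]
  show ?thesis
    unfolding coulD_def
    using lborel_pair.integral_product_swap[of "\<lambda>p. g (fst p) * f (snd p) / dist (fst p) (snd p)"]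
    by (simp add: split_beta' dist_commute mult.commute)
qed

lemma coulD_add_right:
  assumes "density_class f" "density_class g" "density_class h"
  shows "coulD h (\<lambda>x. f x + g x) = coulD h f + coulD h g"
  using coulD_add_left[OF assms] coulD_commute assms density_class_add by metis

lemma coulD_diff_right:
  assumes "density_class f" "density_class g" "density_class h"
  shows "coulD h (\<lambda>x. f x - g x) = coulD h f - coulD h g"
  using coulD_diff_left[OF assms] coulD_commute assms density_class_diff by metis

lemma coulD_diff_self:
  assumes f: "density_class f" and g: "density_class g"
  shows "coulD (\<lambda>x. f x - g x) (\<lambda>x. f x - g x) = coulD f f - 2 * coulD g f + coulD g g"
  using f g by (simp add: coulD_diff_left coulD_diff_right density_class_diff coulD_commute[of f g])

lemma coulD_iterated:
  assumes f: "density_class f" and g: "density_class g"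
  shows "coulD f g = (\<integral>x. f x * (\<integral>y. g y / dist x y \<partial>lborel) \<partial>lborel)"
    and "integrable lborel (\<lambda>x. f x * (\<integral>y. g y / dist x y \<partial>lborel))"
  using lborel_pair.integral_fst'[OF integrable_coulD[OF f g]] lborel_pair.integrable_fst'[OF integrable_coulD[OF f g]]
  by (simp_all add: coulD_def flip: times_divide_eq_right)

lemma density_class_shift:
  assumes f: "density_class f" shows "density_class (\<lambda>x. f (x + a))" "N43 (\<lambda>x. f (x + a)) = N43 f"
proof -
  note [measurable] = density_classD[OF f]
  show "density_class (\<lambda>x. f (x + a))"
    using f integrable_lborel_shift[of f a] integrable_lborel_shift[of "\<lambda>x. \<bar>f x\<bar> powr (4/3)" a]
    by (auto simp: density_class_def)
  show "N43 (\<lambda>x. f (x + a)) = N43 f"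
    using integral_lborel_shift[of "\<lambda>x. \<bar>f x\<bar> powr (4/3)" a] by (auto simp: N43_def)
qed

lemma coulD_shift:
  assumes f: "density_class f" and g: "density_class g"
  shows "coulD (\<lambda>x. f (x + a)) (\<lambda>x. g (x + a)) = coulD f g"
proof -
  note [measurable] = density_classD[OF f] density_classD[OF g]
  have "(\<integral>y. g (y + a) / dist x y \<partial>lborel) = (\<integral>y. g y / dist (x + a) y \<partial>lborel)" for x
    using integral_lborel_shift[of "\<lambda>y. g y / dist (x + a) y" a] by (simp add: dist_norm)
  then have "coulD (\<lambda>x. f (x + a)) (\<lambda>x. g (x + a)) = (\<integral>x. f (x + a) * (\<integral>y. g y / dist (x + a) y \<partial>lborel) \<partial>lborel)"
    by (subst coulD_iterated) (auto intro: density_class_shift f g)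
  also have "\<dots> = (\<integral>x. f x * (\<integral>y. g y / dist x y \<partial>lborel) \<partial>lborel)"
    by (rule integral_lborel_shift[of "\<lambda>x. f x * (\<integral>y. g y / dist x y \<partial>lborel)"]) measurable
  also have "\<dots> = coulD f g" using coulD_iterated(1)[OF f g] by simp
  finally show ?thesis .
qed

lemma density_class_scale:
  assumes f: "density_class f" and c: "c > 0"
  shows "density_class (\<lambda>x. f (c *\<^sub>R x))" 
  using f c integrable_lborel_affine[of f c 0] integrable_lborel_affine[of "\<lambda>x. \<bar>f x\<bar> powr (4/3)" c 0]
  by (auto simp: density_class_def)

text \<open>The two volume elements contribute \<open>c^3\<close> each and the kernel contributes
  \<open>1 / c\<close>. This exponent \<open>5\<close>, against \<open>3\<close> for the mass, makes
  the infimum of the energy strictly subadditive in the mass.\<close>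

lemma coulD_scale:
  assumes f: "density_class f" and c: "c > 0"
  shows "coulD f f = c ^ 5 * coulD (\<lambda>x. f (c *\<^sub>R x)) (\<lambda>x. f (c *\<^sub>R x))"
proof -
  note [measurable] = density_classD[OF f]
  have d: "dist (c *\<^sub>R x) (c *\<^sub>R y) = c * dist x y" for x y :: "real^3"
    using c by (simp add: dist_norm flip: scaleR_diff_right)
  have in1: "(\<integral>y. f y / dist (c *\<^sub>R x) y \<partial>lborel) = c^2 * (\<integral>y. f (c *\<^sub>R y) / dist x y \<partial>lborel)" for x
  proof -
    have "(\<integral>y. f y / dist (c *\<^sub>R x) y \<partial>lborel) = c^3 * (\<integral>y. f (c *\<^sub>R y) / dist (c *\<^sub>R x) (c *\<^sub>R y) \<partial>lborel)"
      using integral_lborel_affine[of "\<lambda>y. f y / dist (c *\<^sub>R x) y" c 0] c by simp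
    also have "\<dots> = c^3 * ((1/c) * (\<integral>y. f (c *\<^sub>R y) / dist x y \<partial>lborel))"
      unfolding d by (subst Bochner_Integration.integral_mult_right_zero[symmetric]) (simp add: mult.commute)
    finally show ?thesis using c by (simp add: power2_eq_square power3_eq_cube)
  qed
  have "coulD f f = (\<integral>x. f x * (\<integral>y. f y / dist x y \<partial>lborel) \<partial>lborel)"
    by (rule coulD_iterated[OF f f])
  also have "\<dots> = c^3 * (\<integral>x. f (c *\<^sub>R x) * (\<integral>y. f y / dist (c *\<^sub>R x) y \<partial>lborel) \<partial>lborel)"
    using integral_lborel_affine[of "\<lambda>x. f x * (\<integral>y. f y / dist x y \<partial>lborel)" c 0] c by simp
  also have "\<dots> = c^3 * (\<integral>x. c^2 * (f (c *\<^sub>R x) * (\<integral>y. f (c *\<^sub>R y) / dist x y \<partial>lborel)) \<partial>lborel)"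
    unfolding in1 by (simp add: mult_ac)
  also have "\<dots> = c^5 * (\<integral>x. f (c *\<^sub>R x) * (\<integral>y. f (c *\<^sub>R y) / dist x y \<partial>lborel) \<partial>lborel)"
    by (simp add: eval_nat_numeral)
  also have "(\<integral>x. f (c *\<^sub>R x) * (\<integral>y. f (c *\<^sub>R y) / dist x y \<partial>lborel) \<partial>lborel) = coulD (\<lambda>x. f (c *\<^sub>R x)) (\<lambda>x. f (c *\<^sub>R x))"
    by (rule coulD_iterated(1)[symmetric]) (auto intro: density_class_scale f c)
  finally show ?thesis .
qed

section \<open>Positivity of the Coulomb form and the energy of the field\<close>

lemma AE_R3R3_neq: "AE p in R3R3. fst p \<noteq> snd p"
proof (rule lborel_pair.AE_pair_measure)
  show "{p \<in> space R3R3. fst p \<noteq> snd p} \<in> sets R3R3"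
    by measurable
  show "AE x::real^3 in lborel. AE y in lborel. fst (x, y) \<noteq> snd (x, y)"
  proof (rule AE_I2)
    fix x :: "real^3"
    show "AE y in lborel. fst (x, y) \<noteq> snd (x, y)"
      using AE_lborel_singleton[of x] by eventually_elim auto
  qed
qed

text \<open>The bound by the Riesz kernel makes the triple integral absolutely convergent, since
  integrating the bound over \<open>x\<close> returns a multiple of the form of the absolute values.
  Fubini then lets \<open>x\<close> be integrated first. One instance gives positivity of the form,
  the other the energy of the field.\<close>

lemma triple_coulomb:
  fixes q :: "real^3 \<Rightarrow> (real^3) \<times> (real^3) \<Rightarrow> real"
  assumes f: "density_class f"
    and q [measurable]: "(\<lambda>z. q (fst z) (snd z)) \<in> borel_measurable (lborel \<Otimes>\<^sub>M R3R3)"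
    and qb: "\<And>x p. \<bar>q x p\<bar> \<le> 1 / ((dist x (fst p))\<^sup>2 * (dist x (snd p))\<^sup>2)"
    and qC: "\<And>p. fst p \<noteq> snd p \<Longrightarrow> (\<integral>x. q x p \<partial>lborel) = C / dist (fst p) (snd p)"
  shows "(\<integral>x. (\<integral>p. f (fst p) * f (snd p) * q x p \<partial>R3R3) \<partial>lborel) = C * coulD f f"
proof -
  note [measurable] = density_classD[OF f]
  interpret P: pair_sigma_finite "lborel :: (real^3) measure" R3R3 ..
  have qm [measurable]: "(\<lambda>x. q x p) \<in> borel_measurable borel" for p
    using measurable_compose[OF measurable_Pair2'[of p R3R3 lborel] q] by (simp add: space_pair_measure)
  let ?F = "\<lambda>z. f (fst (snd z)) * f (snd (snd z)) * q (fst z) (snd z)"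
  have F [measurable]: "?F \<in> borel_measurable (lborel \<Otimes>\<^sub>M R3R3)" by measurable
  let ?a = "\<lambda>p. \<bar>f (fst p)\<bar> * \<bar>f (snd p)\<bar>"
  have int: "integrable (lborel \<Otimes>\<^sub>M R3R3) ?F"
  proof (rule integrableI_bounded[OF F])
    have "(\<integral>\<^sup>+z. ennreal (norm (?F z)) \<partial>(lborel \<Otimes>\<^sub>M R3R3)) = (\<integral>\<^sup>+p. (\<integral>\<^sup>+x. ennreal (norm (?F (x, p))) \<partial>lborel) \<partial>R3R3)"
      by (rule P.nn_integral_snd[symmetric]) measurable
    also have "\<dots> \<le> (\<integral>\<^sup>+p. ennreal (rieszC * (?a p / dist (fst p) (snd p))) \<partial>R3R3)"
    proof (rule nn_integral_mono_AE)
      show "AE p in R3R3. (\<integral>\<^sup>+x. ennreal (norm (?F (x, p))) \<partial>lborel) \<le> ennreal (rieszC * (?a p / dist (fst p) (snd p)))"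
        using AE_R3R3_neq
      proof eventually_elim
        case (elim p)
        have "(\<integral>\<^sup>+x. ennreal (norm (?F (x, p))) \<partial>lborel) \<le>
          (\<integral>\<^sup>+x. ennreal (?a p) * ennreal (1 / ((dist x (fst p))\<^sup>2 * (dist x (snd p))\<^sup>2)) \<partial>lborel)"
        proof (rule nn_integral_mono)
          fix x
          have "norm (?F (x, p)) \<le> ?a p * (1 / ((dist x (fst p))\<^sup>2 * (dist x (snd p))\<^sup>2))"
            using mult_left_mono[OF qb[of x p], of "?a p"] by (simp add: abs_mult)
          then show "ennreal (norm (?F (x, p))) \<le> ennreal (?a p) * ennreal (1 / ((dist x (fst p))\<^sup>2 * (dist x (snd p))\<^sup>2))"
            by (subst ennreal_mult'[symmetric]) (auto intro: ennreal_leI)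
        qed
        also have "\<dots> = ennreal (?a p) * ennreal (rieszC / dist (fst p) (snd p))"
          by (subst nn_integral_cmult) (auto simp: nn_integral_riesz[OF elim])
        also have "\<dots> = ennreal (rieszC * (?a p / dist (fst p) (snd p)))"
          by (subst ennreal_mult'[symmetric]) (auto simp: mult_ac)
        finally show ?case .
      qed
    qed
    also have "\<dots> = ennreal (\<integral>p. rieszC * (?a p / dist (fst p) (snd p)) \<partial>R3R3)"
      using rieszC_pos
      by (intro nn_integral_eq_integral Bochner_Integration.integrable_mult_right impI
          integrable_coulD[OF density_class_abs[OF f] density_class_abs[OF f]]) auto
    finally show "(\<integral>\<^sup>+z. ennreal (norm (?F z)) \<partial>(lborel \<Otimes>\<^sub>M R3R3)) < \<infinity>"
      by (auto intro: le_less_trans)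
  qed
  have "(\<integral>x. (\<integral>p. f (fst p) * f (snd p) * q x p \<partial>R3R3) \<partial>lborel) = integral\<^sup>L (lborel \<Otimes>\<^sub>M R3R3) ?F"
    using P.integral_fst'[OF int] by simp
  also have "\<dots> = (\<integral>p. (\<integral>x. ?F (x, p) \<partial>lborel) \<partial>R3R3)"
    using P.integral_snd[of "\<lambda>x p. ?F (x, p)"] int by (simp add: split_beta')
  also have "\<dots> = (\<integral>p. C * (f (fst p) * f (snd p) / dist (fst p) (snd p)) \<partial>R3R3)"
  proof (rule integral_cong_AE)
    have "(\<lambda>p. \<integral>x. ?F (x, p) \<partial>lborel) \<in> borel_measurable R3R3"
      by measurable
    then show "(\<lambda>p. \<integral>x. ?F (x, p) \<partial>lborel) \<in> borel_measurable R3R3" .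
    show "AE p in R3R3. (\<integral>x. ?F (x, p) \<partial>lborel) = C * (f (fst p) * f (snd p) / dist (fst p) (snd p))"
      using AE_R3R3_neq by eventually_elim (simp add: qC)
  qed measurable
  also have "\<dots> = C * coulD f f" by (simp add: coulD_def flip: Bochner_Integration.integral_mult_right_zero)
  finally show "(\<integral>x. (\<integral>p. f (fst p) * f (snd p) * q x p \<partial>R3R3) \<partial>lborel) = C * coulD f f" .
qed

section \<open>The Riesz majorant and absolute convergence of the field\<close>

text \<open>A majorant of every field integral at \<open>x\<close>. As an \<open>ennreal\<close> it
  exists for all \<open>x\<close>, and its finiteness expresses absolute convergence there.\<close>

definition riesz2 :: "(real^3 \<Rightarrow> real) \<Rightarrow> real^3 \<Rightarrow> ennreal" where
  "riesz2 f x = (\<integral>\<^sup>+y. ennreal (\<bar>f y\<bar> / (dist x y)\<^sup>2) \<partial>lborel)"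

lemma riesz2_measurable [measurable]:
  assumes [measurable]: "f \<in> borel_measurable borel"
  shows "riesz2 f \<in> borel_measurable borel"
  unfolding riesz2_def by measurable

text \<open>By Tonelli it is enough to bound the integral of \<open>1 / (dist x y)\<^sup>2\<close>
  over the ball uniformly in \<open>y\<close>: points closer to \<open>y\<close> than
  \<open>R\<close> give at most \<open>3 * vol1 * R\<close>, the others at most
  \<open>vol1 * R^3 / R\<^sup>2\<close>.\<close>

lemma nn_integral_riesz2_ball:
  assumes f: "integrable lborel f" and R: "R > 0"
  shows "(\<integral>\<^sup>+x. riesz2 f x * indicator (ball 0 R) x \<partial>lborel) < \<infinity>"
proof -
  have [measurable]: "f \<in> borel_measurable borel" using f by simp
  have [measurable]: "ball 0 r \<in> sets (borel :: (real^3) measure)" for r by simp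
  have inner: "(\<integral>\<^sup>+x. ennreal (1 / (dist x y)\<^sup>2) * indicator (ball 0 R) x \<partial>lborel) \<le> ennreal (3 * vol1 * R + vol1 * R)" for y :: "real^3"
  proof -
    have "(\<integral>\<^sup>+x. ennreal (1 / (dist x y)\<^sup>2) * indicator (ball 0 R) x \<partial>lborel) \<le>
      (\<integral>\<^sup>+x. ennreal (1 / (norm (y - x))\<^sup>2) * indicator {z. norm z < R} (y - x) + ennreal (1 / R\<^sup>2) * indicator (ball 0 R) x \<partial>lborel)"
    proof (rule nn_integral_mono)
      fix x
      show "ennreal (1 / (dist x y)\<^sup>2) * indicator (ball 0 R) x \<le>
        ennreal (1 / (norm (y - x))\<^sup>2) * indicator {z. norm z < R} (y - x) + ennreal (1 / R\<^sup>2) * indicator (ball 0 R) x"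
      proof (cases "norm (y - x) < R")
        case True then show ?thesis by (auto simp: indicator_def dist_norm norm_minus_commute)
      next
        case False
        moreover have "norm (y - x) > 0" using False R by linarith
        ultimately have "1 / (dist x y)\<^sup>2 \<le> 1 / R\<^sup>2"
          using R by (intro divide_left_mono power_mono) (auto simp: dist_norm norm_minus_commute)
        then show ?thesis using False by (auto simp: indicator_def intro!: ennreal_leI)
      qed
    qed
    also have "\<dots> = (\<integral>\<^sup>+x. ennreal (1 / (norm (y - x))\<^sup>2) * indicator {z. norm z < R} (y - x) \<partial>lborel)
       + (\<integral>\<^sup>+x. ennreal (1 / R\<^sup>2) * indicator (ball (0::real^3) R) x \<partial>lborel)"
      by (rule nn_integral_add) measurable
    also have "(\<integral>\<^sup>+x. ennreal (1 / (norm (y - x))\<^sup>2) * indicator {z. norm z < R} (y - x) \<partial>lborel)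
       = (\<integral>\<^sup>+z. ennreal (1 / (norm (z::real^3))\<^sup>2) * indicator {z. norm z < R} z \<partial>lborel)"
      by (rule nn_integral_lborel_reflect[of "\<lambda>z. ennreal (1 / (norm (z::real^3))\<^sup>2) * indicator {z. norm z < R} z"]) measurable
    also have "(\<integral>\<^sup>+x. ennreal (1 / R\<^sup>2) * indicator (ball (0::real^3) R) x \<partial>lborel) = ennreal (vol1 * R)"
      using R emeasure_ball3[of R 0]
      by (subst nn_integral_cmult_indicator) (auto simp: ennreal_mult'[symmetric] power2_eq_square power3_eq_cube)
    finally show ?thesis
      using add_right_mono[OF nn_integral_inverse_square_near[OF R], of "ennreal (vol1 * R)"] R
      by (subst ennreal_plus) (auto intro: order_trans)
  qed
  have "(\<integral>\<^sup>+x. riesz2 f x * indicator (ball 0 R) x \<partial>lborel)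
     = (\<integral>\<^sup>+x. (\<integral>\<^sup>+y. ennreal (\<bar>f y\<bar> / (dist x y)\<^sup>2) * indicator (ball 0 R) x \<partial>lborel) \<partial>lborel)"
    unfolding riesz2_def by (intro nn_integral_cong nn_integral_multc[symmetric]) measurable
  also have "\<dots> = (\<integral>\<^sup>+y. (\<integral>\<^sup>+x. ennreal (\<bar>f y\<bar> / (dist x y)\<^sup>2) * indicator (ball 0 R) x \<partial>lborel) \<partial>lborel)"
    by (rule lborel_pair.Fubini'[symmetric]) measurable
  also have "\<dots> = (\<integral>\<^sup>+y. ennreal \<bar>f y\<bar> * (\<integral>\<^sup>+x. ennreal (1 / (dist x y)\<^sup>2) * indicator (ball 0 R) x \<partial>lborel) \<partial>lborel)"
    by (intro nn_integral_cong, subst nn_integral_cmult[symmetric])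
      (auto simp: ennreal_mult'[symmetric] mult.assoc[symmetric])
  also have "\<dots> \<le> (\<integral>\<^sup>+y. ennreal \<bar>f y\<bar> * ennreal (3 * vol1 * R + vol1 * R) \<partial>lborel)"
    by (intro nn_integral_mono mult_left_mono inner) auto
  also have "\<dots> < \<infinity>"
    using f by (subst nn_integral_multc) (auto simp: integrable_iff_bounded ennreal_mult_less_top)
  finally show ?thesis .
qed

lemma AE_riesz2_finite:
  assumes f: "integrable lborel f"
  shows "AE x in lborel. riesz2 f x < \<infinity>"
proof -
  have [measurable]: "f \<in> borel_measurable borel" using f by simp
  have [measurable]: "ball 0 r \<in> sets (borel :: (real^3) measure)" for r by simp
  have "AE x in lborel. \<forall>n. riesz2 f x * indicator (ball 0 (Suc n)) x \<noteq> \<infinity>"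
  proof (subst AE_all_countable, intro allI nn_integral_noteq_infinite)
    fix n show "(\<integral>\<^sup>+x. riesz2 f x * indicator (ball 0 (Suc n)) x \<partial>lborel) \<noteq> \<infinity>"
      using nn_integral_riesz2_ball[OF f, of "Suc n"] by simp
  qed measurable
  then show ?thesis
  proof eventually_elim
    case (elim x)
    obtain n :: nat where "norm x < n" using reals_Archimedean2 by blast
    then have "indicator (ball 0 (Suc n)) x = (1 :: ennreal)" by (auto simp: indicator_def)
    with elim[rule_format, of n] show ?case by (simp add: less_top)
  qed
qed

lemma riesz2_finite_integrable:
  assumes [measurable]: "f \<in> borel_measurable borel" and fin: "riesz2 f x < \<infinity>"
    and [measurable]: "k \<in> borel_measurable borel" and k: "\<And>y. \<bar>k y\<bar> \<le> 1 / (dist x y)\<^sup>2"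
  shows "integrable lborel (\<lambda>y. f y * k y)"
proof (rule integrableI_bounded)
  have "(\<integral>\<^sup>+y. ennreal (norm (f y * k y)) \<partial>lborel) \<le> riesz2 f x"
    unfolding riesz2_def
  proof (intro nn_integral_mono ennreal_leI)
    fix y show "norm (f y * k y) \<le> \<bar>f y\<bar> / (dist x y)\<^sup>2"
      using mult_left_mono[OF k[of y], of "\<bar>f y\<bar>"] by (simp add: abs_mult)
  qed
  then show "(\<integral>\<^sup>+y. ennreal (norm (f y * k y)) \<partial>lborel) < \<infinity>" using fin by (rule le_less_trans)
qed measurable

text \<open>The kernel \<open>1 / dist y z\<close> is a positive multiple of the integral of \<open>1 / ((dist x y)\<^sup>2 * (dist x z)\<^sup>2)\<close>
  over \<open>x\<close>, so the form is the square of an \<open>L\<^sup>2\<close> norm.\<close>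

lemma coulD_self_nonneg:
  assumes f: "density_class f" shows "coulD f f \<ge> 0"
proof -
  note [measurable] = density_classD[OF f]
  let ?q = "\<lambda>x p. 1 / ((dist x (fst p))\<^sup>2 * (dist x (snd p))\<^sup>2)"
  have i: "(\<integral>x. ?q x p \<partial>lborel) = rieszC / dist (fst p) (snd p)" if "fst p \<noteq> snd p" for p :: "(real^3) \<times> (real^3)"
    using nn_integral_riesz[OF that] rieszC_pos
    by (subst integral_eq_nn_integral) auto
  have "rieszC * coulD f f = (\<integral>x. (\<integral>p. f (fst p) * f (snd p) * ?q x p \<partial>R3R3) \<partial>lborel)"
  proof (rule triple_coulomb[OF f, symmetric])
    show "(\<lambda>z. ?q (fst z) (snd z)) \<in> borel_measurable (lborel \<Otimes>\<^sub>M R3R3)" by measurable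
    show "\<bar>?q x p\<bar> \<le> 1 / ((dist x (fst p))\<^sup>2 * (dist x (snd p))\<^sup>2)" for x p
      by (simp add: abs_mult)
  qed (rule i)
  also have "\<dots> \<ge> 0"
  proof (rule integral_nonneg_AE)
    show "AE x in lborel. 0 \<le> (\<integral>p. f (fst p) * f (snd p) * ?q x p \<partial>R3R3)"
      using AE_riesz2_finite[OF density_class_integrable[OF f]]
    proof eventually_elim
      case (elim x)
      have int: "integrable lborel (\<lambda>y. f y * (1 / (dist x y)\<^sup>2))"
        by (rule riesz2_finite_integrable[OF _ elim]) auto
      have "(\<integral>p. f (fst p) * f (snd p) * ?q x p \<partial>R3R3) = (\<integral>y. f y * (1 / (dist x y)\<^sup>2) \<partial>lborel) * (\<integral>y. f y * (1 / (dist x y)\<^sup>2) \<partial>lborel)"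
        using integrable_prod_mult(2)[OF int int] by (simp add: mult_ac)
      then show ?case by simp
    qed
  qed
  finally show ?thesis using rieszC_pos by (simp add: zero_le_mult_iff)
qed

text \<open>The kernel is the gradient of \<open>- 1 / dist x y\<close> in \<open>x\<close>, so this
  is the formal gradient of the potential.\<close>

definition newton_field :: "(real^3 \<Rightarrow> real) \<Rightarrow> real^3 \<Rightarrow> real^3" where
  "newton_field f x = (\<chi> i. \<integral>y. f y * ((x $ i - y $ i) / (dist x y)^3) \<partial>lborel)"

lemma newton_field_kernel_bound: "\<bar>(x $ i - y $ i) / (dist x y)^3\<bar> \<le> 1 / (dist x y)\<^sup>2"
proof (cases "x = y")
  case False
  have "\<bar>(x - y) $ i\<bar> \<le> dist x y" unfolding dist_norm by (rule component_le_norm_cart)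
  then show ?thesis using False by (simp add: field_simps power2_eq_square power3_eq_cube)
qed auto

lemma vec_nth_measurable [measurable]: "(\<lambda>x::real^3. x $ i) \<in> borel_measurable borel"
  by (intro borel_measurable_continuous_onI continuous_intros)

lemma newton_field_measurable [measurable]:
  assumes [measurable]: "f \<in> borel_measurable borel"
  shows "(\<lambda>x. newton_field f x $ i) \<in> borel_measurable borel"
  unfolding newton_field_def vec_lambda_beta by measurable

text \<open>At almost every \<open>x\<close> the squared norm is a double integral over pairs of an
  inner-product kernel, which Cauchy-Schwarz bounds by the Riesz kernel;
  \<open>triple_coulomb\<close> then applies.\<close>

lemma integral_field_square:
  assumes f: "density_class f"
  shows "(\<integral>x. (norm (newton_field f x))\<^sup>2 \<partial>lborel) = gradC * coulD f f"
proof -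
  note [measurable] = density_classD[OF f]
  let ?q = "\<lambda>x p. ((x - fst p) \<bullet> (x - snd p)) / ((dist x (fst p))^3 * (dist x (snd p))^3)"
  have bound: "\<bar>?q x p\<bar> \<le> 1 / ((dist x (fst p))\<^sup>2 * (dist x (snd p))\<^sup>2)" for x p
  proof (cases "x = fst p \<or> x = snd p")
    case False
    then have pos: "dist x (fst p) > 0" "dist x (snd p) > 0" by auto
    have "\<bar>(x - fst p) \<bullet> (x - snd p)\<bar> \<le> dist x (fst p) * dist x (snd p)"
      unfolding dist_norm by (rule Cauchy_Schwarz_ineq2)
    then have "\<bar>?q x p\<bar> \<le> (dist x (fst p) * dist x (snd p)) / ((dist x (fst p))^3 * (dist x (snd p))^3)"
      using pos by (simp add: abs_mult divide_right_mono)
    also have "\<dots> = 1 / ((dist x (fst p))\<^sup>2 * (dist x (snd p))\<^sup>2)"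
      using pos by (simp add: power2_eq_square power3_eq_cube)
    finally show ?thesis .
  qed auto
  have "gradC * coulD f f = (\<integral>x. (\<integral>p. f (fst p) * f (snd p) * ?q x p \<partial>R3R3) \<partial>lborel)"
  proof (rule triple_coulomb[OF f, symmetric])
    show "(\<lambda>z. ?q (fst z) (snd z)) \<in> borel_measurable (lborel \<Otimes>\<^sub>M R3R3)" by measurable
    show "(\<integral>x. ?q x p \<partial>lborel) = gradC / dist (fst p) (snd p)" if "fst p \<noteq> snd p" for p :: "(real^3) \<times> (real^3)"
      using integral_grad_kernel[OF that] .
  qed (rule bound)
  also have "\<dots> = (\<integral>x. (norm (newton_field f x))\<^sup>2 \<partial>lborel)"
  proof (rule integral_cong_AE)
    show "(\<lambda>x. \<integral>p. f (fst p) * f (snd p) * ?q x p \<partial>R3R3) \<in> borel_measurable lborel"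
      by measurable
    show "(\<lambda>x. (norm (newton_field f x))\<^sup>2) \<in> borel_measurable lborel"
      unfolding power2_norm_eq_inner inner_vec_def by measurable
    show "AE x in lborel. (\<integral>p. f (fst p) * f (snd p) * ?q x p \<partial>R3R3) = (norm (newton_field f x))\<^sup>2"
      using AE_riesz2_finite[OF density_class_integrable[OF f]]
    proof eventually_elim
      case (elim x)
      let ?k = "\<lambda>i y. f y * ((x $ i - y $ i) / (dist x y)^3)"
      have int: "integrable lborel (?k i)" for i
        by (rule riesz2_finite_integrable[OF _ elim _ newton_field_kernel_bound]) measurable
      have "(\<integral>p. f (fst p) * f (snd p) * ?q x p \<partial>R3R3) = (\<integral>p. (\<Sum>i\<in>UNIV. ?k i (fst p) * ?k i (snd p)) \<partial>R3R3)"
        by (intro Bochner_Integration.integral_cong) (auto simp: inner_vec_def sum_distrib_left sum_divide_distrib mult_ac intro!: sum.cong)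
      also have "\<dots> = (\<Sum>i\<in>UNIV. (\<integral>y. ?k i y \<partial>lborel) * (\<integral>y. ?k i y \<partial>lborel))"
        using integrable_prod_mult[OF int int] by (subst Bochner_Integration.integral_sum) auto
      also have "\<dots> = (norm (newton_field f x))\<^sup>2"
        unfolding power2_norm_eq_inner inner_vec_def by (simp add: newton_field_def)
      finally show ?case .
    qed
  qed
  finally show ?thesis by simp
qed

section \<open>The field is the gradient of the potential almost everywhere\<close>

text \<open>For a unit vector \<open>w\<close>, the component of the field along \<open>w\<close>. A
  general direction rather than a coordinate lets \<open>- axis i 1\<close> serve for left
  derivatives.\<close>

definition dirfield :: "real^3 \<Rightarrow> (real^3 \<Rightarrow> real) \<Rightarrow> real^3 \<Rightarrow> real" where
  "dirfield w f x = (\<integral>y. f y * (((x - y) \<bullet> w) / (dist x y)^3) \<partial>lborel)"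

definition newton :: "(real^3 \<Rightarrow> real) \<Rightarrow> real^3 \<Rightarrow> real" where
  "newton f x = - (\<integral>y. f y / dist x y \<partial>lborel)"

lemma dirfield_kernel_bound:
  fixes w :: "real^3" assumes "norm w = 1"
  shows "\<bar>((x - y) \<bullet> w) / (dist x y)^3\<bar> \<le> 1 / (dist x y)\<^sup>2"
proof (cases "x = y")
  case False
  have "\<bar>(x - y) \<bullet> w\<bar> \<le> dist x y" unfolding dist_norm using Cauchy_Schwarz_ineq2[of "x - y" w] assms by simp
  then show ?thesis using False by (simp add: field_simps power2_eq_square power3_eq_cube)
qed auto

lemma dirfield_measurable [measurable]:
  assumes [measurable]: "f \<in> borel_measurable borel"
  shows "dirfield w f \<in> borel_measurable borel"
  unfolding dirfield_def by measurable

lemma dirfield_minus: "dirfield (- w) f x = - dirfield w f x"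
  unfolding dirfield_def by simp

lemma dirfield_axis: "dirfield (axis i 1) f x = newton_field f x $ i"
  unfolding dirfield_def newton_field_def by (simp add: inner_axis)

lemma dirfield_le_riesz2:
  assumes "norm w = 1"
  shows "ennreal \<bar>dirfield w f x\<bar> \<le> riesz2 f x"
proof -
  have "ennreal \<bar>dirfield w f x\<bar> \<le> (\<integral>\<^sup>+y. ennreal \<bar>f y * (((x - y) \<bullet> w) / (dist x y)^3)\<bar> \<partial>lborel)"
    unfolding dirfield_def
    using integral_norm_bound_ennreal[of lborel "\<lambda>y. f y * (((x - y) \<bullet> w) / (dist x y)^3)"]
    by (cases "integrable lborel (\<lambda>y. f y * (((x - y) \<bullet> w) / (dist x y)^3))") (auto simp: not_integrable_integral_eq)
  also have "\<dots> \<le> riesz2 f x"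
    unfolding riesz2_def
  proof (intro nn_integral_mono ennreal_leI)
    fix y show "\<bar>f y * (((x - y) \<bullet> w) / (dist x y)^3)\<bar> \<le> \<bar>f y\<bar> / (dist x y)\<^sup>2"
      using mult_left_mono[OF dirfield_kernel_bound[OF assms, of x y], of "\<bar>f y\<bar>"] by (simp add: abs_mult)
  qed
  finally show ?thesis .
qed

section \<open>Lines along which the majorant is integrable\<close>

definition good_line :: "real^3 \<Rightarrow> (real^3 \<Rightarrow> real) \<Rightarrow> real^3 \<Rightarrow> bool" where
  "good_line w f x \<longleftrightarrow> (\<forall>n::nat. (\<integral>\<^sup>+s. riesz2 f (x + s *\<^sub>R w) * indicator {-real n..real n} s \<partial>lborel) < \<infinity>)"

text \<open>Tonelli over a ball times an interval: the translates \<open>x + s *\<^sub>R w\<close>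
  stay in a larger ball, over which \<open>riesz2 f\<close> has a finite integral. Integer radii and
  interval lengths keep the exceptional sets countable in number.\<close>

lemma AE_good_line:
  assumes f: "integrable lborel f" and w: "norm w = 1"
  shows "AE x in lborel. good_line w f x"
proof -
  have [measurable]: "f \<in> borel_measurable borel" using f by simp
  have [measurable]: "ball 0 r \<in> sets (borel :: (real^3) measure)" for r by simp
  let ?I = "\<lambda>n x. (\<integral>\<^sup>+s. riesz2 f (x + s *\<^sub>R w) * indicator {-real n..real n} s \<partial>lborel)"
  have fin: "(\<integral>\<^sup>+x. ?I n x * indicator (ball 0 (Suc m)) x \<partial>lborel) < \<infinity>" for n m
  proof -
    let ?J = "(\<integral>\<^sup>+x. riesz2 f x * indicator (ball 0 (Suc m + n)) x \<partial>lborel)"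
    have J: "?J < \<infinity>" by (rule nn_integral_riesz2_ball[OF f]) simp
    have "(\<integral>\<^sup>+x. ?I n x * indicator (ball 0 (Suc m)) x \<partial>lborel)
      = (\<integral>\<^sup>+x. (\<integral>\<^sup>+s. riesz2 f (x + s *\<^sub>R w) * indicator {-real n..real n} s * indicator (ball 0 (Suc m)) x \<partial>lborel) \<partial>lborel)"
      by (intro nn_integral_cong nn_integral_multc[symmetric]) measurable
    also have "\<dots> = (\<integral>\<^sup>+s. (\<integral>\<^sup>+x. riesz2 f (x + s *\<^sub>R w) * indicator {-real n..real n} s * indicator (ball 0 (Suc m)) x \<partial>lborel) \<partial>lborel)"
      by (rule lborel_pair.Fubini') measurable
    also have "\<dots> \<le> (\<integral>\<^sup>+s. indicator {-real n..real n} s * ?J \<partial>lborel)"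
    proof (rule nn_integral_mono)
      fix s :: real
      show "(\<integral>\<^sup>+x. riesz2 f (x + s *\<^sub>R w) * indicator {-real n..real n} s * indicator (ball 0 (Suc m)) x \<partial>lborel)
        \<le> indicator {-real n..real n} s * ?J"
      proof (cases "s \<in> {-real n..real n}")
        case True
        have "(\<integral>\<^sup>+x. riesz2 f (x + s *\<^sub>R w) * indicator {-real n..real n} s * indicator (ball 0 (Suc m)) x \<partial>lborel)
          \<le> (\<integral>\<^sup>+x. riesz2 f (x + s *\<^sub>R w) * indicator (ball 0 (Suc m + n)) (x + s *\<^sub>R w) \<partial>lborel)"
        proof (rule nn_integral_mono)
          fix x :: "real^3"
          have "norm (x + s *\<^sub>R w) \<le> norm x + \<bar>s\<bar>" using norm_triangle_ineq[of x "s *\<^sub>R w"] w by simp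
          then have "norm x < Suc m \<Longrightarrow> norm (x + s *\<^sub>R w) < Suc m + n" using True by auto
          then show "riesz2 f (x + s *\<^sub>R w) * indicator {-real n..real n} s * indicator (ball 0 (Suc m)) x
            \<le> riesz2 f (x + s *\<^sub>R w) * indicator (ball 0 (Suc m + n)) (x + s *\<^sub>R w)"
            using True by (auto simp: indicator_def)
        qed
        also have "\<dots> = ?J"
          by (rule nn_integral_lborel_shift[of "\<lambda>x. riesz2 f x * indicator (ball 0 (Suc m + n)) x"]) measurable
        finally show ?thesis using True by simp
      qed auto
    qed
    also have "\<dots> = ennreal (2 * real n) * ?J"
      by (subst nn_integral_multc) auto
    also have "\<dots> < \<infinity>" using J by (simp add: ennreal_mult_less_top)
    finally show ?thesis .
  qed
  have "AE x in lborel. \<forall>n m. ?I n x * indicator (ball 0 (Suc m)) x \<noteq> \<infinity>"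
  proof (subst AE_all_countable, rule allI, subst AE_all_countable, rule allI, rule nn_integral_noteq_infinite)
    fix n m :: nat
    show "(\<lambda>x. ?I n x * indicator (ball 0 (Suc m)) x) \<in> borel_measurable lborel" by measurable
    show "(\<integral>\<^sup>+x. ?I n x * indicator (ball 0 (Suc m)) x \<partial>lborel) \<noteq> \<infinity>" using fin[of n m] by simp
  qed
  then show ?thesis
  proof eventually_elim
    case (elim x)
    obtain m :: nat where "norm x < m" using reals_Archimedean2 by blast
    then have "indicator (ball 0 (Suc m)) x = (1 :: ennreal)" by (auto simp: indicator_def)
    show ?case unfolding good_line_def
    proof
      fix n
      have "?I n x * indicator (ball 0 (Suc m)) x \<noteq> \<infinity>" using elim by blast
      then show "?I n x < \<infinity>"
        using \<open>indicator (ball 0 (Suc m)) x = (1 :: ennreal)\<close> by (simp only: mult_1_right less_top infinity_ennreal_def)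
    qed
  qed
qed

lemma good_line_interval:
  assumes gl: "good_line w f x"
  shows "(\<integral>\<^sup>+s. riesz2 f (x + s *\<^sub>R w) * indicator {a..b} s \<partial>lborel) < \<infinity>"
proof -
  obtain n :: nat where "max \<bar>a\<bar> \<bar>b\<bar> < n" using reals_Archimedean2 by blast
  then have "(\<integral>\<^sup>+s. riesz2 f (x + s *\<^sub>R w) * indicator {a..b} s \<partial>lborel) \<le>
     (\<integral>\<^sup>+s. riesz2 f (x + s *\<^sub>R w) * indicator {-real n..real n} s \<partial>lborel)"
    by (intro nn_integral_mono mult_left_mono) (auto simp: indicator_def)
  then show ?thesis using gl unfolding good_line_def by (blast intro: le_less_trans)
qed

lemma good_line_integrable:
  assumes [measurable]: "f \<in> borel_measurable borel" and gl: "good_line w f x" and w: "norm w = 1"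
  shows "set_integrable lborel {a..b} (\<lambda>s. dirfield w f (x + s *\<^sub>R w))"
  unfolding set_integrable_def
proof (rule integrableI_bounded)
  have "(\<integral>\<^sup>+s. ennreal (norm (indicator {a..b} s *\<^sub>R dirfield w f (x + s *\<^sub>R w))) \<partial>lborel)
     \<le> (\<integral>\<^sup>+s. riesz2 f (x + s *\<^sub>R w) * indicator {a..b} s \<partial>lborel)"
    using dirfield_le_riesz2[OF w] by (intro nn_integral_mono) (auto simp: indicator_def)
  then show "(\<integral>\<^sup>+s. ennreal (norm (indicator {a..b} s *\<^sub>R dirfield w f (x + s *\<^sub>R w))) \<partial>lborel) < \<infinity>"
    using good_line_interval[OF gl] by (rule le_less_trans)
qed measurable

lemma negligible_line:
  fixes x w :: "real^3"
  shows "AE y in lborel. y \<notin> range (\<lambda>s. x + s *\<^sub>R w)"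
proof -
  have "negligible ((+) x ` span {w})"
    by (intro negligible_translation negligible_lowdim) (simp add: dim_singleton)
  moreover have "range (\<lambda>s. x + s *\<^sub>R w) = (+) x ` span {w}"
    by (auto simp: span_singleton)
  moreover have "closed ((+) x ` span {w})"
    by (intro closed_translation closed_span)
  ultimately have "range (\<lambda>s. x + s *\<^sub>R w) \<in> null_sets lborel"
    by (simp add: negligible_iff_null_sets null_sets_completion_iff borel_closed)
  then show ?thesis by (rule AE_not_in)
qed

text \<open>The fundamental theorem of calculus along the line, under the integral over
  \<open>y\<close>. For \<open>y\<close> off the line, hence for almost every \<open>y\<close>,
  \<open>- 1 / dist\<close> is differentiable along it with the field kernel as derivative;
  \<open>good_line\<close> justifies Fubini.\<close>

lemma newton_line:
  assumes f [measurable]: "f \<in> borel_measurable borel" and fi: "integrable lborel f" and gl: "good_line w f x" and w: "norm w = 1"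
    and fin: "riesz2 f x < \<infinity>" and h: "h \<ge> 0"
  shows "newton f (x + h *\<^sub>R w) - newton f x = (\<integral>s. indicator {0..h} s * dirfield w f (x + s *\<^sub>R w) \<partial>lborel)"
proof -
  let ?k = "\<lambda>s y. ((x + s *\<^sub>R w - y) \<bullet> w) / (dist (x + s *\<^sub>R w) y)^3"
  let ?F = "\<lambda>p. indicator {0..h} (fst p) * (f (snd p) * ?k (fst p) (snd p))"
  have Fm [measurable]: "?F \<in> borel_measurable (lborel \<Otimes>\<^sub>M lborel)" by measurable
  have int: "integrable (lborel \<Otimes>\<^sub>M lborel) ?F"
  proof (rule integrableI_bounded)
    have "(\<integral>\<^sup>+p. ennreal (norm (?F p)) \<partial>(lborel \<Otimes>\<^sub>M lborel)) = (\<integral>\<^sup>+s. (\<integral>\<^sup>+y. ennreal (norm (?F (s, y))) \<partial>lborel) \<partial>lborel)"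
      by (rule lborel.nn_integral_fst[symmetric]) measurable
    also have "\<dots> \<le> (\<integral>\<^sup>+s. riesz2 f (x + s *\<^sub>R w) * indicator {0..h} s \<partial>lborel)"
    proof (rule nn_integral_mono)
      fix s
      have "(\<integral>\<^sup>+y. ennreal (norm (?F (s, y))) \<partial>lborel) \<le> (\<integral>\<^sup>+y. ennreal (\<bar>f y\<bar> / (dist (x + s *\<^sub>R w) y)\<^sup>2) * indicator {0..h} s \<partial>lborel)"
      proof (rule nn_integral_mono)
        fix y
        show "ennreal (norm (?F (s, y))) \<le> ennreal (\<bar>f y\<bar> / (dist (x + s *\<^sub>R w) y)\<^sup>2) * indicator {0..h} s"
          using mult_left_mono[OF dirfield_kernel_bound[OF w, of "x + s *\<^sub>R w" y], of "\<bar>f y\<bar>"]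
          by (auto simp: indicator_def abs_mult intro!: ennreal_leI)
      qed
      also have "\<dots> = riesz2 f (x + s *\<^sub>R w) * indicator {0..h} s"
        unfolding riesz2_def by (rule nn_integral_multc) measurable
      finally show "(\<integral>\<^sup>+y. ennreal (norm (?F (s, y))) \<partial>lborel) \<le> riesz2 f (x + s *\<^sub>R w) * indicator {0..h} s" .
    qed
    also have "\<dots> < \<infinity>" by (rule good_line_interval[OF gl])
    finally show "(\<integral>\<^sup>+p. ennreal (norm (?F p)) \<partial>(lborel \<Otimes>\<^sub>M lborel)) < \<infinity>" .
  qed measurable
  have inner: "AE y in lborel. (\<integral>s. ?F (s, y) \<partial>lborel) = f y / dist x y - f y / dist (x + h *\<^sub>R w) y"
    using negligible_line[of x w]
  proof eventually_elim
    case (elim y)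
    have ne: "x + s *\<^sub>R w \<noteq> y" for s using elim by auto
    have der: "((\<lambda>s. - (1 / dist (x + s *\<^sub>R w) y)) has_real_derivative ?k s y) (at s)" for s
    proof -
      let ?v = "\<lambda>s. x + s *\<^sub>R w - y"
      have v: "?v s \<noteq> 0" using ne[of s] by simp
      have g: "(?v has_derivative (\<lambda>d. d *\<^sub>R w)) (at s)"
        by (auto intro!: derivative_eq_intros)
      have "((\<lambda>s. norm (?v s)) has_derivative (\<lambda>d. (d *\<^sub>R w) \<bullet> sgn (?v s))) (at s)"
        by (rule has_derivative_compose[OF g has_derivative_norm[OF v]])
      moreover have "(\<lambda>d. (d *\<^sub>R w) \<bullet> sgn (?v s)) = (*) (w \<bullet> sgn (?v s))"
        by (auto simp: fun_eq_iff)
      ultimately have "((\<lambda>s. norm (?v s)) has_real_derivative (w \<bullet> sgn (?v s))) (at s)"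
        by (simp only: has_field_derivative_def)
      from DERIV_minus[OF DERIV_inverse'[OF this]] v
      have "((\<lambda>s. - inverse (norm (?v s))) has_real_derivative
        - (- (inverse (norm (?v s)) * (w \<bullet> sgn (?v s)) * inverse (norm (?v s))))) (at s)"
        by simp
      moreover have "- (- (inverse (norm (?v s)) * (w \<bullet> sgn (?v s)) * inverse (norm (?v s)))) = ?k s y"
        by (simp add: sgn_div_norm dist_norm inner_commute divide_inverse power3_eq_cube)
      ultimately show ?thesis by (simp add: dist_norm divide_inverse)
    qed
    have "(\<integral>s. ?k s y * indicator {0..h} s \<partial>lborel) = - (1 / dist (x + h *\<^sub>R w) y) - (- (1 / dist (x + 0 *\<^sub>R w) y))"
    proof (rule integral_FTC_Icc_real[OF h, where F = "\<lambda>s. - (1 / dist (x + s *\<^sub>R w) y)"])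
      show "isCont (\<lambda>s. ?k s y) s" for s using ne[of s] by (intro continuous_intros) auto
    qed (rule der)
    moreover have "(\<integral>s. ?F (s, y) \<partial>lborel) = f y * (\<integral>s. ?k s y * indicator {0..h} s \<partial>lborel)"
      by (subst Bochner_Integration.integral_mult_right_zero[symmetric]) (simp add: mult_ac)
    ultimately show ?case by (simp only: scaleR_zero_left add_0_right) (simp add: right_diff_distrib)
  qed
  \<comment> \<open>The bound \<open>1 / d \<le> 1 / d\<^sup>2 + 1\<close> reduces this to
    finiteness of \<open>riesz2 f x\<close> and integrability of \<open>f\<close>.\<close>
  have intx: "integrable lborel (\<lambda>y. f y / dist x y)"
  proof (rule Bochner_Integration.integrable_bound)
    show "integrable lborel (\<lambda>y. \<bar>f y * (1 / (dist x y)\<^sup>2)\<bar> + \<bar>f y\<bar>)"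
      using riesz2_finite_integrable[OF f fin, of "\<lambda>y. 1 / (dist x y)\<^sup>2"] fi
      by (intro Bochner_Integration.integrable_add integrable_abs) auto
    show "AE y in lborel. norm (f y / dist x y) \<le> norm (\<bar>f y * (1 / (dist x y)\<^sup>2)\<bar> + \<bar>f y\<bar>)"
    proof (rule AE_I2)
      fix y
      have "1 / dist x y \<le> 1 / (dist x y)\<^sup>2 + 1"
      proof (cases "dist x y \<le> 1")
        case True
        then have "dist x y * dist x y \<le> dist x y" by (simp add: mult_left_le)
        then have "1 / dist x y \<le> 1 / (dist x y)\<^sup>2" by (cases "x = y") (auto simp: power2_eq_square intro!: divide_left_mono)
        then show ?thesis by simp
      next
        case False
        then have "1 / dist x y \<le> 1" by (subst divide_le_eq_1) auto
        moreover have "0 \<le> 1 / (dist x y)\<^sup>2" by simp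
        ultimately show ?thesis by linarith
      qed
      then have "\<bar>f y\<bar> * (1 / dist x y) \<le> \<bar>f y\<bar> * (1 / (dist x y)\<^sup>2 + 1)" by (intro mult_left_mono) auto
      then show "norm (f y / dist x y) \<le> norm (\<bar>f y * (1 / (dist x y)\<^sup>2)\<bar> + \<bar>f y\<bar>)"
        by (simp add: abs_mult distrib_left)
    qed
  qed measurable
  have intF: "integrable lborel (\<lambda>y. \<integral>s. ?F (s, y) \<partial>lborel)"
    using lborel_pair.integrable_snd[of "\<lambda>s y. ?F (s, y)"] int by (simp add: split_beta')
  \<comment> \<open>Convergence at the far endpoint is a consequence: the integrand there differs
    from the one at \<open>x\<close> by the integrable inner integral over the segment.\<close>
  have inth: "integrable lborel (\<lambda>y. f y / dist (x + h *\<^sub>R w) y)"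
  proof (subst integrable_cong_AE)
    show "integrable lborel (\<lambda>y. f y / dist x y - (\<integral>s. ?F (s, y) \<partial>lborel))"
      by (intro Bochner_Integration.integrable_diff intx intF)
    show "AE y in lborel. f y / dist (x + h *\<^sub>R w) y = f y / dist x y - (\<integral>s. ?F (s, y) \<partial>lborel)"
      using inner by eventually_elim simp
    show "(\<lambda>y. f y / dist x y - (\<integral>s. ?F (s, y) \<partial>lborel)) \<in> borel_measurable lborel"
      using intx intF by (intro borel_measurable_diff) (auto dest: borel_measurable_integrable)
  qed measurable
  have "(\<integral>s. indicator {0..h} s * dirfield w f (x + s *\<^sub>R w) \<partial>lborel) = (\<integral>s. (\<integral>y. ?F (s, y) \<partial>lborel) \<partial>lborel)"
    unfolding dirfield_def by (simp flip: Bochner_Integration.integral_mult_right_zero)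
  also have "\<dots> = (\<integral>y. (\<integral>s. ?F (s, y) \<partial>lborel) \<partial>lborel)"
    using lborel_pair.Fubini_integral[of "\<lambda>s y. ?F (s, y)"] int by (simp add: split_beta')
  also have "\<dots> = (\<integral>y. f y / dist x y - f y / dist (x + h *\<^sub>R w) y \<partial>lborel)"
    using intF inner by (intro integral_cong_AE) (auto dest: borel_measurable_integrable)
  also have "\<dots> = newton f (x + h *\<^sub>R w) - newton f x"
    unfolding newton_def using intx inth by simp
  finally show ?thesis by simp
qed

section \<open>Lebesgue differentiation along lines\<close>

definition line_int :: "real^3 \<Rightarrow> (real^3 \<Rightarrow> real) \<Rightarrow> real^3 \<Rightarrow> real \<Rightarrow> real" where
  "line_int w f z h = (\<integral>s. indicator {0..h} s * dirfield w f (z + s *\<^sub>R w) \<partial>lborel)"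

lemma line_int_measurable [measurable]:
  assumes [measurable]: "f \<in> borel_measurable borel"
  shows "(\<lambda>z. line_int w f z h) \<in> borel_measurable borel"
  unfolding line_int_def by measurable

lemma line_int_eq:
  assumes f: "f \<in> borel_measurable borel" and gl: "good_line w f z" and w: "norm w = 1"
  shows "line_int w f z h = integral {0..h} (\<lambda>s. dirfield w f (z + s *\<^sub>R w))"
  using set_borel_integral_eq_integral(2)[OF good_line_integrable[OF f gl w, of 0 h]]
  by (simp add: line_int_def set_lebesgue_integral_def)

lemma continuous_on_line_int:
  assumes f: "f \<in> borel_measurable borel" and gl: "good_line w f z" and w: "norm w = 1"
  shows "continuous_on {0..b} (line_int w f z)"
  using indefinite_integral_continuous_1[OF set_borel_integral_eq_integral(1)[OF good_line_integrable[OF f gl w, of 0 b]]]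
  by (simp add: line_int_eq[OF f gl w, abs_def])

text \<open>Difference quotients along rational increments only, so that the set of good points is Borel.\<close>

definition rat_diff :: "real^3 \<Rightarrow> (real^3 \<Rightarrow> real) \<Rightarrow> real^3 \<Rightarrow> bool" where
  "rat_diff w f z \<longleftrightarrow> (\<forall>n::nat. \<exists>m::nat. \<forall>q::rat. 0 < real_of_rat q \<longrightarrow> real_of_rat q < 1 / real (Suc m) \<longrightarrow>
     \<bar>line_int w f z (real_of_rat q) / real_of_rat q - dirfield w f z\<bar> \<le> 1 / real (Suc n))"

lemma rat_diff_measurable [measurable]:
  assumes [measurable]: "f \<in> borel_measurable borel"
  shows "Measurable.pred borel (rat_diff w f)"
  unfolding rat_diff_def by measurable

text \<open>Lebesgue differentiation in one variable: at almost every \<open>s\<close> the averages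
  of \<open>dirfield\<close> over the segment from \<open>s\<close> to \<open>s + h\<close> tend to
  its value at \<open>s\<close>.\<close>

lemma AE_line_rat_diff:
  assumes f [measurable]: "f \<in> borel_measurable borel" and gl: "good_line w f x" and w: "norm w = 1"
  shows "AE s in lborel. rat_diff w f (x + s *\<^sub>R w)"
proof -
  let ?g = "\<lambda>s. dirfield w f (x + s *\<^sub>R w)"
  have gi: "?g integrable_on cbox a b" for a b
    using set_borel_integral_eq_integral(1)[OF good_line_integrable[OF f gl w, of a b]] by simp
  obtain N where N: "negligible N" and *:
    "\<And>s e. \<lbrakk>s \<notin> N; 0 < e\<rbrakk> \<Longrightarrow> \<exists>d>0. \<forall>h. 0 < h \<and> h < d \<longrightarrow>
        norm(integral (cbox s (s + h *\<^sub>R One)) ?g /\<^sub>R h ^ DIM(real) - ?g s) < e"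
    using integrable_ccontinuous_explicit[of ?g, OF gi] by blast
  have sh: "integral (cbox s (s + h)) ?g = line_int w f (x + s *\<^sub>R w) h" for s h
  proof -
    have "line_int w f (x + s *\<^sub>R w) h = (\<integral>r. indicator {s..s+h} (s + 1 * r) * ?g (s + 1 * r) \<partial>lborel)"
      unfolding line_int_def by (intro Bochner_Integration.integral_cong) (auto simp: indicator_def scaleR_add_left add.assoc)
    also have "\<dots> = (\<integral>r. indicator {s..s+h} r * ?g r \<partial>lborel)"
      using lborel_integral_real_affine[of 1 "\<lambda>r. indicator {s..s+h} r * ?g r" s] by simp
    also have "\<dots> = integral {s..s+h} ?g"
      using set_borel_integral_eq_integral(2)[OF good_line_integrable[OF f gl w, of s "s+h"]]
      by (simp add: set_lebesgue_integral_def)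
    finally show ?thesis by simp
  qed
  have "rat_diff w f (x + s *\<^sub>R w)" if s: "s \<notin> N" for s
    unfolding rat_diff_def
  proof
    fix n :: nat
    obtain d where d: "d > 0" "\<And>h. 0 < h \<Longrightarrow> h < d \<Longrightarrow> norm (integral (cbox s (s + h *\<^sub>R One)) ?g /\<^sub>R h ^ DIM(real) - ?g s) < 1 / real (Suc n)"
      using *[OF s, of "1 / real (Suc n)"] by auto
    obtain m where m: "1 / real (Suc m) < d" using nat_approx_posE[OF d(1)] by blast
    have "\<bar>line_int w f (x + s *\<^sub>R w) h / h - ?g s\<bar> \<le> 1 / real (Suc n)" if "0 < h" "h < 1 / real (Suc m)" for h
      using d(2)[of h] that m sh[of s h] by (simp add: divide_inverse mult.commute)
    then show "\<exists>m::nat. \<forall>q::rat. 0 < real_of_rat q \<longrightarrow> real_of_rat q < 1 / real (Suc m) \<longrightarrow>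
     \<bar>line_int w f (x + s *\<^sub>R w) (real_of_rat q) / real_of_rat q - ?g s\<bar> \<le> 1 / real (Suc n)"
      by blast
  qed
  moreover have "AE s in lborel. s \<notin> N"
    using N AE_not_in[of N lebesgue] by (simp add: negligible_iff_null_sets AE_completion_iff)
  ultimately show ?thesis by auto
qed

lemma AE_lborel_shift:
  assumes "AE x in lborel. P (x :: real^3)"
  shows "AE x in lborel. P (x + a)"
proof -
  obtain N where N: "N \<in> null_sets lborel" and P: "\<And>x. x \<notin> N \<Longrightarrow> P x"
    using assms unfolding eventually_ae_filter by auto
  have "{x. x - (- a) \<in> N} \<in> null_sets lborel" using N by (rule null_sets_translation)
  then show ?thesis by (rule AE_I') (use P in auto)
qed

text \<open>Passage from almost every point of almost every line to almost every point of space.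
  Fubini exchanges the quantifiers, for which \<open>rat_diff\<close> must be Borel; then one value
  of \<open>s\<close> is fixed and the translation by \<open>s *\<^sub>R w\<close> is
  undone.\<close>

lemma AE_rat_diff:
  assumes f: "integrable lborel f" and w: "norm w = 1"
  shows "AE z in lborel. rat_diff w f z"
proof -
  have fm [measurable]: "f \<in> borel_measurable borel" using f by simp
  have "AE x in lborel. AE s in lborel. rat_diff w f (x + s *\<^sub>R w)"
    using AE_good_line[OF f w] by eventually_elim (rule AE_line_rat_diff[OF fm _ w])
  then have "AE s in lborel. AE x in lborel. rat_diff w f (x + s *\<^sub>R w)"
    by (subst (asm) lborel_pair.AE_commute) measurable
  then have "\<exists>s::real. AE x in lborel. rat_diff w f (x + s *\<^sub>R w)"
    using eventually_happens[of "\<lambda>s. AE x in lborel. rat_diff w f (x + s *\<^sub>R w)" "ae_filter lborel"]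
    by (simp add: ae_filter_eq_bot_iff)
  then obtain s :: real where "AE x in lborel. rat_diff w f (x + s *\<^sub>R w)" ..
  from AE_lborel_shift[OF this, of "- s *\<^sub>R w"] show ?thesis by simp
qed

text \<open>The difference quotient is continuous in \<open>h > 0\<close>. A violation of the bound
  at a real \<open>h\<close> would persist on a neighbourhood and so occur at a rational
  increment.\<close>

lemma right_derivative:
  assumes f: "f \<in> borel_measurable borel" "integrable lborel f" and gl: "good_line w f z" and w: "norm w = 1"
    and fin: "riesz2 f z < \<infinity>" and rd: "rat_diff w f z"
  shows "((\<lambda>h. (newton f (z + h *\<^sub>R w) - newton f z) / h) \<longlongrightarrow> dirfield w f z) (at_right 0)"
proof (rule tendstoI)
  fix e :: real assume "e > 0"
  then obtain n :: nat where n: "1 / real (Suc n) < e" using nat_approx_posE by blast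
  obtain m :: nat where m: "\<And>q::rat. 0 < real_of_rat q \<Longrightarrow> real_of_rat q < 1 / real (Suc m) \<Longrightarrow>
     \<bar>line_int w f z (real_of_rat q) / real_of_rat q - dirfield w f z\<bar> \<le> 1 / real (Suc n)"
    using rd unfolding rat_diff_def by blast
  let ?Q = "\<lambda>h. \<bar>line_int w f z h / h - dirfield w f z\<bar>"
  have Q: "?Q h \<le> 1 / real (Suc n)" if h: "0 < h" "h < 1 / real (Suc m)" for h
  proof (rule ccontr)
    assume c: "\<not> ?Q h \<le> 1 / real (Suc n)"
    have "continuous_on {0<..<1} ?Q"
      by (intro continuous_intros continuous_on_subset[OF continuous_on_line_int[OF f(1) gl w, of 1]]) auto
    then have "isCont ?Q h"
      by (rule continuous_on_interior) (use h in \<open>auto intro: less_le_trans simp: interior_open\<close>)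
    then have "(?Q \<longlongrightarrow> ?Q h) (at h)" by (simp add: isCont_def)
    then have "eventually (\<lambda>x. 1 / real (Suc n) < ?Q x) (at h)"
      by (rule order_tendstoD(1)) (use c in simp)
    then obtain d where d: "d > 0" "\<And>x. x \<noteq> h \<Longrightarrow> dist x h < d \<Longrightarrow> 1 / real (Suc n) < ?Q x"
      unfolding eventually_at by auto
    obtain q :: rat where q: "h < real_of_rat q" "real_of_rat q < min (h + d) (1 / real (Suc m))"
      using of_rat_dense[of h "min (h + d) (1 / real (Suc m))"] d(1) h by auto
    have "0 < real_of_rat q" using q h by linarith
    then have "?Q (real_of_rat q) \<le> 1 / real (Suc n)" using m[of q] q by linarith
    moreover have "1 / real (Suc n) < ?Q (real_of_rat q)"
      using d(2)[of "real_of_rat q"] q by (auto simp: dist_real_def)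
    ultimately show False by linarith
  qed
  show "eventually (\<lambda>h. dist ((newton f (z + h *\<^sub>R w) - newton f z) / h) (dirfield w f z) < e) (at_right 0)"
  proof (rule eventually_at_rightI)
    fix h assume h: "h \<in> {0<..<1 / real (Suc m)}"
    then have "newton f (z + h *\<^sub>R w) - newton f z = line_int w f z h"
      unfolding line_int_def by (intro newton_line[OF f gl w fin]) auto
    then show "dist ((newton f (z + h *\<^sub>R w) - newton f z) / h) (dirfield w f z) < e"
      using Q[of h] h n by (simp add: dist_real_def)
  qed simp
qed

text \<open>The right derivative in direction \<open>- axis i 1\<close> is minus the left derivative
  in direction \<open>axis i 1\<close>, so two one-sided limits suffice.\<close>

lemma AE_newton_partial_derivative:
  assumes f: "integrable lborel f"
  shows "AE z in lborel. ((\<lambda>h. newton f (z + h *\<^sub>R axis i 1)) has_real_derivative newton_field f z $ i) (at 0)"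
proof -
  have fm: "f \<in> borel_measurable borel" using f by simp
  let ?e = "axis i 1 :: real^3"
  have w: "norm ?e = 1" "norm (- ?e) = 1" by simp_all
  show ?thesis
    using AE_good_line[OF f w(1)] AE_good_line[OF f w(2)] AE_riesz2_finite[OF f] AE_rat_diff[OF f w(1)] AE_rat_diff[OF f w(2)]
  proof eventually_elim
    case (elim z)
    let ?q = "\<lambda>h. (newton f (z + h *\<^sub>R ?e) - newton f z) / h"
    have r: "(?q \<longlongrightarrow> newton_field f z $ i) (at_right 0)"
      using right_derivative[OF fm f elim(1) w(1) elim(3,4)] by (simp add: dirfield_axis)
    have "((\<lambda>h. - ((newton f (z + h *\<^sub>R (- ?e)) - newton f z) / h)) \<longlongrightarrow> - dirfield (- ?e) f z) (at_right 0)"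
      by (rule tendsto_minus[OF right_derivative[OF fm f elim(2) w(2) elim(3,5)]])
    then have "(?q \<longlongrightarrow> newton_field f z $ i) (at_left 0)"
      unfolding filterlim_at_left_to_right by (simp add: dirfield_axis dirfield_minus)
    then have "(?q \<longlongrightarrow> newton_field f z $ i) (at 0)" using r by (rule filterlim_split_at)
    then show ?case by (simp add: DERIV_def)
  qed
qed

lemma AE_grad_newton:
  assumes f: "integrable lborel f"
  shows "AE z in lborel. grad (newton f) z = newton_field f z"
proof -
  have "AE z in lborel. \<forall>i\<in>UNIV. ((\<lambda>h. newton f (z + h *\<^sub>R axis i 1)) has_real_derivative newton_field f z $ i) (at 0)"
    using AE_newton_partial_derivative[OF f] by (intro AE_finite_allI) auto
  then show ?thesis
    by eventually_elim (auto simp: grad_def vec_eq_iff DERIV_imp_deriv)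
qed

lemma AE_field_diff:
  assumes f: "integrable lborel f" and g: "integrable lborel g"
  shows "AE x in lborel. newton_field f x - newton_field g x = newton_field (\<lambda>x. f x - g x) x"
proof -
  have [measurable]: "f \<in> borel_measurable borel" "g \<in> borel_measurable borel" using f g by auto
  show ?thesis
    using AE_riesz2_finite[OF f] AE_riesz2_finite[OF g]
  proof eventually_elim
    case (elim x)
    have "integrable lborel (\<lambda>y. f y * ((x $ i - y $ i) / (dist x y)^3))" for i
      by (rule riesz2_finite_integrable[OF _ elim(1) _ newton_field_kernel_bound]) measurable
    moreover have "integrable lborel (\<lambda>y. g y * ((x $ i - y $ i) / (dist x y)^3))" for i
      by (rule riesz2_finite_integrable[OF _ elim(2) _ newton_field_kernel_bound]) measurable
    ultimately show ?case
      by (simp add: newton_field_def vec_eq_iff left_diff_distrib diff_divide_distrib)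
  qed
qed

lemma L2sq_grad_newton_diff:
  assumes f: "density_class f" and g: "density_class g"
  shows "L2sq (\<lambda>x. grad (newton f) x - grad (newton g) x) = gradC * coulD (\<lambda>x. f x - g x) (\<lambda>x. f x - g x)"
proof -
  note [measurable] = density_classD[OF f] density_classD[OF g]
  note fi = density_class_integrable[OF f] and gi = density_class_integrable[OF g]
  let ?F = "\<lambda>x. (norm (newton_field (\<lambda>x. f x - g x) x))\<^sup>2"
  have m [measurable]: "?F \<in> borel_measurable borel"
    unfolding power2_norm_eq_inner inner_vec_def by measurable
  have ae: "AE x in lebesgue. ?F x = (norm (grad (newton f) x - grad (newton g) x))\<^sup>2"
    unfolding AE_completion_iff
    using AE_field_diff[OF fi gi] AE_grad_newton[OF fi] AE_grad_newton[OF gi] by eventually_elim simp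
  have m': "?F \<in> borel_measurable lebesgue" using m by (simp add: measurable_completion)
  have "L2sq (\<lambda>x. grad (newton f) x - grad (newton g) x) = (\<integral>x. ?F x \<partial>lebesgue)"
    unfolding L2sq_def
  proof (rule integral_cong_AE[symmetric])
    \<comment> \<open>Where no derivative exists, \<open>deriv\<close> has an arbitrary value.
      Measurability comes from completeness of the Lebesgue measure and equality almost everywhere
      with a Borel function.\<close>
    show "(\<lambda>x. (norm (grad (newton f) x - grad (newton g) x))\<^sup>2) \<in> borel_measurable lebesgue"
      using m' ae by (rule borel_measurable_AE)
  qed (use m' ae in auto)
  also have "\<dots> = (\<integral>x. ?F x \<partial>lborel)" by (rule integral_completion) measurable
  also have "\<dots> = gradC * coulD (\<lambda>x. f x - g x) (\<lambda>x. f x - g x)"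
    by (rule integral_field_square[OF density_class_diff[OF f g]])
  finally show ?thesis .
qed

section \<open>The energy functional\<close>

lemma integral_const_ball:
  assumes "L > 0"
  shows "integrable lborel (\<lambda>x::real^3. c * indicator (ball 0 L) x :: real)"
    "(\<integral>x. c * indicator (ball (0::real^3) L) x \<partial>lborel) = c * (vol1 * L^3)"
proof -
  have e: "emeasure lborel (ball (0::real^3) L) = ennreal (vol1 * L^3)" using assms by (simp add: emeasure_ball3)
  show "integrable lborel (\<lambda>x::real^3. c * indicator (ball 0 L) x :: real)"
    by (intro Bochner_Integration.integrable_mult_right integrable_real_indicator) (use e in auto)
  have "measure lborel (ball (0::real^3) L) = vol1 * L^3"
    using e assms by (intro measure_eq_emeasure_eq_ennreal) auto
  then show "(\<integral>x. c * indicator (ball (0::real^3) L) x \<partial>lborel) = c * (vol1 * L^3)" by simp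
qed

text \<open>With \<open>a^3\<close> and \<open>b^3\<close> the mass fractions, \<open>a^5\<close>
  and \<open>b^5\<close> are the energy fractions. For each summand the difference of the two sides
  factors as \<open>x^3 * (1 - x)\<^sup>2 * (1 + 2 * x) / 3\<close>, and the two coefficients
  \<open>2/3\<close> add up to \<open>4/3\<close>.\<close>

lemma pow5_split:
  fixes a b :: real
  assumes "0 \<le> a" "0 \<le> b" "a^3 + b^3 = 1"
  shows "a^5 + b^5 \<le> 1 - (4/3) * (a^3 * b^3)"
proof -
  have *: "x^5 \<le> x^3 - (2/3) * (x^3 * (1 - x^3))" if "0 \<le> x" "x^3 \<le> 1" for x :: real
  proof -
    have "x^3 * (1 - x\<^sup>2 - (2/3) * (1 - x^3)) = x^3 * ((1 - x)\<^sup>2 * (1 + 2 * x) / 3)"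
      by (simp add: field_simps eval_nat_numeral)
    also have "\<dots> \<ge> 0" using that by simp
    finally have "0 \<le> x^3 * (1 - x\<^sup>2 - (2/3) * (1 - x^3))" .
    moreover have "x^3 * (1 - x\<^sup>2 - (2/3) * (1 - x^3)) = x^3 - x^5 - (2/3) * (x^3 * (1 - x^3))"
      by (simp add: field_simps eval_nat_numeral)
    ultimately show ?thesis by linarith
  qed
  have "a^3 \<ge> 0" "b^3 \<ge> 0" using assms by auto
  then have "a^3 \<le> 1" "b^3 \<le> 1" using assms(3) by linarith+
  then have "a^5 \<le> a^3 - (2/3) * (a^3 * (1 - a^3))" "b^5 \<le> b^3 - (2/3) * (b^3 * (1 - b^3))"
    using *[OF assms(1)] *[OF assms(2)] by blast+
  moreover have "1 - a^3 = b^3" "1 - b^3 = a^3" using assms by auto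
  ultimately show ?thesis using assms(3) by (simp add: mult.commute)
qed

section \<open>Admissible densities\<close>

text \<open>\<open>Phi_super\<close> is the condition \<open>n < 3\<close> in usable form: the power
  \<open>4/3\<close> is at most an arbitrarily small multiple of \<open>\<Phi>\<close> plus a linear
  term, which integrates to a multiple of the mass.\<close>

locale polytrope =
  fixes \<Phi> :: "real \<Rightarrow> real"
  assumes Phi_cont: "continuous_on {0..} \<Phi>"
    and Phi_zero: "\<Phi> 0 = 0"
    and Phi_nonneg: "r \<ge> 0 \<Longrightarrow> \<Phi> r \<ge> 0"
    and Phi_strict: "strictly_convex_on {0..} \<Phi>"
    and Phi_super: "e > 0 \<Longrightarrow> \<exists>C\<ge>0. \<forall>r\<ge>0. r powr (4/3) \<le> e * \<Phi> r + C * r"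
    and Phi_sub: "\<exists>C>0. \<exists>n'. 0 < n' \<and> n' < 3 \<and>
                      (\<exists>r0>0. \<forall>r. 0 \<le> r \<and> r \<le> r0 \<longrightarrow> \<Phi> r \<le> C * r powr (1 + 1/n'))"
begin

text \<open>The counterpart of \<open>FM\<close> for Borel functions and \<open>lborel\<close>;
  \<open>rep\<close> connects the two.\<close>

definition adm :: "real \<Rightarrow> (real^3 \<Rightarrow> real) \<Rightarrow> bool" where
  "adm m \<rho> \<longleftrightarrow> \<rho> \<in> borel_measurable borel \<and> (\<forall>x. 0 \<le> \<rho> x) \<and> integrable lborel \<rho>
     \<and> integrable lborel (\<lambda>x. \<Phi> (\<rho> x)) \<and> (\<integral>x. \<rho> x \<partial>lborel) = m"

definition Int_Phi :: "(real^3 \<Rightarrow> real) \<Rightarrow> real" where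
  "Int_Phi \<rho> = (\<integral>x. \<Phi> (\<rho> x) \<partial>lborel)"

definition En :: "(real^3 \<Rightarrow> real) \<Rightarrow> real" where
  "En \<rho> = Int_Phi \<rho> - coulD \<rho> \<rho> / 2"

lemma admD:
  assumes "adm m \<rho>"
  shows "\<rho> \<in> borel_measurable borel" "\<And>x. 0 \<le> \<rho> x" "integrable lborel \<rho>"
    "integrable lborel (\<lambda>x. \<Phi> (\<rho> x))" "(\<integral>x. \<rho> x \<partial>lborel) = m"
  using assms by (auto simp: adm_def)

text \<open>Continuity of \<open>\<Phi>\<close> is known on the half-line only, so it is first
  composed with \<open>max 0\<close>.\<close>

lemma Phi_measurable:
  assumes [measurable]: "\<rho> \<in> borel_measurable N" and "\<And>x. 0 \<le> \<rho> x"
  shows "(\<lambda>x. \<Phi> (\<rho> x)) \<in> borel_measurable N"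
proof -
  have "continuous_on UNIV (\<lambda>r. \<Phi> (max 0 r))"
    by (rule continuous_on_compose2[OF Phi_cont]) (auto intro!: continuous_intros)
  then have [measurable]: "(\<lambda>r. \<Phi> (max 0 r)) \<in> borel_measurable borel"
    by (rule borel_measurable_continuous_onI)
  have "(\<lambda>x. \<Phi> (max 0 (\<rho> x))) \<in> borel_measurable N" by measurable
  then show ?thesis using assms(2) by (simp add: max_def)
qed

lemma adm_mass_nonneg: "adm m \<rho> \<Longrightarrow> m \<ge> 0"
  using admD[of m \<rho>] Bochner_Integration.integral_nonneg[of lborel \<rho>] by simp

lemma Int_Phi_nonneg: "adm m \<rho> \<Longrightarrow> Int_Phi \<rho> \<ge> 0"
  unfolding Int_Phi_def using admD(2) by (intro Bochner_Integration.integral_nonneg Phi_nonneg) auto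

lemma
  assumes a: "adm m \<rho>"
  shows adm_density_class: "density_class \<rho>"
    and N43_le_super: "(\<And>r. r \<ge> 0 \<Longrightarrow> r powr (4/3) \<le> e * \<Phi> r + C * r) \<Longrightarrow> N43 \<rho> \<le> e * Int_Phi \<rho> + C * m"
proof -
  note ad = admD[OF a]
  note [measurable] = ad(1)
  have *: "integrable lborel (\<lambda>x. \<bar>\<rho> x\<bar> powr (4/3)) \<and> N43 \<rho> \<le> e * Int_Phi \<rho> + C * m"
    if le: "\<And>r. r \<ge> 0 \<Longrightarrow> r powr (4/3) \<le> e * \<Phi> r + C * r" for e C
  proof
    have i: "integrable lborel (\<lambda>x. e * \<Phi> (\<rho> x) + C * \<rho> x)" using ad by simp
    have p: "\<bar>\<rho> x\<bar> powr (4/3) \<le> e * \<Phi> (\<rho> x) + C * \<rho> x" for x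
      using le[of "\<rho> x"] ad(2)[of x] by simp
    show j: "integrable lborel (\<lambda>x. \<bar>\<rho> x\<bar> powr (4/3))"
    proof (rule Bochner_Integration.integrable_bound[OF i])
      show "AE x in lborel. norm (\<bar>\<rho> x\<bar> powr (4/3)) \<le> norm (e * \<Phi> (\<rho> x) + C * \<rho> x)"
        using p by (intro AE_I2) (smt (verit) powr_ge_zero real_norm_def)
    qed measurable
    have "N43 \<rho> \<le> (\<integral>x. e * \<Phi> (\<rho> x) + C * \<rho> x \<partial>lborel)"
      unfolding N43_def by (intro integral_mono j i p)
    also have "\<dots> = e * Int_Phi \<rho> + C * m" using ad by (simp add: Int_Phi_def)
    finally show "N43 \<rho> \<le> e * Int_Phi \<rho> + C * m" .
  qed
  obtain C1 where "\<forall>r\<ge>0. r powr (4/3) \<le> 1 * \<Phi> r + C1 * r" using Phi_super[of 1] by auto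
  then show "density_class \<rho>" unfolding density_class_def using *[of 1 C1] ad by auto
  show "(\<And>r. r \<ge> 0 \<Longrightarrow> r powr (4/3) \<le> e * \<Phi> r + C * r) \<Longrightarrow> N43 \<rho> \<le> e * Int_Phi \<rho> + C * m"
    using *[of e C] by auto
qed

lemma adm_shift:
  assumes a: "adm m \<rho>"
  shows "adm m (\<lambda>x. \<rho> (x + a))" "En (\<lambda>x. \<rho> (x + a)) = En \<rho>"
proof -
  note ad = admD[OF a]
  have Pm: "(\<lambda>x. \<Phi> (\<rho> x)) \<in> borel_measurable borel" by (rule Phi_measurable) (use ad in auto)
  note [measurable] = ad(1) Pm
  show "adm m (\<lambda>x. \<rho> (x + a))"
    unfolding adm_def using ad integral_lborel_shift[OF ad(1), of a] integrable_lborel_shift[OF ad(1), of a]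
      integrable_lborel_shift[OF Pm, of a] by auto
  show "En (\<lambda>x. \<rho> (x + a)) = En \<rho>"
    unfolding En_def Int_Phi_def using integral_lborel_shift[OF Pm, of a] coulD_shift[OF adm_density_class[OF a] adm_density_class[OF a], of a] by simp
qed

section \<open>Coercivity and negativity of the energy\<close>

text \<open>In \<open>coulD_le\<close> the choice \<open>s = t = 1 / q\<close> with
  \<open>q = N43 \<rho> + 1\<close> makes each of the three terms at most a constant times
  \<open>q\<close>. Linear growth in \<open>N43 \<rho>\<close> is what \<open>Phi_super\<close> can
  absorb.\<close>

lemma coulD_le_N43:
  assumes a: "adm m \<rho>" and m: "m \<le> M"
  shows "coulD \<rho> \<rho> \<le> (1/2 + 3 * vol1 / 2 + M\<^sup>2) * (N43 \<rho> + 1)"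
proof -
  note ad = admD[OF a]
  let ?N = "N43 \<rho>"
  define q where "q = ?N + 1"
  have q: "q > 0" "?N \<le> q" "0 \<le> ?N" using N43_nonneg[of \<rho>] by (auto simp: q_def)
  have "coulD \<rho> \<rho> \<le> (1/q)/2 * (?N * ?N) + 3 * vol1 * (1/q) / (4 * (1/q)) * (?N + ?N) + m * m / (1/q)"
    using coulD_le[OF adm_density_class[OF a] adm_density_class[OF a] ad(2) ad(2), of "1/q" "1/q"] q ad(5) by simp
  moreover have "(1/q)/2 * (?N * ?N) \<le> 1/2 * q"
  proof -
    have "?N * ?N \<le> q * q" using q by (intro mult_mono) auto
    then show ?thesis using q by (simp add: field_simps)
  qed
  moreover have "3 * vol1 * (1/q) / (4 * (1/q)) * (?N + ?N) \<le> 3 * vol1 / 2 * q"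
    using q by (simp add: mult_left_mono)
  moreover have "m * m / (1/q) \<le> M\<^sup>2 * q"
    using q m adm_mass_nonneg[OF a] by (auto simp: power2_eq_square intro!: mult_mono)
  ultimately show ?thesis unfolding q_def[symmetric] by (simp add: distrib_right)
qed

text \<open>\<open>Phi_super\<close> with \<open>e = 1 / K\<close> turns the previous bound into
  \<open>coulD \<rho> \<rho> \<le> Int_Phi \<rho>\<close> up to a constant, so half of the internal
  energy survives in \<open>En\<close>.\<close>

lemma Int_Phi_le_En:
  shows "\<exists>B\<ge>0. \<forall>m \<rho>. adm m \<rho> \<longrightarrow> m \<le> M \<longrightarrow> Int_Phi \<rho> \<le> 2 * En \<rho> + B"
proof -
  define K where "K = 1/2 + 3 * vol1 / 2 + M\<^sup>2"
  have K: "K > 0" unfolding K_def by (intro add_pos_nonneg) auto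
  obtain C where C: "C \<ge> 0" "\<forall>r\<ge>0. r powr (4/3) \<le> (1/K) * \<Phi> r + C * r"
    using Phi_super[of "1/K"] K by auto
  have "Int_Phi \<rho> \<le> 2 * En \<rho> + K * (C * \<bar>M\<bar> + 1)" if a: "adm m \<rho>" and m: "m \<le> M" for m \<rho>
  proof -
    have "N43 \<rho> \<le> (1/K) * Int_Phi \<rho> + C * m" using N43_le_super[OF a, of "1/K" C] C by blast
    also have "C * m \<le> C * \<bar>M\<bar>" using C m by (intro mult_left_mono) auto
    finally have "K * (N43 \<rho> + 1) \<le> K * ((1/K) * Int_Phi \<rho> + C * \<bar>M\<bar> + 1)" using K by (intro mult_left_mono) auto
    also have "\<dots> = Int_Phi \<rho> + K * (C * \<bar>M\<bar> + 1)" using K by (simp add: algebra_simps)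
    finally have "coulD \<rho> \<rho> \<le> Int_Phi \<rho> + K * (C * \<bar>M\<bar> + 1)"
      using coulD_le_N43[OF a m] unfolding K_def by linarith
    then show ?thesis by (simp add: En_def)
  qed
  moreover have "K * (C * \<bar>M\<bar> + 1) \<ge> 0" using K C by simp
  ultimately show ?thesis by blast
qed

lemma N43_bounded:
  "\<exists>N0>0. \<forall>\<rho>. adm M \<rho> \<longrightarrow> En \<rho> \<le> E \<longrightarrow> N43 \<rho> \<le> N0"
proof -
  obtain B where B: "\<And>\<rho>. adm M \<rho> \<Longrightarrow> Int_Phi \<rho> \<le> 2 * En \<rho> + B"
    using Int_Phi_le_En[of M] by blast
  obtain C where C: "C \<ge> 0" "\<forall>r\<ge>0. r powr (4/3) \<le> 1 * \<Phi> r + C * r" using Phi_super[of 1] by auto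
  have "N43 \<rho> \<le> \<bar>2 * E + B + C * M\<bar> + 1" if a: "adm M \<rho>" "En \<rho> \<le> E" for \<rho>
    using N43_le_super[OF a(1), of 1 C] C B[OF a(1)] a(2) by force
  then show ?thesis by (intro exI[of _ "\<bar>2 * E + B + C * M\<bar> + 1"]) auto
qed

text \<open>For a constant density on a ball of radius \<open>L\<close> the internal energy is of order \<open>L powr (- 3 / n')\<close>,
  while the potential energy is of order \<open>- 1 / L\<close>; the former is negligible for large \<open>L\<close> as \<open>n' < 3\<close>.\<close>

lemma En_negative:
  assumes M: "M > 0"
  shows "\<exists>\<rho>. adm M \<rho> \<and> En \<rho> < 0"
proof -
  obtain C n' r0 where C: "C > 0" and n': "0 < n'" "n' < 3" and r0: "r0 > 0"
    and sub: "\<And>r. 0 \<le> r \<Longrightarrow> r \<le> r0 \<Longrightarrow> \<Phi> r \<le> C * r powr (1 + 1/n')"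
    using Phi_sub by blast
  have v: "vol1 > 0" by simp
  have v3: "unit_ball_vol 3 \<noteq> (0::real)" using unit_ball_vol_pos[of 3] by linarith
  have "((\<lambda>L. M / (vol1 * L^3)) \<longlongrightarrow> 0) at_top"
    using v by (intro tendsto_divide_0[OF tendsto_const] filterlim_at_top_imp_at_infinity
      filterlim_tendsto_pos_mult_at_top[OF tendsto_const] filterlim_pow_at_top filterlim_ident) auto
  then have ev1: "eventually (\<lambda>L. M / (vol1 * L^3) < r0) at_top" using r0 by (rule order_tendstoD)
  have "((\<lambda>L. C * (M / vol1) powr (1/n') * L powr (1 - 3/n')) \<longlongrightarrow> 0) at_top"
    using n' by (intro tendsto_mult_right_zero tendsto_neg_powr filterlim_ident) (auto simp: field_simps)
  moreover have "M / 4 > 0" using M by simp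
  ultimately have ev2: "eventually (\<lambda>L. C * (M / vol1) powr (1/n') * L powr (1 - 3/n') < M / 4) at_top"
    by (rule order_tendstoD)
  obtain L where L: "L > 0" "M / (vol1 * L^3) < r0" "C * (M / vol1) powr (1/n') * L powr (1 - 3/n') < M / 4"
    using eventually_happens[OF eventually_conj[OF eventually_gt_at_top[of 0] eventually_conj[OF ev1 ev2]]] by auto
  define c where "c = M / (vol1 * L^3)"
  have c: "c > 0" "c < r0" "c * (vol1 * L^3) = M" using M L v v3 by (auto simp: c_def)
  define \<rho> where "\<rho> x = c * indicator (ball (0::real^3) L) x" for x
  note ib = integral_const_ball[OF L(1)]
  have P: "\<Phi> (\<rho> x) = \<Phi> c * indicator (ball 0 L) x" for x by (auto simp: \<rho>_def indicator_def Phi_zero)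
  have [measurable]: "ball (0::real^3) L \<in> sets borel" by simp
  have a: "adm M \<rho>"
    unfolding adm_def P using ib[of c] ib[of "\<Phi> c"] c by (auto simp: \<rho>_def[abs_def])
  have J: "Int_Phi \<rho> = \<Phi> c * (vol1 * L^3)" unfolding Int_Phi_def P by (rule ib)
  have ceq: "c = (M / vol1) * L powr (-3)"
    unfolding c_def powr_neg_numeral[OF L(1)] by simp
  have "c powr (1/n') = (M / vol1) powr (1/n') * (L powr (-3)) powr (1/n')"
    unfolding ceq by (rule powr_mult)
  then have c_powr: "c powr (1/n') = (M / vol1) powr (1/n') * L powr (- 3/n')" by (simp add: powr_powr)
  have "\<Phi> c \<le> C * c powr (1 + 1/n')" using sub[of c] c by linarith
  moreover have "c powr (1 + 1/n') = c * c powr (1/n')" using c(1) by (simp add: powr_add)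
  ultimately have Phi_c: "\<Phi> c \<le> C * c * ((M / vol1) powr (1/n') * L powr (- 3/n'))"
    by (simp only: c_powr mult.assoc)
  have "Int_Phi \<rho> \<le> (C * c * ((M / vol1) powr (1/n') * L powr (- 3/n'))) * (vol1 * L^3)"
    unfolding J using L by (intro mult_right_mono Phi_c) auto
  also have "\<dots> = M * (C * (M / vol1) powr (1/n') * L powr (- 3/n'))"
    unfolding c(3)[symmetric] by (simp add: mult_ac)
  also have "\<dots> = M * (C * (M / vol1) powr (1/n') * L powr (1 - 3/n')) / L"
    using L powr_add[of L 1 "- 3/n'"] by simp
  also have "\<dots> < M * (M / 4) / L"
    using L M by (intro divide_strict_right_mono mult_strict_left_mono)
  finally have J': "Int_Phi \<rho> < M\<^sup>2 / (4 * L)" by (simp add: power2_eq_square)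
  have d: "density_class \<rho>" by (rule adm_density_class[OF a])
  note i2 = integrable_prod_mult[OF density_class_integrable[OF d] density_class_integrable[OF d]]
  \<comment> \<open>Points of the ball are at distance at most \<open>2 * L\<close>, so half the
    interaction energy is at least \<open>M\<^sup>2 / (4 * L)\<close>, and \<open>L\<close> was
    chosen to keep the internal energy below exactly this.\<close>
  have "(\<integral>p. \<rho> (fst p) * \<rho> (snd p) * (1 / (2 * L)) \<partial>R3R3) \<le> coulD \<rho> \<rho>"
    unfolding coulD_def
  proof (rule integral_mono_AE)
    show "integrable R3R3 (\<lambda>p. \<rho> (fst p) * \<rho> (snd p) * (1 / (2 * L)))" using i2(1) by simp
    show "AE p in R3R3. \<rho> (fst p) * \<rho> (snd p) * (1 / (2 * L)) \<le> \<rho> (fst p) * \<rho> (snd p) / dist (fst p) (snd p)"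
      using AE_R3R3_neq
    proof eventually_elim
      case (elim p)
      show ?case
      proof (cases "fst p \<in> ball 0 L \<and> snd p \<in> ball 0 L")
        case True
        then have "dist (fst p) (snd p) \<le> 2 * L"
          using dist_triangle[of "fst p" "snd p" 0] by (auto simp: dist_commute)
        then have "1 / (2 * L) \<le> 1 / dist (fst p) (snd p)" using elim L by (intro divide_left_mono) auto
        then have "\<rho> (fst p) * \<rho> (snd p) * (1 / (2 * L)) \<le> \<rho> (fst p) * \<rho> (snd p) * (1 / dist (fst p) (snd p))"
          using admD(2)[OF a] by (intro mult_left_mono) auto
        then show ?thesis by simp
      qed (auto simp: \<rho>_def)
    qed
  qed (rule integrable_coulD[OF d d])
  then have "M\<^sup>2 / (2 * L) \<le> coulD \<rho> \<rho>" using i2(2) admD(5)[OF a] by (simp add: power2_eq_square)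
  moreover have "M\<^sup>2 / (2 * L) / 2 = M\<^sup>2 / (4 * L)" by simp
  ultimately have "En \<rho> < 0" using J' unfolding En_def by linarith
  then show ?thesis using a by blast
qed

section \<open>Scaling and splitting of the infimum\<close>

text \<open>The dilation by \<open>b\<close> restores the mass \<open>M\<close>. It changes the
  interaction by \<open>b^5\<close> but the internal energy by \<open>b^3\<close> only;
  \<open>b \<le> 1\<close> and \<open>Int_Phi \<rho> \<ge> 0\<close> make the mismatch favourable.
  Taking the cube root \<open>b\<close> of the mass fraction as parameter avoids fractional
  powers.\<close>

lemma En_scaling:
  assumes h: "\<And>\<sigma>. adm M \<sigma> \<Longrightarrow> h \<le> En \<sigma>" and a: "adm (b^3 * M) \<rho>" and b: "0 < b" "b \<le> 1"
  shows "b^5 * h \<le> En \<rho>"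
proof -
  note ad = admD[OF a]
  note [measurable] = ad(1)
  have Pm [measurable]: "(\<lambda>x. \<Phi> (\<rho> x)) \<in> borel_measurable borel" by (rule Phi_measurable) (use ad in auto)
  let ?s = "\<lambda>x. \<rho> (b *\<^sub>R x)"
  have J: "Int_Phi \<rho> = b^3 * Int_Phi ?s"
    using integral_lborel_affine[OF Pm, of b 0] b by (simp add: Int_Phi_def)
  have m: "(\<integral>x. ?s x \<partial>lborel) = M"
    using integral_lborel_affine[OF ad(1), of b 0] b ad(5) by simp
  have "adm M ?s"
    unfolding adm_def using m ad b integrable_lborel_affine[OF ad(1), of b 0] integrable_lborel_affine[OF Pm, of b 0] by simp
  then have "h \<le> Int_Phi ?s - coulD ?s ?s / 2" using h by (simp add: En_def)
  then have "b^5 * h \<le> b^5 * (Int_Phi ?s - coulD ?s ?s / 2)" using b by (intro mult_left_mono) auto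
  also have "\<dots> = b^2 * Int_Phi \<rho> - coulD \<rho> \<rho> / 2"
    unfolding J coulD_scale[OF adm_density_class[OF a] b(1)] by (simp add: algebra_simps flip: power_add)
  also have "b^2 * Int_Phi \<rho> \<le> 1 * Int_Phi \<rho>"
    using b Int_Phi_nonneg[OF a] by (intro mult_right_mono) (auto simp: power_le_one)
  finally show ?thesis by (simp add: En_def)
qed

lemma adm_restrict:
  assumes a: "adm m \<rho>" and A: "A \<in> sets borel"
  shows "adm (\<integral>x. \<rho> x * indicator A x \<partial>lborel) (\<lambda>x. \<rho> x * indicator A x)"
    and "Int_Phi (\<lambda>x. \<rho> x * indicator A x) = (\<integral>x. \<Phi> (\<rho> x) * indicator A x \<partial>lborel)"
proof -
  note ad = admD[OF a]
  note [measurable] = ad(1) A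
  have [simp]: "\<Phi> (\<rho> x * indicator A x) = \<Phi> (\<rho> x) * indicator A x" for x by (auto simp: indicator_def Phi_zero)
  show "adm (\<integral>x. \<rho> x * indicator A x \<partial>lborel) (\<lambda>x. \<rho> x * indicator A x)"
    unfolding adm_def using ad
    by (auto intro!: integrable_real_mult_indicator)
  show "Int_Phi (\<lambda>x. \<rho> x * indicator A x) = (\<integral>x. \<Phi> (\<rho> x) * indicator A x \<partial>lborel)"
    by (simp add: Int_Phi_def)
qed

text \<open>Both pieces obey \<open>En_scaling\<close>, and \<open>pow5_split\<close> turns the gain
  from strict subadditivity into a multiple of the product of the masses. A near-minimizer can thus
  be cut into two substantial pieces only if they interact strongly.\<close>

lemma En_split:
  assumes h: "\<And>\<sigma>. adm M \<sigma> \<Longrightarrow> h \<le> En \<sigma>" and M: "M > 0" and hneg: "h < 0"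
    and a: "adm M \<rho>" and A: "A \<in> sets borel"
  shows "(- h) / M\<^sup>2 * ((\<integral>x. \<rho> x * indicator A x \<partial>lborel) * (\<integral>x. \<rho> x * indicator (- A) x \<partial>lborel))
     \<le> En \<rho> - h + coulD (\<lambda>x. \<rho> x * indicator A x) (\<lambda>x. \<rho> x * indicator (- A) x)"
proof -
  note ad = admD[OF a]
  note [measurable] = ad(1) A
  let ?a = "\<lambda>x. \<rho> x * indicator A x" and ?b = "\<lambda>x. \<rho> x * indicator (- A) x"
  let ?ma = "\<integral>x. ?a x \<partial>lborel" and ?mb = "\<integral>x. ?b x \<partial>lborel"
  have A': "- A \<in> sets borel" using A by auto
  note ra = adm_restrict[OF a A] and rb = adm_restrict[OF a A']
  have da: "density_class ?a" and db: "density_class ?b" using ra rb adm_density_class by blast+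
  have sum: "?a x + ?b x = \<rho> x" for x by (auto simp: indicator_def)
  have mm: "?ma + ?mb = M"
    using Bochner_Integration.integral_add[OF admD(3)[OF ra(1)] admD(3)[OF rb(1)]] ad(5) by (simp add: sum)
  have nn: "?ma \<ge> 0" "?mb \<ge> 0" using adm_mass_nonneg ra(1) rb(1) by auto
  have D0: "coulD ?a ?b \<ge> 0" using ad(2) by (intro coulD_nonneg) auto
  have J: "Int_Phi \<rho> = Int_Phi ?a + Int_Phi ?b"
  proof -
    have "Int_Phi ?a + Int_Phi ?b = (\<integral>x. \<Phi> (\<rho> x) * indicator A x + \<Phi> (\<rho> x) * indicator (- A) x \<partial>lborel)"
      unfolding ra(2) rb(2) using ad(4)
      by (intro Bochner_Integration.integral_add[symmetric] integrable_real_mult_indicator) auto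
    also have "\<dots> = Int_Phi \<rho>"
      unfolding Int_Phi_def by (intro Bochner_Integration.integral_cong) (auto simp: indicator_def)
    finally show ?thesis by simp
  qed
  have "coulD \<rho> \<rho> = coulD (\<lambda>x. ?a x + ?b x) (\<lambda>x. ?a x + ?b x)" by (simp add: sum)
  also have "\<dots> = coulD ?a ?a + coulD ?b ?b + 2 * coulD ?a ?b"
    using da db by (simp only: coulD_add_left coulD_add_right density_class_add coulD_commute[of ?b ?a])
  finally have En: "En \<rho> = En ?a + En ?b - coulD ?a ?b"
    using J unfolding En_def by linarith
  show ?thesis
  \<comment> \<open>A piece without mass cannot be dilated to mass \<open>M\<close>; in that case
    the left side is \<open>0\<close>.\<close>
  proof (cases "?ma = 0 \<or> ?mb = 0")
    case True
    then show ?thesis using h[OF a] D0 by auto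
  next
    case False
    with nn have pos: "?ma > 0" "?mb > 0" by auto
    define p q where "p = root 3 (?ma / M)" and "q = root 3 (?mb / M)"
    have p3: "p^3 = ?ma / M" and q3: "q^3 = ?mb / M" and pq: "p > 0" "q > 0"
      using pos M by (auto simp: p_def q_def)
    have s1: "p^3 + q^3 = 1" using mm M by (simp add: p3 q3 flip: add_divide_distrib)
    have le1: "x \<le> 1" if "x > 0" "x^3 \<le> 1" for x :: real
    proof (rule ccontr)
      assume "\<not> x \<le> 1" then have "x^3 > 1" by (simp add: one_less_power)
      with that show False by simp
    qed
    have "p^3 \<le> 1" "q^3 \<le> 1"
      using s1 zero_less_power[OF pq(1), of 3] zero_less_power[OF pq(2), of 3] by linarith+
    then have "p \<le> 1" "q \<le> 1" using pq le1 by blast+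
    have aa: "adm (p^3 * M) ?a" and bb: "adm (q^3 * M) ?b" using ra(1) rb(1) M by (simp_all add: p3 q3)
    have "p^5 * h \<le> En ?a" "q^5 * h \<le> En ?b"
      using En_scaling[OF h aa] En_scaling[OF h bb] pq \<open>p \<le> 1\<close> \<open>q \<le> 1\<close> by auto
    then have "(p^5 + q^5) * h - coulD ?a ?b \<le> En \<rho>" unfolding En by (simp add: distrib_right)
    moreover have "(1 - (4/3) * (p^3 * q^3)) * h \<le> (p^5 + q^5) * h"
      using pow5_split[of p q] pq s1 hneg by (intro mult_right_mono_neg) auto
    ultimately have "(4/3) * ((- h) * (p^3 * q^3)) \<le> En \<rho> - h + coulD ?a ?b" by (simp add: algebra_simps)
    moreover have "0 \<le> (- h) * (p^3 * q^3)" using hneg pq by (intro mult_nonneg_nonneg) auto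
    ultimately have "(- h) * (p^3 * q^3) \<le> En \<rho> - h + coulD ?a ?b" by linarith
    then show ?thesis unfolding p3 q3 by (simp add: power2_eq_square)
  qed
qed

end

section \<open>Concentration of minimizing sequences\<close>

lemma near_eq_indicator: "near R x y = indicator (ball x R) y"
  by (simp add: near_def indicator_def)

text \<open>First \<open>s\<close> is chosen so that the product term is at most
  \<open>e / 2\<close>, then \<open>t\<close> so that the singular term is too. The radius
  \<open>t\<close> therefore depends on \<open>N0\<close> and \<open>e\<close> but not on the
  functions.\<close>

lemma coulD_split_uniform:
  assumes N0: "N0 > 0" and e: "e > 0"
  obtains t where "t > 0"
    "\<And>f g G B. \<lbrakk>density_class f; density_class g; \<And>x. 0 \<le> f x; \<And>x. 0 \<le> g x; N43 f \<le> N0; N43 g \<le> N0;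
       G \<in> borel_measurable R3R3; \<And>p. \<bar>G p\<bar> \<le> B; \<And>p. (1 - near t (fst p) (snd p)) / dist (fst p) (snd p) \<le> G p\<rbrakk>
       \<Longrightarrow> coulD f g \<le> e + (\<integral>p. f (fst p) * g (snd p) * G p \<partial>R3R3)"
proof -
  define s where "s = e / (N0 * N0)"
  define t where "t = e * s / (3 * vol1 * N0)"
  have v: "vol1 > 0" using unit_ball_vol_pos[of "real DIM(real^3)"] by simp
  have cancel: "c * (x / c) = x" if "c \<noteq> 0" for c x :: real using that by simp
  have s: "s > 0" and t: "t > 0" using N0 e v by (auto simp: s_def t_def)
  have s2: "s/2 * (N0 * N0) = e / 2" using N0 by (simp add: s_def)
  have vN: "3 * vol1 * N0 > 0" using v N0 by (intro mult_pos_pos) auto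
  have "3 * vol1 * t / (4 * s) * (N0 + N0) = (3 * vol1 * N0) * t / (2 * s)" using s by (simp add: field_simps)
  also have "(3 * vol1 * N0) * t = e * s" unfolding t_def by (rule cancel) (use vN in linarith)
  also have "e * s / (2 * s) = e / 2" using s by simp
  finally have t2: "3 * vol1 * t / (4 * s) * (N0 + N0) = e / 2" .
  show ?thesis
  proof (rule that[OF t])
    fix f g G B
    assume f: "density_class f" and g: "density_class g" and f0: "\<And>x. 0 \<le> f x" and g0: "\<And>x. 0 \<le> g x"
      and Nf: "N43 f \<le> N0" and Ng: "N43 g \<le> N0" and G: "G \<in> borel_measurable R3R3" "\<And>p. \<bar>G p\<bar> \<le> B"
      "\<And>p. (1 - near t (fst p) (snd p)) / dist (fst p) (snd p) \<le> G p"
    have "s/2 * (N43 f * N43 g) \<le> s/2 * (N0 * N0)"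
      using s Nf Ng N43_nonneg N0 by (intro mult_left_mono mult_mono) auto
    moreover have "3 * vol1 * t / (4 * s) * (N43 f + N43 g) \<le> 3 * vol1 * t / (4 * s) * (N0 + N0)"
      using s t v Nf Ng by (intro mult_left_mono add_mono) auto
    ultimately show "coulD f g \<le> e + (\<integral>p. f (fst p) * g (snd p) * G p \<partial>R3R3)"
      using coulD_split_le[OF f g f0 g0 t s G] s2 t2 by linarith
  qed
qed

text \<open>With the constant majorant \<open>1 / t\<close>, a bound on \<open>N43\<close> lets a
  small mass of one factor and a bounded mass of the other force a small interaction.\<close>

lemma coulD_uniform:
  assumes N0: "N0 > 0" and e: "e > 0"
  obtains t where "t > 0"
    "\<And>f g. \<lbrakk>density_class f; density_class g; \<And>x. 0 \<le> f x; \<And>x. 0 \<le> g x; N43 f \<le> N0; N43 g \<le> N0\<rbrakk>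
       \<Longrightarrow> coulD f g \<le> e + (\<integral>x. f x \<partial>lborel) * (\<integral>x. g x \<partial>lborel) / t"
proof -
  obtain t where t: "t > 0" and *: "\<And>f g G B. \<lbrakk>density_class f; density_class g; \<And>x. 0 \<le> f x; \<And>x. 0 \<le> g x; N43 f \<le> N0; N43 g \<le> N0;
       G \<in> borel_measurable R3R3; \<And>p. \<bar>G p\<bar> \<le> B; \<And>p. (1 - near t (fst p) (snd p)) / dist (fst p) (snd p) \<le> G p\<rbrakk>
       \<Longrightarrow> coulD f g \<le> e + (\<integral>p. f (fst p) * g (snd p) * G p \<partial>R3R3)"
    by (rule coulD_split_uniform[OF N0 e]) blast
  show ?thesis
  proof (rule that[OF t])
    fix f g assume f: "density_class f" and g: "density_class g" and f0: "\<And>x. 0 \<le> f x" and g0: "\<And>x. 0 \<le> g x"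
      and N: "N43 f \<le> N0" "N43 g \<le> N0"
    have "coulD f g \<le> e + (\<integral>p. f (fst p) * g (snd p) * (1/t) \<partial>R3R3)"
      by (rule *[OF f g f0 g0 N, of _ "1/t"]) (use t in \<open>auto simp: near_def divide_simps\<close>)
    then show "coulD f g \<le> e + (\<integral>x. f x \<partial>lborel) * (\<integral>x. g x \<partial>lborel) / t"
      using integrable_prod_mult[OF density_class_integrable[OF f] density_class_integrable[OF g]] by simp
  qed
qed

lemma coulD_separated:
  assumes f: "density_class f" and g: "density_class g" and f0: "\<And>x. 0 \<le> f x" and g0: "\<And>x. 0 \<le> g x" and L: "L > 0"
    and sep: "\<And>x y. f x \<noteq> 0 \<Longrightarrow> g y \<noteq> 0 \<Longrightarrow> L \<le> dist x y"
  shows "coulD f g \<le> (\<integral>x. f x \<partial>lborel) * (\<integral>x. g x \<partial>lborel) / L"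
proof -
  note i = integrable_prod_mult[OF density_class_integrable[OF f] density_class_integrable[OF g]]
  have "coulD f g \<le> (\<integral>p. f (fst p) * g (snd p) * (1/L) \<partial>R3R3)"
    unfolding coulD_def
  proof (intro integral_mono integrable_coulD f g)
    show "integrable R3R3 (\<lambda>p. f (fst p) * g (snd p) * (1/L))" using i by simp
    fix p
    show "f (fst p) * g (snd p) / dist (fst p) (snd p) \<le> f (fst p) * g (snd p) * (1/L)"
    proof (cases "f (fst p) = 0 \<or> g (snd p) = 0")
      case False
      then have "L \<le> dist (fst p) (snd p)" using sep by auto
      moreover from this have "0 < dist (fst p) (snd p)" using L by linarith
      ultimately have "1 / dist (fst p) (snd p) \<le> 1 / L" using L by (intro divide_left_mono) auto
      then have "f (fst p) * g (snd p) * (1 / dist (fst p) (snd p)) \<le> f (fst p) * g (snd p) * (1/L)"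
        using f0 g0 by (intro mult_left_mono) auto
      then show ?thesis by simp
    qed auto
  qed
  then show ?thesis using i by simp
qed

lemma integral_indicator_diff:
  fixes \<rho> :: "real^3 \<Rightarrow> real"
  assumes i: "integrable lborel \<rho>" and [measurable]: "A \<in> sets borel" "B \<in> sets borel" and AB: "A \<subseteq> B"
  shows "(\<integral>x. \<rho> x * indicator (B - A) x \<partial>lborel) = (\<integral>x. \<rho> x * indicator B x \<partial>lborel) - (\<integral>x. \<rho> x * indicator A x \<partial>(lborel :: (real^3) measure))"
proof -
  have "(\<integral>x. \<rho> x * indicator (B - A) x \<partial>lborel) = (\<integral>x. \<rho> x * indicator B x - \<rho> x * indicator A x \<partial>lborel)"
    using AB by (intro Bochner_Integration.integral_cong) (auto simp: indicator_def)
  also have "\<dots> = (\<integral>x. \<rho> x * indicator B x \<partial>lborel) - (\<integral>x. \<rho> x * indicator A x \<partial>lborel)"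
    using i by (intro Bochner_Integration.integral_diff integrable_real_mult_indicator) auto
  finally show ?thesis .
qed

lemma integral_indicator_mono:
  fixes \<rho> :: "real^3 \<Rightarrow> real"
  assumes i: "integrable lborel \<rho>" and "\<And>x. 0 \<le> \<rho> x" and [measurable]: "A \<in> sets borel" "B \<in> sets borel" and AB: "A \<subseteq> B"
  shows "(\<integral>x. \<rho> x * indicator A x \<partial>lborel) \<le> (\<integral>x. \<rho> x * indicator B x \<partial>(lborel :: (real^3) measure))"
  using assms by (intro integral_mono integrable_real_mult_indicator mult_left_mono) (auto simp: indicator_def)

locale polytrope_bound = polytrope +
  fixes M h :: real
  assumes M_pos: "M > 0" and En_ge: "\<And>\<sigma>. adm M \<sigma> \<Longrightarrow> h \<le> En \<sigma>"
begin

lemma h_neg: "h < 0"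
  using En_negative[OF M_pos] En_ge by force

text \<open>The energy bound forces \<open>coulD \<rho> \<rho> \<ge> - h\<close>. The singular part
  near the diagonal and the pairs beyond distance \<open>R\<close> account for at most
  \<open>- h / 4\<close> each, so pairs within distance \<open>R\<close> carry product mass at least
  \<open>- h / 2 * t\<close>. If every ball of radius \<open>R\<close> had mass at most
  \<open>d\<close>, that product mass would be at most \<open>M * d\<close>.\<close>

lemma nonvanishing:
  "\<exists>R>0. \<exists>d>0. \<forall>\<rho>. adm M \<rho> \<longrightarrow> En \<rho> \<le> h / 2 \<longrightarrow> (\<exists>a. d \<le> (\<integral>x. \<rho> x * indicator (ball a R) x \<partial>lborel))"
proof -
  obtain N0 where N0: "N0 > 0" "\<And>\<rho>. adm M \<rho> \<Longrightarrow> En \<rho> \<le> h/2 \<Longrightarrow> N43 \<rho> \<le> N0"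
    using N43_bounded[of M "h/2"] by blast
  have h4: "- h / 4 > 0" using h_neg by simp
  obtain t where t: "t > 0" and *: "\<And>f g G B. \<lbrakk>density_class f; density_class g; \<And>x. 0 \<le> f x; \<And>x. 0 \<le> g x; N43 f \<le> N0; N43 g \<le> N0;
       G \<in> borel_measurable R3R3; \<And>p. \<bar>G p\<bar> \<le> B; \<And>p. (1 - near t (fst p) (snd p)) / dist (fst p) (snd p) \<le> G p\<rbrakk>
       \<Longrightarrow> coulD f g \<le> - h / 4 + (\<integral>p. f (fst p) * g (snd p) * G p \<partial>R3R3)"
    by (rule coulD_split_uniform[OF N0(1) h4]) blast
  \<comment> \<open>\<open>R\<close> makes \<open>M * M / R\<close> equal to \<open>- h / 4\<close>;
    the choice of \<open>d\<close> makes \<open>M * d\<close> equal to \<open>t * (- h / 4)\<close>,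
    half of the product mass required.\<close>
  define R where "R = M * M / (- h / 4)"
  have R: "R > 0" using M_pos h_neg by (auto simp: R_def divide_pos_neg)
  have MR: "M * M / R = - h / 4" unfolding R_def using M_pos h_neg by simp
  define d where "d = t * (- h / 4) / M"
  have d: "d > 0" using t h_neg M_pos by (auto simp: d_def divide_neg_pos mult_pos_neg)
  show ?thesis
  proof (rule exI[of _ R], rule conjI, rule R, rule exI[of _ d], rule conjI, rule d, intro allI impI)
    fix \<rho> assume a: "adm M \<rho>" and E: "En \<rho> \<le> h / 2"
    note ad = admD[OF a]
    note [measurable] = ad(1)
    have dc: "density_class \<rho>" by (rule adm_density_class[OF a])
    \<comment> \<open>A majorant with two levels: away from the diagonal the kernel is at most
      \<open>1/t\<close>, and beyond distance \<open>R\<close> at most \<open>1/R\<close>.\<close>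
    let ?G = "\<lambda>p. near R (fst p) (snd p) * (1/t) + 1/R"
    have Gm [measurable]: "?G \<in> borel_measurable R3R3" by measurable
    have nearb: "\<bar>near R (fst p) (snd p)\<bar> \<le> 1" for p by (simp add: near_def)
    have "coulD \<rho> \<rho> \<le> - h / 4 + (\<integral>p. \<rho> (fst p) * \<rho> (snd p) * ?G p \<partial>R3R3)"
    proof (rule *[OF dc dc ad(2) ad(2) N0(2)[OF a E] N0(2)[OF a E] Gm])
      show "\<bar>?G p\<bar> \<le> 1/t + 1/R" for p using t R by (auto simp: near_def)
      show "(1 - near t (fst p) (snd p)) / dist (fst p) (snd p) \<le> ?G p" for p
      proof (cases "dist (fst p) (snd p) < t")
        case True then show ?thesis using t R by (auto simp: near_def)
      next
        case False
        then have dp: "0 < dist (fst p) (snd p)" using t by linarith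
        have 1: "1 / dist (fst p) (snd p) \<le> 1 / t" using t False dp by (intro divide_left_mono mult_pos_pos) auto
        have 2: "\<not> dist (fst p) (snd p) < R \<Longrightarrow> 1 / dist (fst p) (snd p) \<le> 1 / R" using R dp by (intro divide_left_mono mult_pos_pos) auto
        have 3: "0 < 1 / R" using R by simp
        show ?thesis using False 1 2 3 by (auto simp: near_def simp del: zero_less_divide_1_iff)
      qed
    qed
    also have "(\<integral>p. \<rho> (fst p) * \<rho> (snd p) * ?G p \<partial>R3R3) = (\<integral>p. \<rho> (fst p) * \<rho> (snd p) * near R (fst p) (snd p) \<partial>R3R3) / t + M * M / R"
    proof -
      have i1: "integrable R3R3 (\<lambda>p. \<rho> (fst p) * \<rho> (snd p) * near R (fst p) (snd p))"
        by (rule integrable_prod_bounded[OF ad(3,3) _ nearb]) measurable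
      note i2 = integrable_prod_mult[OF ad(3,3)]
      have "(\<integral>p. \<rho> (fst p) * \<rho> (snd p) * ?G p \<partial>R3R3) = (\<integral>p. \<rho> (fst p) * \<rho> (snd p) * near R (fst p) (snd p) / t + \<rho> (fst p) * \<rho> (snd p) / R \<partial>R3R3)"
        by (simp add: distrib_left)
      also have "\<dots> = (\<integral>p. \<rho> (fst p) * \<rho> (snd p) * near R (fst p) (snd p) \<partial>R3R3) / t + (\<integral>p. \<rho> (fst p) * \<rho> (snd p) \<partial>R3R3) / R"
        using i1 i2(1) by simp
      finally show ?thesis using i2(2) ad(5) by simp
    qed
    finally have D: "coulD \<rho> \<rho> \<le> - h / 2 + (\<integral>p. \<rho> (fst p) * \<rho> (snd p) * near R (fst p) (snd p) \<partial>R3R3) / t"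
      using MR by simp
    have "- h \<le> coulD \<rho> \<rho>" using E Int_Phi_nonneg[OF a] unfolding En_def by linarith
    with D have "- h / 2 \<le> (\<integral>p. \<rho> (fst p) * \<rho> (snd p) * near R (fst p) (snd p) \<partial>R3R3) / t" by linarith
    then have low: "- h / 2 * t \<le> (\<integral>p. \<rho> (fst p) * \<rho> (snd p) * near R (fst p) (snd p) \<partial>R3R3)"
      using t by (simp only: pos_le_divide_eq)
    show "\<exists>a. d \<le> (\<integral>x. \<rho> x * indicator (ball a R) x \<partial>lborel)"
    proof (rule ccontr)
      assume "\<nexists>a. d \<le> (\<integral>x. \<rho> x * indicator (ball a R) x \<partial>lborel)"
      then have less: "(\<integral>x. \<rho> x * indicator (ball a R) x \<partial>lborel) \<le> d" for a by (meson linear)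
      have i1: "integrable R3R3 (\<lambda>p. \<rho> (fst p) * \<rho> (snd p) * near R (fst p) (snd p))"
        by (rule integrable_prod_bounded[OF ad(3,3) _ nearb]) measurable
      have "(\<integral>p. \<rho> (fst p) * \<rho> (snd p) * near R (fst p) (snd p) \<partial>R3R3) = (\<integral>x. (\<integral>y. \<rho> x * (\<rho> y * indicator (ball x R) y) \<partial>lborel) \<partial>lborel)"
        using lborel_pair.integral_fst'[OF i1] by (simp add: near_eq_indicator mult.assoc)
      also have "\<dots> \<le> (\<integral>x. \<rho> x * d \<partial>lborel)"
      proof (rule integral_mono)
        show "integrable lborel (\<lambda>x. \<integral>y. \<rho> x * (\<rho> y * indicator (ball x R) y) \<partial>lborel)"
          using lborel_pair.integrable_fst'[OF i1] by (simp add: near_eq_indicator mult.assoc)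
        show "(\<integral>y. \<rho> x * (\<rho> y * indicator (ball x R) y) \<partial>lborel) \<le> \<rho> x * d" for x
          using mult_left_mono[OF less[of x] ad(2)[of x]] by simp
      qed (use ad in simp)
      also have "\<dots> = t * (- h / 4)" using ad(5) M_pos by (simp add: d_def)
      finally have "- h / 2 * t \<le> t * (- h / 4)" using low by linarith
      moreover have "t * (- h) > 0" using t h_neg by (intro mult_pos_pos) auto
      ultimately show False by (simp add: field_simps)
    qed
  qed
qed

text \<open>Among \<open>K\<close> disjoint shells around \<open>a\<close> one carries mass at most \<open>M / K\<close>. Cutting along
  this shell decouples the inner from the outer part up to a small interaction energy, so that
  \<open>En_split\<close> bounds the product of the two masses.\<close>

lemma concentration:
  assumes R0: "R0 > 0" and d: "d > 0" and e: "e > 0"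
  shows "\<exists>\<eta>>0. \<exists>R>0. \<forall>\<rho> a. adm M \<rho> \<longrightarrow> En \<rho> < h + \<eta> \<longrightarrow> d \<le> (\<integral>x. \<rho> x * indicator (ball a R0) x \<partial>lborel)
     \<longrightarrow> (\<integral>x. \<rho> x * indicator (- ball a R) x \<partial>lborel) < e"
proof -
  \<comment> \<open>As the inner mass is at least \<open>d\<close>, the left side of
    \<open>En_split\<close> is at least \<open>k\<close> times the outer mass. The right side will
    stay below \<open>5 * e' = k * e\<close>: \<open>e'\<close> for the energy excess,
    \<open>e'\<close> for the separated part and \<open>2 * e'\<close> for the shell.\<close>
  define k where "k = (- h) / M\<^sup>2 * d"
  have k: "k > 0" unfolding k_def using h_neg M_pos d by (intro mult_pos_pos divide_pos_pos) auto
  define e' where "e' = k * e / 5"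
  have e': "e' > 0" using k e by (simp add: e'_def)
  obtain N0 where N0: "N0 > 0" "\<And>\<rho>. adm M \<rho> \<Longrightarrow> En \<rho> \<le> h + e' \<Longrightarrow> N43 \<rho> \<le> N0"
    using N43_bounded[of M "h+e'"] by blast
  obtain t where t: "t > 0" and *: "\<And>f g. \<lbrakk>density_class f; density_class g; \<And>x. 0 \<le> f x; \<And>x. 0 \<le> g x; N43 f \<le> N0; N43 g \<le> N0\<rbrakk>
       \<Longrightarrow> coulD f g \<le> e' + (\<integral>x. f x \<partial>lborel) * (\<integral>x. g x \<partial>lborel) / t"
    by (rule coulD_uniform[OF N0(1) e']) blast
  \<comment> \<open>Shells of width \<open>L\<close> keep the interaction across a shell below
    \<open>M * M / L = e'\<close>. With \<open>K\<close> shells the lightest one interacts with the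
    outside by at most \<open>M / K * M / t \<le> e'\<close>, apart from the near-diagonal
    \<open>e'\<close>.\<close>
  define L where "L = M * M / e'"
  have L: "L > 0" "M * M / L = e'" using M_pos e' by (auto simp: L_def)
  obtain K :: nat where K: "M * M / (t * e') < K" using reals_Archimedean2 by blast
  have K0: "K > 0" using K M_pos t e' by (metis divide_pos_pos less_trans mult_pos_pos of_nat_0_less_iff)
  have K1: "M / K * M / t \<le> e'" using K K0 t e' by (simp add: field_simps)
  define r where "r j = R0 + real j * L" for j :: nat
  have rmono: "r i \<le> r j" if "i \<le> j" for i j using that L by (simp add: r_def mult_right_mono)
  have rS: "r (Suc j) = r j + L" for j by (simp add: r_def algebra_simps)
  have r0: "r 0 = R0" by (simp add: r_def)
  have rK: "r K > 0" using rmono[of 0 K] r0 R0 by simp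
  show ?thesis
  proof (rule exI[of _ e'], rule conjI, rule e', rule exI[of _ "r K"], rule conjI, rule rK, intro allI impI)
    fix \<rho> a assume a: "adm M \<rho>" and E: "En \<rho> < h + e'" and dl: "d \<le> (\<integral>x. \<rho> x * indicator (ball a R0) x \<partial>lborel)"
    note ad = admD[OF a]
    note [measurable] = ad(1)
    have [measurable]: "ball a s \<in> sets borel" for s by simp
    define m where "m A = (\<integral>x. \<rho> x * indicator A x \<partial>lborel)" for A
    have mle: "m A \<le> m B" if "A \<subseteq> B" "A \<in> sets borel" "B \<in> sets borel" for A B
      unfolding m_def using that by (intro integral_indicator_mono ad)
    have mU: "m UNIV = M" using ad(5) by (simp add: m_def)
    have m0: "m A \<ge> 0" for A unfolding m_def using ad(2) by (intro Bochner_Integration.integral_nonneg) auto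
    have "\<exists>j<K. m (ball a (r (Suc j)) - ball a (r j)) \<le> M / K"
    proof (rule ccontr)
      assume "\<not> ?thesis"
      then have "M / K < m (ball a (r (Suc j)) - ball a (r j))" if "j < K" for j using that by force
      then have "(\<Sum>j<K. M / K) < (\<Sum>j<K. m (ball a (r (Suc j)) - ball a (r j)))"
        using K0 by (intro sum_strict_mono) auto
      also have "\<dots> = (\<Sum>j<K. m (ball a (r (Suc j))) - m (ball a (r j)))"
        unfolding m_def by (intro sum.cong integral_indicator_diff ad subset_ball rmono) auto
      also have "\<dots> = m (ball a (r K)) - m (ball a (r 0))" by (rule sum_lessThan_telescope)
      also have "\<dots> \<le> M" using mle[of "ball a (r K)" UNIV] mU m0[of "ball a (r 0)"] by simp
      finally show False using K0 by simp
    qed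
    then obtain j where j: "j < K" and mj: "m (ball a (r (Suc j)) - ball a (r j)) \<le> M / K" by blast
    let ?A = "ball a (r (Suc j))"
    let ?S = "ball a (r (Suc j)) - ball a (r j)"
    let ?f1 = "\<lambda>x. \<rho> x * indicator (ball a (r j)) x" and ?f2 = "\<lambda>x. \<rho> x * indicator ?S x"
    let ?g = "\<lambda>x. \<rho> x * indicator (- ?A) x"
    have dc: "density_class \<rho>" by (rule adm_density_class[OF a])
    have dcr: "density_class (\<lambda>x. \<rho> x * indicator A x)" "N43 (\<lambda>x. \<rho> x * indicator A x) \<le> N0" if [measurable]: "A \<in> sets borel" for A
    proof -
      have le: "\<bar>\<rho> x * indicator A x\<bar> \<le> \<bar>\<rho> x\<bar>" for x by (auto simp: indicator_def)
      show "density_class (\<lambda>x. \<rho> x * indicator A x)" by (rule density_class_bound[OF dc _ le]) measurable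
      have "N43 (\<lambda>x. \<rho> x * indicator A x) \<le> N43 \<rho>" by (rule N43_mono[OF dc _ le]) measurable
      then show "N43 (\<lambda>x. \<rho> x * indicator A x) \<le> N0" using N0(2)[OF a] E by linarith
    qed
    have pos: "0 \<le> \<rho> x * indicator A x" for x A using ad(2) by simp
    have sub: "ball a (r j) \<subseteq> ?A" by (intro subset_ball rmono) simp
    have fsum: "\<rho> x * indicator ?A x = ?f1 x + ?f2 x" for x using sub by (auto simp: indicator_def)
    have dec: "coulD (\<lambda>x. \<rho> x * indicator ?A x) ?g = coulD ?f1 ?g + coulD ?f2 ?g"
      unfolding fsum by (rule coulD_add_left) (auto intro: dcr)
    have "coulD ?f1 ?g \<le> m (ball a (r j)) * m (- ?A) / L"
      unfolding m_def
    proof (rule coulD_separated[OF _ _ _ _ L(1)])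
      fix x y assume "?f1 x \<noteq> 0" "?g y \<noteq> 0"
      then have "dist a x < r j" "r (Suc j) \<le> dist a y" by (auto simp: indicator_def split: if_splits)
      then show "L \<le> dist x y" using dist_triangle[of a y x] rS[of j] by linarith
    qed (auto intro: dcr pos)
    also have "\<dots> \<le> M * M / L"
      using L m0 mle[of "ball a (r j)" UNIV] mle[of "- ?A" UNIV] mU M_pos by (intro divide_right_mono mult_mono) auto
    finally have b1: "coulD ?f1 ?g \<le> e'" using L by simp
    have "coulD ?f2 ?g \<le> e' + m ?S * m (- ?A) / t"
      unfolding m_def by (rule *) (auto intro: dcr pos)
    also have "m ?S * m (- ?A) / t \<le> M / K * M / t"
      using t mj m0 mle[of "- ?A" UNIV] mU M_pos by (intro divide_right_mono mult_mono) auto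
    finally have b2: "coulD ?f2 ?g \<le> 2 * e'" using K1 by simp
    have "(- h) / M\<^sup>2 * (m ?A * m (- ?A)) \<le> En \<rho> - h + coulD (\<lambda>x. \<rho> x * indicator ?A x) ?g"
      unfolding m_def by (rule En_split[OF En_ge M_pos h_neg a]) measurable
    then have up: "(- h) / M\<^sup>2 * (m ?A * m (- ?A)) < 5 * e'" using dec b1 b2 E e' by linarith
    have "R0 \<le> r (Suc j)" using rmono[of 0 "Suc j"] r0 by simp
    then have "d \<le> m ?A" using dl mle[of "ball a R0" ?A] by (auto simp: m_def subset_ball)
    then have "k * m (- ?A) \<le> (- h) / M\<^sup>2 * (m ?A * m (- ?A))"
      unfolding k_def mult.assoc using h_neg m0 by (intro mult_left_mono mult_right_mono divide_nonneg_nonneg) auto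
    then have "k * m (- ?A) < k * e" using up by (simp add: e'_def)
    then have "m (- ?A) < e" using k by simp
    moreover have "m (- ball a (r K)) \<le> m (- ?A)"
      using j rmono[of "Suc j" K] by (intro mle) (auto simp: ball_def)
    ultimately show "(\<integral>x. \<rho> x * indicator (- ball a (r K)) x \<partial>lborel) < e" by (simp add: m_def)
  qed
qed

end

section \<open>Compactness in the Coulomb seminorm\<close>

text \<open>Capping the kernel at \<open>1 / t\<close> makes the potential bounded and Lipschitz
  with constants depending only on \<open>t\<close> and the mass, as Arzela-Ascoli requires.\<close>

definition trunc_pot :: "real \<Rightarrow> (real^3 \<Rightarrow> real) \<Rightarrow> real^3 \<Rightarrow> real" where
  "trunc_pot t f x = (\<integral>y. f y * (1 / max t (dist x y)) \<partial>lborel)"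

lemma trunc_kernel_bound: "t > 0 \<Longrightarrow> \<bar>1 / max t d\<bar> \<le> 1 / (t::real)"
  by (auto simp: max_def divide_simps)

lemma trunc_kernel_lipschitz:
  fixes t a b :: real
  assumes t: "t > 0"
  shows "\<bar>1 / max t a - 1 / max t b\<bar> \<le> \<bar>a - b\<bar> / t\<^sup>2"
proof -
  have p: "max t a > 0" "max t b > 0" using t by auto
  have "\<bar>1 / max t a - 1 / max t b\<bar> = \<bar>max t b - max t a\<bar> / (max t a * max t b)"
    using p by (simp add: diff_frac_eq abs_mult mult.commute)
  also have "\<dots> \<le> \<bar>a - b\<bar> / (t * t)"
    using t p by (intro frac_le mult_mono mult_pos_pos) auto
  finally show ?thesis by (simp add: power2_eq_square)
qed

lemma trunc_integrable:
  assumes f: "integrable lborel f" and t: "t > 0"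
  shows "integrable lborel (\<lambda>y. f y * (1 / max t (dist x y)))"
proof (rule Bochner_Integration.integrable_bound)
  have [measurable]: "f \<in> borel_measurable borel" using f by simp
  show "(\<lambda>y. f y * (1 / max t (dist x y))) \<in> borel_measurable lborel" by measurable
  show "integrable lborel (\<lambda>y. f y * (1/t))" using f by simp
  show "AE y in lborel. norm (f y * (1 / max t (dist x y))) \<le> norm (f y * (1/t))"
  proof (rule AE_I2)
    fix y
    show "norm (f y * (1 / max t (dist x y))) \<le> norm (f y * (1/t))"
      using mult_left_mono[OF trunc_kernel_bound[OF t, of "dist x y"], of "\<bar>f y\<bar>"] t
      by (simp add: abs_mult)
  qed
qed

lemma trunc_pot_bound:
  assumes f: "integrable lborel f" and t: "t > 0" and f0: "\<And>x. 0 \<le> f x"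
  shows "\<bar>trunc_pot t f x\<bar> \<le> (\<integral>y. f y \<partial>lborel) / t"
proof -
  have "\<bar>trunc_pot t f x\<bar> \<le> (\<integral>y. \<bar>f y * (1 / max t (dist x y))\<bar> \<partial>lborel)"
    unfolding trunc_pot_def using integral_norm_bound[of lborel "\<lambda>y. f y * (1 / max t (dist x y))"] by simp
  also have "\<dots> \<le> (\<integral>y. f y * (1/t) \<partial>lborel)"
  proof (rule integral_mono)
    show "integrable lborel (\<lambda>y. \<bar>f y * (1 / max t (dist x y))\<bar>)"
      using trunc_integrable[OF f t] by (rule integrable_abs)
    show "\<bar>f y * (1 / max t (dist x y))\<bar> \<le> f y * (1/t)" for y
      using mult_left_mono[OF trunc_kernel_bound[OF t, of "dist x y"] f0[of y]] f0[of y] by (simp add: abs_mult)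
  qed (use f in simp)
  finally show ?thesis by simp
qed

lemma trunc_pot_lipschitz:
  assumes f: "integrable lborel f" and t: "t > 0" and f0: "\<And>x. 0 \<le> f x"
  shows "\<bar>trunc_pot t f x - trunc_pot t f x'\<bar> \<le> dist x x' / t\<^sup>2 * (\<integral>y. f y \<partial>lborel)"
proof -
  let ?k = "\<lambda>x y. 1 / max t (dist x y)"
  have "trunc_pot t f x - trunc_pot t f x' = (\<integral>y. f y * ?k x y - f y * ?k x' y \<partial>lborel)"
    unfolding trunc_pot_def by (intro Bochner_Integration.integral_diff[symmetric] trunc_integrable f t)
  then have "\<bar>trunc_pot t f x - trunc_pot t f x'\<bar> \<le> (\<integral>y. \<bar>f y * ?k x y - f y * ?k x' y\<bar> \<partial>lborel)"
    using integral_norm_bound[of lborel "\<lambda>y. f y * ?k x y - f y * ?k x' y"] by simp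
  also have "\<dots> \<le> (\<integral>y. f y * (dist x x' / t\<^sup>2) \<partial>lborel)"
  proof (rule integral_mono)
    show "integrable lborel (\<lambda>y. \<bar>f y * ?k x y - f y * ?k x' y\<bar>)"
      by (intro integrable_abs Bochner_Integration.integrable_diff trunc_integrable f t)
    fix y
    have "\<bar>?k x y - ?k x' y\<bar> \<le> \<bar>dist x y - dist x' y\<bar> / t\<^sup>2" by (rule trunc_kernel_lipschitz[OF t])
    also have "\<dots> \<le> dist x x' / t\<^sup>2"
      by (intro divide_right_mono) (use dist_triangle[of x y x'] dist_triangle[of x' y x] in \<open>auto simp: dist_commute\<close>)
    finally have "f y * \<bar>?k x y - ?k x' y\<bar> \<le> f y * (dist x x' / t\<^sup>2)" by (intro mult_left_mono f0)
    moreover have "\<bar>f y * ?k x y - f y * ?k x' y\<bar> = f y * \<bar>?k x y - ?k x' y\<bar>"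
      using f0[of y] by (simp only: right_diff_distrib[symmetric] abs_mult abs_of_nonneg)
    ultimately show "\<bar>f y * ?k x y - f y * ?k x' y\<bar> \<le> f y * (dist x x' / t\<^sup>2)" by linarith
  qed (use f in simp)
  finally show ?thesis by (simp add: mult.commute)
qed

text \<open>Here \<open>f\<close> may change sign. The full and the truncated kernel differ only
  within distance \<open>t\<close>, where the difference is at most \<open>1 / dist\<close>; the
  near-diagonal energy of \<open>\<bar>f\<bar>\<close> is at most \<open>e\<close> by
  \<open>coulD_split_uniform\<close> with the exact far kernel as majorant.\<close>

lemma coulD_trunc_uniform:
  assumes N0: "N0 > 0" and e: "e > 0"
  obtains t where "t > 0"
    "\<And>f. \<lbrakk>density_class f; N43 f \<le> N0\<rbrakk> \<Longrightarrow> coulD f f \<le> e + (\<integral>x. f x * trunc_pot t f x \<partial>lborel)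
       \<and> integrable lborel (\<lambda>x. f x * trunc_pot t f x)"
proof -
  obtain t where t: "t > 0" and *: "\<And>f g G B. \<lbrakk>density_class f; density_class g; \<And>x. 0 \<le> f x; \<And>x. 0 \<le> g x; N43 f \<le> N0; N43 g \<le> N0;
       G \<in> borel_measurable R3R3; \<And>p. \<bar>G p\<bar> \<le> B; \<And>p. (1 - near t (fst p) (snd p)) / dist (fst p) (snd p) \<le> G p\<rbrakk>
       \<Longrightarrow> coulD f g \<le> e + (\<integral>p. f (fst p) * g (snd p) * G p \<partial>R3R3)"
    by (rule coulD_split_uniform[OF N0 e]) blast
  show ?thesis
  proof (rule that[OF t])
    fix f assume f: "density_class f" and N: "N43 f \<le> N0"
    note [measurable] = density_classD[OF f]
    note fi = density_class_integrable[OF f]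
    let ?a = "\<lambda>x. \<bar>f x\<bar>"
    let ?G = "\<lambda>p. (1 - near t (fst p) (snd p)) / dist (fst p) (snd p)"
    let ?T = "\<lambda>p. 1 / max t (dist (fst p) (snd p))"
    have a: "density_class ?a" "N43 ?a \<le> N0" using f N by (auto intro: density_class_abs simp: N43_def)
    have Gm [measurable]: "?G \<in> borel_measurable R3R3" by measurable
    have Gb: "\<bar>?G p\<bar> \<le> 1/t" for p using t by (auto simp: near_def divide_simps)
    have aG: "integrable R3R3 (\<lambda>p. ?a (fst p) * ?a (snd p) * ?G p)"
      by (rule integrable_prod_bounded[OF _ _ Gm Gb]) (use fi in auto)
    have aD: "integrable R3R3 (\<lambda>p. ?a (fst p) * ?a (snd p) / dist (fst p) (snd p))"
      by (rule integrable_coulD[OF a(1) a(1)])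
    have ab: "coulD ?a ?a \<le> e + (\<integral>p. ?a (fst p) * ?a (snd p) * ?G p \<partial>R3R3)"
      by (rule *[OF a(1) a(1) _ _ a(2) a(2) Gm Gb]) auto
    have fT: "integrable R3R3 (\<lambda>p. f (fst p) * f (snd p) * ?T p)"
      by (rule integrable_prod_bounded[OF fi fi, of _ "1/t"]) (use t trunc_kernel_bound in auto)
    \<comment> \<open>The near-diagonal energy of \<open>\<bar>f\<bar>\<close>, written as total
      minus far part, plus the truncated form of \<open>f\<close> itself.\<close>
    let ?R = "\<lambda>p. ?a (fst p) * ?a (snd p) / dist (fst p) (snd p) - ?a (fst p) * ?a (snd p) * ?G p + f (fst p) * f (snd p) * ?T p"
    have "coulD f f \<le> (\<integral>p. ?R p \<partial>R3R3)"
      unfolding coulD_def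
    proof (rule integral_mono_AE)
      show "integrable R3R3 ?R" by (intro Bochner_Integration.integrable_add Bochner_Integration.integrable_diff aD aG fT)
      show "AE p in R3R3. f (fst p) * f (snd p) / dist (fst p) (snd p) \<le> ?R p"
        using AE_R3R3_neq
      proof eventually_elim
        case (elim p)
        let ?d = "dist (fst p) (snd p)" and ?c = "f (fst p) * f (snd p)"
        have ac: "?a (fst p) * ?a (snd p) = \<bar>?c\<bar>" by (simp add: abs_mult)
        have d: "?d > 0" using elim by simp
        show ?case
        proof (cases "?d < t")
          case True
          then have "1 / t \<le> 1 / ?d" using d t by (intro divide_left_mono mult_pos_pos) auto
          then have "\<bar>1 / ?d - 1 / t\<bar> \<le> 1 / ?d" using t by simp
          then have "\<bar>?c\<bar> * \<bar>1 / ?d - 1 / t\<bar> \<le> \<bar>?c\<bar> * (1 / ?d)" by (rule mult_left_mono) simp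
          moreover have "?c * (1 / ?d - 1 / t) \<le> \<bar>?c\<bar> * \<bar>1 / ?d - 1 / t\<bar>" using abs_ge_self[of "?c * (1 / ?d - 1 / t)"] by (simp only: abs_mult)
          moreover have "?R p = \<bar>?c\<bar> * (1 / ?d) + ?c * (1 / t)" using True unfolding ac by (simp add: near_def max_def)
          moreover have "?c * (1 / ?d - 1 / t) = ?c / ?d - ?c * (1 / t)" by (simp add: right_diff_distrib)
          ultimately show ?thesis by linarith
        next
          case False
          then show ?thesis unfolding ac by (simp add: near_def max_def)
        qed
      qed
    qed (rule integrable_coulD[OF f f])
    also have "\<dots> = coulD ?a ?a - (\<integral>p. ?a (fst p) * ?a (snd p) * ?G p \<partial>R3R3) + (\<integral>p. f (fst p) * f (snd p) * ?T p \<partial>R3R3)"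
      using aD aG fT by (simp only: Bochner_Integration.integral_add Bochner_Integration.integral_diff Bochner_Integration.integrable_diff coulD_def)
    also have "\<dots> \<le> e + (\<integral>p. f (fst p) * f (snd p) * ?T p \<partial>R3R3)" using ab by linarith
    also have "(\<integral>p. f (fst p) * f (snd p) * ?T p \<partial>R3R3) = (\<integral>x. f x * trunc_pot t f x \<partial>lborel)"
      using lborel_pair.integral_fst'[OF fT] by (simp add: trunc_pot_def mult.assoc flip: times_divide_eq_right)
    finally have "coulD f f \<le> e + (\<integral>x. f x * trunc_pot t f x \<partial>lborel)" .
    moreover have "integrable lborel (\<lambda>x. f x * trunc_pot t f x)"
      using lborel_pair.integrable_fst'[OF fT] by (simp add: trunc_pot_def mult.assoc flip: times_divide_eq_right)
    ultimately show "coulD f f \<le> e + (\<integral>x. f x * trunc_pot t f x \<partial>lborel)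
       \<and> integrable lborel (\<lambda>x. f x * trunc_pot t f x)" by blast
  qed
qed

text \<open>On a large ball the truncated potentials converge uniformly; outside it they are merely
  bounded, but tightness leaves little mass there. The truncation level depends on \<open>e\<close>,
  and so does the subsequence.\<close>

lemma subsequence_coulD_small:
  fixes \<rho> :: "nat \<Rightarrow> real^3 \<Rightarrow> real"
  assumes dc: "\<And>n. density_class (\<rho> n)" and pos: "\<And>n x. 0 \<le> \<rho> n x" and M: "M > 0"
    and mass: "\<And>n. (\<integral>x. \<rho> n x \<partial>lborel) = M" and N0: "N0 > 0" and N: "\<And>n. N43 (\<rho> n) \<le> N0"
    and tight: "\<And>e. e > 0 \<Longrightarrow> \<exists>R>0. \<exists>K. \<forall>n\<ge>K. (\<integral>x. \<rho> n x * indicator (- ball 0 R) x \<partial>lborel) < e"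
    and e: "e > 0"
  shows "\<exists>r. strict_mono (r :: nat \<Rightarrow> nat) \<and> (\<exists>K. \<forall>i\<ge>K. \<forall>j\<ge>K.
     coulD (\<lambda>x. \<rho> (r i) x - \<rho> (r j) x) (\<lambda>x. \<rho> (r i) x - \<rho> (r j) x) < e)"
proof -
  have e2: "e / 2 > 0" using e by simp
  \<comment> \<open>\<open>N43_diff\<close> bounds a difference of two members of the sequence by
    \<open>4 * N0 + 4 * N0\<close>.\<close>
  have N8: "8 * N0 > 0" using N0 by simp
  obtain t where t: "t > 0" and T: "\<And>f. \<lbrakk>density_class f; N43 f \<le> 8 * N0\<rbrakk> \<Longrightarrow>
      coulD f f \<le> e / 2 + (\<integral>x. f x * trunc_pot t f x \<partial>lborel) \<and> integrable lborel (\<lambda>x. f x * trunc_pot t f x)"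
    by (rule coulD_trunc_uniform[OF N8 e2]) blast
  \<comment> \<open>The contributions \<open>2 * M * e1\<close> from inside the ball and
    \<open>4 * e3 * M / t\<close> from outside both stay below \<open>e / 4\<close>.\<close>
  define e1 where "e1 = e / (8 * (M + 1))"
  define e3 where "e3 = e * t / (32 * (M + 1))"
  have e13: "e1 > 0" "e3 > 0" using e M t by (auto simp: e1_def e3_def)
  obtain R K1 where R: "R > 0" and K1: "\<And>n. n \<ge> K1 \<Longrightarrow> (\<integral>x. \<rho> n x * indicator (- ball 0 R) x \<partial>lborel) < e3"
    using tight[OF e13(2)] by blast
  note fi = density_class_integrable[OF dc]
  have equi: "\<exists>d>0. \<forall>n y. y \<in> cball 0 R \<and> norm (x - y) < d \<longrightarrow> norm (trunc_pot t (\<rho> n) x - trunc_pot t (\<rho> n) y) < c"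
    if c: "c > 0" for x :: "real^3" and c :: real
  proof (intro exI[of _ "c * t\<^sup>2 / M"] conjI allI impI)
    show "c * t\<^sup>2 / M > 0" using c t M by simp
    fix n and y :: "real^3" assume y: "y \<in> cball 0 R \<and> norm (x - y) < c * t\<^sup>2 / M"
    have "norm (trunc_pot t (\<rho> n) x - trunc_pot t (\<rho> n) y) \<le> dist x y / t\<^sup>2 * M"
      using trunc_pot_lipschitz[OF fi t pos, of n x y] mass[of n] by simp
    also have "\<dots> < c" using y t M by (simp add: dist_norm field_simps)
    finally show "norm (trunc_pot t (\<rho> n) x - trunc_pot t (\<rho> n) y) < c" .
  qed
  obtain g k where k: "strict_mono (k :: nat \<Rightarrow> nat)" and conv: "\<And>c. 0 < c \<Longrightarrow>
      \<exists>K. \<forall>n x. n \<ge> K \<and> x \<in> cball 0 R \<longrightarrow> norm (trunc_pot t (\<rho> (k n)) x - g x) < c"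
  proof (rule Arzela_Ascoli[of "cball (0::real^3) R" "\<lambda>n. trunc_pot t (\<rho> n)" "M / t"])
    show "norm (trunc_pot t (\<rho> n) x) \<le> M / t" for n x
      using trunc_pot_bound[OF fi t pos, of n x] mass[of n] by simp
  qed (use equi in auto)
  obtain K2 where K2: "\<And>n x. n \<ge> K2 \<Longrightarrow> x \<in> cball 0 R \<Longrightarrow> norm (trunc_pot t (\<rho> (k n)) x - g x) < e1 / 2"
    using conv[of "e1 / 2"] e13 by auto
  show ?thesis
  proof (intro exI[of _ k] conjI k exI[of _ "max K1 K2"] allI impI)
    fix i j assume "max K1 K2 \<le> i" "max K1 K2 \<le> j"
    then have ij: "K1 \<le> k i" "K1 \<le> k j" "K2 \<le> i" "K2 \<le> j"
      using seq_suble[OF k, of i] seq_suble[OF k, of j] by auto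
    let ?p = "\<rho> (k i)" and ?q = "\<rho> (k j)"
    let ?f = "\<lambda>x. ?p x - ?q x"
    have fd: "density_class ?f" by (intro density_class_diff dc)
    have "N43 ?f \<le> 4 * N43 ?p + 4 * N43 ?q" by (rule N43_diff[OF dc dc])
    also have "\<dots> \<le> 8 * N0" using N[of "k i"] N[of "k j"] by simp
    finally have TT: "coulD ?f ?f \<le> e / 2 + (\<integral>x. ?f x * trunc_pot t ?f x \<partial>lborel)" "integrable lborel (\<lambda>x. ?f x * trunc_pot t ?f x)"
      using T[OF fd] by auto
    have W: "trunc_pot t ?f x = trunc_pot t ?p x - trunc_pot t ?q x" for x
      unfolding trunc_pot_def left_diff_distrib
      by (intro Bochner_Integration.integral_diff trunc_integrable fi t)
    let ?B = "\<lambda>x. indicator (- ball 0 R) x :: real"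
    have [measurable]: "ball (0::real^3) R \<in> sets borel" by simp
    let ?u = "\<lambda>x. (?p x + ?q x) * e1 + (?p x * ?B x + ?q x * ?B x) * (2 * M / t)"
    have ipB: "integrable lborel (\<lambda>x. ?p x * ?B x)" "integrable lborel (\<lambda>x. ?q x * ?B x)"
      using fi by (auto intro!: integrable_real_mult_indicator)
    have "(\<integral>x. ?f x * trunc_pot t ?f x \<partial>lborel) \<le> (\<integral>x. ?u x \<partial>lborel)"
    proof (rule integral_mono)
      show "integrable lborel ?u"
        using ipB fi by simp
      fix x
      have fx: "\<bar>?f x\<bar> \<le> ?p x + ?q x" using pos[of "k i" x] pos[of "k j" x] by simp
      have "?f x * trunc_pot t ?f x \<le> \<bar>?f x\<bar> * \<bar>trunc_pot t ?f x\<bar>"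
        using abs_ge_self[of "?f x * trunc_pot t ?f x"] by (simp only: abs_mult)
      also have "\<dots> \<le> (?p x + ?q x) * \<bar>trunc_pot t ?f x\<bar>" by (intro mult_right_mono fx) simp
      also have "\<dots> \<le> ?u x"
      proof (cases "x \<in> ball 0 R")
        case True
        then have "x \<in> cball 0 R" by simp
        then have "\<bar>trunc_pot t ?f x\<bar> \<le> e1" using K2[OF ij(3), of x] K2[OF ij(4), of x] unfolding W real_norm_def by linarith
        then have "(?p x + ?q x) * \<bar>trunc_pot t ?f x\<bar> \<le> (?p x + ?q x) * e1"
          using pos by (intro mult_left_mono add_nonneg_nonneg) auto
        then show ?thesis using True by simp
      next
        case False
        have "\<bar>trunc_pot t ?f x\<bar> \<le> 2 * M / t"
          unfolding W using trunc_pot_bound[OF fi t pos, of "k i" x] trunc_pot_bound[OF fi t pos, of "k j" x] mass by simp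
        then have "(?p x + ?q x) * \<bar>trunc_pot t ?f x\<bar> \<le> (?p x + ?q x) * (2 * M / t)"
          using pos by (intro mult_left_mono add_nonneg_nonneg) auto
        moreover have "0 \<le> (?p x + ?q x) * e1" using pos e13 by (intro mult_nonneg_nonneg add_nonneg_nonneg) auto
        moreover have "?u x = (?p x + ?q x) * e1 + (?p x + ?q x) * (2 * M / t)" using False by simp
        ultimately show ?thesis by linarith
      qed
      finally show "?f x * trunc_pot t ?f x \<le> ?u x" .
    qed (rule TT)
    also have "\<dots> = (M + M) * e1 + ((\<integral>x. ?p x * ?B x \<partial>lborel) + (\<integral>x. ?q x * ?B x \<partial>lborel)) * (2 * M / t)"
      using ipB fi mass by simp
    also have "\<dots> \<le> (M + M) * e1 + (e3 + e3) * (2 * M / t)"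
      using K1[OF ij(1)] K1[OF ij(2)] M t by (intro add_left_mono mult_right_mono add_mono) auto
    also have "\<dots> < e / 2"
    proof -
      have "(M + M) * e1 < e / 4" using M e by (simp add: e1_def field_simps)
      moreover have "(e3 + e3) * (2 * M / t) = (e / 8) * (M / (M + 1))"
        unfolding e3_def using t M by (simp add: divide_simps)
      moreover have "(e / 8) * (M / (M + 1)) \<le> (e / 8) * 1"
        using M e by (intro mult_left_mono) auto
      moreover have "e / 8 < e / 4" using e by simp
      ultimately show ?thesis by linarith
    qed
    finally show "coulD ?f ?f < e" using TT(1) by linarith
  qed
qed

text \<open>Each tolerance \<open>1 / real (Suc m)\<close> needs its own subsequence, and the bound
  passes to further subsequences, so a diagonal sequence serves all tolerances.\<close>

lemma subsequence_coulD_Cauchy: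
  fixes \<rho> :: "nat \<Rightarrow> real^3 \<Rightarrow> real"
  assumes dc: "\<And>n. density_class (\<rho> n)" and pos: "\<And>n x. 0 \<le> \<rho> n x" and M: "M > 0"
    and mass: "\<And>n. (\<integral>x. \<rho> n x \<partial>lborel) = M" and N0: "N0 > 0" and N: "\<And>n. N43 (\<rho> n) \<le> N0"
    and tight: "\<And>e. e > 0 \<Longrightarrow> \<exists>R>0. \<exists>K. \<forall>n\<ge>K. (\<integral>x. \<rho> n x * indicator (- ball 0 R) x \<partial>lborel) < e"
  shows "\<exists>r. strict_mono (r :: nat \<Rightarrow> nat) \<and> (\<forall>e>0. \<exists>K. \<forall>i\<ge>K. \<forall>j\<ge>K.
     coulD (\<lambda>x. \<rho> (r i) x - \<rho> (r j) x) (\<lambda>x. \<rho> (r i) x - \<rho> (r j) x) < e)"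
proof -
  define P where "P m s \<longleftrightarrow> (\<exists>K. \<forall>i\<ge>K. \<forall>j\<ge>K.
     coulD (\<lambda>x. \<rho> (s i) x - \<rho> (s j) x) (\<lambda>x. \<rho> (s i) x - \<rho> (s j) x) < 1 / real (Suc m))" for m :: nat and s :: "nat \<Rightarrow> nat"
  interpret subseqs P
  proof
    fix m s assume s: "strict_mono (s :: nat \<Rightarrow> nat)"
    have "\<exists>r. strict_mono (r :: nat \<Rightarrow> nat) \<and> (\<exists>K. \<forall>i\<ge>K. \<forall>j\<ge>K.
     coulD (\<lambda>x. \<rho> (s (r i)) x - \<rho> (s (r j)) x) (\<lambda>x. \<rho> (s (r i)) x - \<rho> (s (r j)) x) < 1 / real (Suc m))"
    proof (rule subsequence_coulD_small[where \<rho> = "\<lambda>n. \<rho> (s n)", OF _ _ M _ N0])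
      show "\<exists>R>0. \<exists>K. \<forall>n\<ge>K. (\<integral>x. \<rho> (s n) x * indicator (- ball 0 R) x \<partial>lborel) < e" if "e > 0" for e
        using tight[OF that] seq_suble[OF s] by (meson order_trans)
    qed (use dc pos mass N in auto)
    then show "\<exists>r'. strict_mono r' \<and> P m (s \<circ> r')" unfolding P_def o_def .
  qed
  have stable: "P n (s \<circ> r)" if sr: "strict_mono r" and Ps: "P n s" for r s :: "nat \<Rightarrow> nat" and n
  proof -
    obtain K where "\<And>i j. i \<ge> K \<Longrightarrow> j \<ge> K \<Longrightarrow> coulD (\<lambda>x. \<rho> (s i) x - \<rho> (s j) x) (\<lambda>x. \<rho> (s i) x - \<rho> (s j) x) < 1 / real (Suc n)"
      using Ps unfolding P_def by blast
    then show ?thesis unfolding P_def o_def using seq_suble[OF sr] by (meson order_trans)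
  qed
  \<comment> \<open>The diagonal sequence refines the \<open>k\<close>-th subsequence only from
    index \<open>Suc k\<close> on, hence the offset.\<close>
  have diag: "P k (diagseq \<circ> ((+) (Suc k)))" for k by (rule diagseq_holds[OF stable])
  show ?thesis
  proof (intro exI[of _ diagseq] conjI subseq_diagseq allI impI)
    fix e :: real assume "e > 0"
    then obtain k where k: "1 / real (Suc k) < e" using nat_approx_posE by blast
    obtain K where K: "\<And>i j. i \<ge> K \<Longrightarrow> j \<ge> K \<Longrightarrow> coulD (\<lambda>x. \<rho> (diagseq (Suc k + i)) x - \<rho> (diagseq (Suc k + j)) x)
       (\<lambda>x. \<rho> (diagseq (Suc k + i)) x - \<rho> (diagseq (Suc k + j)) x) < 1 / real (Suc k)"
      using diag[of k] unfolding P_def o_def by blast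
    show "\<exists>K. \<forall>i\<ge>K. \<forall>j\<ge>K. coulD (\<lambda>x. \<rho> (diagseq i) x - \<rho> (diagseq j) x) (\<lambda>x. \<rho> (diagseq i) x - \<rho> (diagseq j) x) < e"
    proof (intro exI[of _ "Suc k + K"] allI impI)
      fix i j assume "Suc k + K \<le> i" "Suc k + K \<le> j"
      then have "i - Suc k \<ge> K" "j - Suc k \<ge> K" "Suc k + (i - Suc k) = i" "Suc k + (j - Suc k) = j" by auto
      then show "coulD (\<lambda>x. \<rho> (diagseq i) x - \<rho> (diagseq j) x) (\<lambda>x. \<rho> (diagseq i) x - \<rho> (diagseq j) x) < e"
        using K[of "i - Suc k" "j - Suc k"] k by simp
    qed
  qed
qed

section \<open>Convergence to a minimizer\<close>

context polytrope
begin

section \<open>The convexity gap and strong convergence\<close>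

definition gap :: "real \<Rightarrow> real \<Rightarrow> real" where
  "gap x y = (\<Phi> x + \<Phi> y) / 2 - \<Phi> ((x + y) / 2)"

lemma gap_pos: "0 \<le> x \<Longrightarrow> 0 \<le> y \<Longrightarrow> x \<noteq> y \<Longrightarrow> gap x y > 0"
proof -
  assume xy: "0 \<le> x" "0 \<le> y" "x \<noteq> y"
  have "\<Phi> ((1 - 1/2) * x + 1/2 * y) < (1 - 1/2) * \<Phi> x + 1/2 * \<Phi> y"
    using Phi_strict xy unfolding strictly_convex_on_def by (meson atLeast_iff half_gt_zero_iff less_divide_eq_1 zero_less_one one_less_numeral_iff semiring_norm(76) divide_less_eq_1_pos zero_less_numeral zero_less_divide_1_iff)
  moreover have "(1 - 1/2) * x + 1/2 * y = (x + y) / 2" by (simp add: field_simps)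
  ultimately show ?thesis by (simp add: gap_def field_simps)
qed

lemma gap_nonneg: "0 \<le> x \<Longrightarrow> 0 \<le> y \<Longrightarrow> gap x y \<ge> 0"
  using gap_pos[of x y] by (cases "x = y") (auto simp: gap_def)

text \<open>A continuous positive function has a positive minimum on the compact set of pairs in
  question. The bound \<open>A\<close> matters, since strict convexity may degenerate at
  infinity.\<close>

lemma gap_uniform:
  assumes \<eta>: "\<eta> > 0"
  shows "\<exists>\<kappa>>0. \<forall>x y. 0 \<le> x \<longrightarrow> x \<le> A \<longrightarrow> 0 \<le> y \<longrightarrow> y \<le> A \<longrightarrow> \<eta> \<le> \<bar>x - y\<bar> \<longrightarrow> \<kappa> \<le> gap x y"
proof -
  define S where "S = {0..A} \<times> {0..A} \<inter> {p. \<eta> \<le> \<bar>fst p - snd p\<bar>}"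
  have "closed {p::real\<times>real. \<eta> \<le> \<bar>fst p - snd p\<bar>}"
    by (intro closed_Collect_le continuous_intros)
  then have S: "compact S" unfolding S_def by (intro compact_Int_closed compact_Times) auto
  have "continuous_on S (\<lambda>p. gap (fst p) (snd p))"
    unfolding gap_def by (intro continuous_intros continuous_on_compose2[OF Phi_cont]) (auto simp: S_def)
  show ?thesis
  proof (cases "S = {}")
    case True
    have "\<forall>x y. 0 \<le> x \<longrightarrow> x \<le> A \<longrightarrow> 0 \<le> y \<longrightarrow> y \<le> A \<longrightarrow> \<eta> \<le> \<bar>x - y\<bar> \<longrightarrow> (1::real) \<le> gap x y"
    proof (intro allI impI)
      fix x y assume "0 \<le> x" "x \<le> A" "0 \<le> y" "y \<le> A" "\<eta> \<le> \<bar>x - y\<bar>"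
      then have "(x, y) \<in> S" by (simp add: S_def)
      then show "1 \<le> gap x y" using True by simp
    qed
    then show ?thesis by (intro exI[of _ "1::real"]) simp
  next
    case False
    obtain p where p: "p \<in> S" "\<And>q. q \<in> S \<Longrightarrow> gap (fst p) (snd p) \<le> gap (fst q) (snd q)"
      using continuous_attains_inf[OF S False \<open>continuous_on S _\<close>] by blast
    have "gap (fst p) (snd p) > 0" using p(1) \<eta> by (intro gap_pos) (auto simp: S_def)
    moreover have "gap (fst p) (snd p) \<le> gap x y" if "0 \<le> x" "x \<le> A" "0 \<le> y" "y \<le> A" "\<eta> \<le> \<bar>x - y\<bar>" for x y
      using p(2)[of "(x, y)"] that by (simp add: S_def)
    ultimately show ?thesis by blast
  qed
qed

lemma adm_midpoint:
  assumes a: "adm m \<rho>" and b: "adm m \<sigma>"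
  shows "adm m (\<lambda>x. (\<rho> x + \<sigma> x) / 2)"
    and "integrable lborel (\<lambda>x. gap (\<rho> x) (\<sigma> x))"
    and "(\<integral>x. gap (\<rho> x) (\<sigma> x) \<partial>lborel) = (Int_Phi \<rho> + Int_Phi \<sigma>) / 2 - Int_Phi (\<lambda>x. (\<rho> x + \<sigma> x) / 2)"
proof -
  note A = admD[OF a] and B = admD[OF b]
  note [measurable] = A(1) B(1)
  let ?m = "\<lambda>x. (\<rho> x + \<sigma> x) / 2"
  have pos: "0 \<le> ?m x" for x using A(2)[of x] B(2)[of x] by simp
  have Pm: "(\<lambda>x. \<Phi> (?m x)) \<in> borel_measurable lborel" by (rule Phi_measurable[OF _ pos]) measurable
  have le: "\<Phi> (?m x) \<le> (\<Phi> (\<rho> x) + \<Phi> (\<sigma> x)) / 2" for x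
    using gap_nonneg[OF A(2)[of x] B(2)[of x]] by (simp add: gap_def)
  have i: "integrable lborel (\<lambda>x. (\<Phi> (\<rho> x) + \<Phi> (\<sigma> x)) / 2)" using A(4) B(4) by simp
  have j: "integrable lborel (\<lambda>x. \<Phi> (?m x))"
  proof (rule Bochner_Integration.integrable_bound[OF i Pm])
    show "AE x in lborel. norm (\<Phi> (?m x)) \<le> norm ((\<Phi> (\<rho> x) + \<Phi> (\<sigma> x)) / 2)"
    proof (rule AE_I2)
      fix x show "norm (\<Phi> (?m x)) \<le> norm ((\<Phi> (\<rho> x) + \<Phi> (\<sigma> x)) / 2)"
        using le[of x] Phi_nonneg[OF pos[of x]] by simp
    qed
  qed
  show "adm m ?m" unfolding adm_def using A B pos j by auto
  show "integrable lborel (\<lambda>x. gap (\<rho> x) (\<sigma> x))" unfolding gap_def using i j by (rule Bochner_Integration.integrable_diff)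
  show "(\<integral>x. gap (\<rho> x) (\<sigma> x) \<partial>lborel) = (Int_Phi \<rho> + Int_Phi \<sigma>) / 2 - Int_Phi ?m"
    unfolding gap_def Int_Phi_def using i j A(4) B(4) by simp
qed

text \<open>Four contributions: the tails outside the ball; values above \<open>A = B^3\<close>,
  where \<open>z \<le> (1/B) * z powr (4/3)\<close>; pairs of values closer than
  \<open>\<eta>\<close>; and the remaining pairs, where
  \<open>\<bar>x - y\<bar> \<le> A \<le> (A/\<kappa>) * gap x y\<close>. They cost at most
  \<open>e/4\<close>, \<open>e/4\<close>, \<open>e/8\<close> and \<open>e/8\<close>.\<close>

lemma L1_estimate:
  assumes N0: "N0 > 0" and e: "e > 0" and R: "R > 0"
  shows "\<exists>c>0. \<forall>\<rho> \<sigma>. adm m \<rho> \<longrightarrow> adm m \<sigma> \<longrightarrow> N43 \<rho> \<le> N0 \<longrightarrow> N43 \<sigma> \<le> N0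
     \<longrightarrow> (\<integral>x. \<rho> x * indicator (- ball 0 R) x \<partial>lborel) < e/8 \<longrightarrow> (\<integral>x. \<sigma> x * indicator (- ball 0 R) x \<partial>lborel) < e/8
     \<longrightarrow> (\<integral>x. gap (\<rho> x) (\<sigma> x) \<partial>lborel) < c \<longrightarrow> (\<integral>x. \<bar>\<rho> x - \<sigma> x\<bar> \<partial>lborel) < e"
proof -
  define B where "B = 8 * N0 / e"
  define A where "A = B ^ 3"
  have B: "B > 0" using N0 e by (simp add: B_def)
  have A: "A > 0" using B by (simp add: A_def)
  define \<eta> where "\<eta> = e / (8 * (vol1 * R^3 + 1))"
  have vR: "vol1 * R^3 \<ge> 0" using R by simp
  have \<eta>: "\<eta> > 0" using e vR unfolding \<eta>_def by (intro divide_pos_pos) auto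
  have \<eta>R: "\<eta> * (vol1 * R^3) \<le> e / 8"
  proof -
    have "\<eta> * (vol1 * R^3) \<le> \<eta> * (vol1 * R^3 + 1)" using \<eta> by (intro mult_left_mono) auto
    also have "\<dots> = e / 8" unfolding \<eta>_def using vR by (simp add: add_nonneg_eq_0_iff divide_simps)
    finally show ?thesis .
  qed
  obtain \<kappa> where \<kappa>: "\<kappa> > 0" "\<And>x y. 0 \<le> x \<Longrightarrow> x \<le> A \<Longrightarrow> 0 \<le> y \<Longrightarrow> y \<le> A \<Longrightarrow> \<eta> \<le> \<bar>x - y\<bar> \<Longrightarrow> \<kappa> \<le> gap x y"
    using gap_uniform[OF \<eta>, of A] by blast
  define c where "c = \<kappa> * e / (8 * A)"
  have c: "c > 0" using \<kappa> e A by (simp add: c_def)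
  have large: "z \<le> (1/B) * z powr (4/3)" if z: "z > A" for z
  proof -
    have z0: "z > 0" using z A by linarith
    have "B = A powr (1/3)" using B by (simp add: A_def powr_powr flip: powr_numeral)
    also have "\<dots> \<le> z powr (1/3)" using z A by (intro powr_mono2) auto
    finally have "z * B \<le> z * z powr (1/3)" using z0 by (intro mult_left_mono) auto
    also have "\<dots> = z powr (4/3)" using z0 powr_add[of z 1 "1/3"] by simp
    finally show ?thesis using B by (simp add: field_simps)
  qed
  have pt: "\<bar>x - y\<bar> \<le> \<eta> + (A/\<kappa>) * gap x y + (1/B) * (x powr (4/3) + y powr (4/3))"
    if xy: "0 \<le> x" "0 \<le> y" for x y
  proof -
    have g: "0 \<le> (A/\<kappa>) * gap x y" using A \<kappa>(1) gap_nonneg[OF xy] by simp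
    have px: "0 \<le> (1/B) * x powr (4/3)" and py: "0 \<le> (1/B) * y powr (4/3)" using B by simp_all
    consider "x > A \<and> y \<le> x" | "y > A \<and> x \<le> y" | "x \<le> A" "y \<le> A" by linarith
    then show ?thesis
    proof cases
      case 1
      then have "\<bar>x - y\<bar> \<le> x" using xy by simp
      also have "x \<le> (1/B) * x powr (4/3)" using large 1 by simp
      finally show ?thesis using g py \<eta> unfolding distrib_left by linarith
    next
      case 2
      then have "\<bar>x - y\<bar> \<le> y" using xy by simp
      also have "y \<le> (1/B) * y powr (4/3)" using large 2 by simp
      finally show ?thesis using g px \<eta> unfolding distrib_left by linarith
    next
      case 3
      show ?thesis
      proof (cases "\<eta> \<le> \<bar>x - y\<bar>")
        case True
        have "(A/\<kappa>) * \<kappa> \<le> (A/\<kappa>) * gap x y" using \<kappa>(2)[OF xy(1) 3(1) xy(2) 3(2) True] A \<kappa>(1) by (intro mult_left_mono) auto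
        then have "A \<le> (A/\<kappa>) * gap x y" using \<kappa>(1) by simp
        moreover have "\<bar>x - y\<bar> \<le> A" using xy 3 by simp
        ultimately show ?thesis using px py \<eta> unfolding distrib_left by linarith
      next
        case False
        then show ?thesis using g px py unfolding distrib_left by linarith
      qed
    qed
  qed
  have "(\<integral>x. \<bar>\<rho> x - \<sigma> x\<bar> \<partial>lborel) < e"
    if a: "adm m \<rho>" and b: "adm m \<sigma>" and N: "N43 \<rho> \<le> N0" "N43 \<sigma> \<le> N0"
      and out: "(\<integral>x. \<rho> x * indicator (- ball 0 R) x \<partial>lborel) < e/8" "(\<integral>x. \<sigma> x * indicator (- ball 0 R) x \<partial>lborel) < e/8"
      and gp: "(\<integral>x. gap (\<rho> x) (\<sigma> x) \<partial>lborel) < c" for \<rho> \<sigma>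
  proof -
    note ad = admD[OF a] and bd = admD[OF b]
    note [measurable] = ad(1) bd(1)
    have [measurable]: "ball (0::real^3) R \<in> sets borel" by simp
    let ?o = "\<lambda>x. indicator (- ball (0::real^3) R) x :: real"
    note gi = adm_midpoint(2)[OF a b]
    have p1: "integrable lborel (\<lambda>x. \<rho> x powr (4/3))" "(\<integral>x. \<rho> x powr (4/3) \<partial>lborel) = N43 \<rho>"
      using density_class_integrable43[OF adm_density_class[OF a]] ad(2) by (simp_all add: N43_def)
    have p2: "integrable lborel (\<lambda>x. \<sigma> x powr (4/3))" "(\<integral>x. \<sigma> x powr (4/3) \<partial>lborel) = N43 \<sigma>"
      using density_class_integrable43[OF adm_density_class[OF b]] bd(2) by (simp_all add: N43_def)
    have o: "integrable lborel (\<lambda>x. \<rho> x * ?o x)" "integrable lborel (\<lambda>x. \<sigma> x * ?o x)"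
      using ad(3) bd(3) by (auto intro!: integrable_real_mult_indicator)
    note ib = integral_const_ball[OF R, of \<eta>]
    let ?u = "\<lambda>x. (\<rho> x * ?o x + \<sigma> x * ?o x) + (\<eta> * indicator (ball 0 R) x + ((A/\<kappa>) * gap (\<rho> x) (\<sigma> x) + (1/B) * (\<rho> x powr (4/3) + \<sigma> x powr (4/3))))"
    have i1: "integrable lborel (\<lambda>x. (A/\<kappa>) * gap (\<rho> x) (\<sigma> x) + (1/B) * (\<rho> x powr (4/3) + \<sigma> x powr (4/3)))"
      using gi p1 p2 by (intro Bochner_Integration.integrable_add Bochner_Integration.integrable_mult_right) auto
    have "(\<integral>x. \<bar>\<rho> x - \<sigma> x\<bar> \<partial>lborel) \<le> (\<integral>x. ?u x \<partial>lborel)"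
    proof (rule integral_mono)
      show "integrable lborel ?u" by (intro Bochner_Integration.integrable_add o ib i1)
      show "integrable lborel (\<lambda>x. \<bar>\<rho> x - \<sigma> x\<bar>)" using ad(3) bd(3) by (intro integrable_abs Bochner_Integration.integrable_diff)
      fix x
      have *: "\<bar>\<rho> x - \<sigma> x\<bar> \<le> \<eta> + (A/\<kappa>) * gap (\<rho> x) (\<sigma> x) + (1/B) * (\<rho> x powr (4/3) + \<sigma> x powr (4/3))"
        by (rule pt) (use ad bd in auto)
      have g: "0 \<le> (A/\<kappa>) * gap (\<rho> x) (\<sigma> x)" using A \<kappa>(1) gap_nonneg ad(2) bd(2) by simp
      have pw: "0 \<le> (1/B) * (\<rho> x powr (4/3) + \<sigma> x powr (4/3))" using B by simp
      show "\<bar>\<rho> x - \<sigma> x\<bar> \<le> ?u x"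
      proof (cases "x \<in> ball 0 R")
        case True
        then have "?o x = 0" "indicator (ball 0 R) x = (1::real)" by (auto simp: indicator_def)
        then show ?thesis using * by (simp only: mult_zero_right mult_1_right add_0_left)
      next
        case False
        then have eq: "?o x = 1" "indicator (ball 0 R) x = (0::real)" by (auto simp: indicator_def)
        have "\<bar>\<rho> x - \<sigma> x\<bar> \<le> \<rho> x + \<sigma> x" using ad(2)[of x] bd(2)[of x] by simp
        then show ?thesis unfolding eq mult_zero_right mult_1_right using g pw by linarith
      qed
    qed
    also have "\<dots> = (\<integral>x. \<rho> x * ?o x \<partial>lborel) + (\<integral>x. \<sigma> x * ?o x \<partial>lborel) + (\<eta> * (vol1 * R^3)
       + ((A/\<kappa>) * (\<integral>x. gap (\<rho> x) (\<sigma> x) \<partial>lborel) + (1/B) * (N43 \<rho> + N43 \<sigma>)))"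
    proof -
      have "(\<integral>x. (A/\<kappa>) * gap (\<rho> x) (\<sigma> x) + (1/B) * (\<rho> x powr (4/3) + \<sigma> x powr (4/3)) \<partial>lborel)
        = (A/\<kappa>) * (\<integral>x. gap (\<rho> x) (\<sigma> x) \<partial>lborel) + (1/B) * (N43 \<rho> + N43 \<sigma>)"
        using gi p1 p2 by (simp del: times_divide_eq_left)
      moreover have "(\<integral>x. \<rho> x * ?o x + \<sigma> x * ?o x \<partial>lborel) = (\<integral>x. \<rho> x * ?o x \<partial>lborel) + (\<integral>x. \<sigma> x * ?o x \<partial>lborel)"
        by (rule Bochner_Integration.integral_add[OF o])
      moreover note Bochner_Integration.integral_add[OF Bochner_Integration.integrable_add[OF o] Bochner_Integration.integrable_add[OF ib(1) i1]]
        Bochner_Integration.integral_add[OF ib(1) i1] ib(2)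
      ultimately show ?thesis by linarith
    qed
    also have "\<dots> < e"
    proof -
      have "(A/\<kappa>) * (\<integral>x. gap (\<rho> x) (\<sigma> x) \<partial>lborel) \<le> (A/\<kappa>) * c" using A \<kappa>(1) gp by (intro mult_left_mono) auto
      also have "\<dots> = e / 8" using A \<kappa>(1) by (simp add: c_def)
      finally have 1: "(A/\<kappa>) * (\<integral>x. gap (\<rho> x) (\<sigma> x) \<partial>lborel) \<le> e / 8" .
      have "(1/B) * (N43 \<rho> + N43 \<sigma>) \<le> (1/B) * (2 * N0)" using N B by (intro mult_left_mono) auto
      also have "\<dots> = e / 4" using N0 e by (simp add: B_def)
      finally have "(1/B) * (N43 \<rho> + N43 \<sigma>) \<le> e / 4" .
      with 1 out \<eta>R e show ?thesis by linarith
    qed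
    finally show ?thesis .
  qed
  then show ?thesis using c by blast
qed

end

context polytrope_bound
begin

text \<open>By the parallelogram identity the form at the midpoint is the average of the two forms
  minus a quarter of the form of the difference. The midpoint again has mass \<open>M\<close>, so
  its energy is at least \<open>h\<close>.\<close>

lemma midpoint_gap:
  assumes a: "adm M \<rho>" and b: "adm M \<sigma>"
  shows "(\<integral>x. gap (\<rho> x) (\<sigma> x) \<partial>lborel) \<le> (En \<rho> + En \<sigma>) / 2 - h + coulD (\<lambda>x. \<rho> x - \<sigma> x) (\<lambda>x. \<rho> x - \<sigma> x) / 8"
proof -
  let ?m = "\<lambda>x. (\<rho> x + \<sigma> x) / 2"
  note m = adm_midpoint[OF a b]
  note da = adm_density_class[OF a] and db = adm_density_class[OF b]
  have dh: "density_class (\<lambda>x. (1/2) * \<rho> x)" "density_class (\<lambda>x. (1/2) * \<sigma> x)" by (rule density_class_cmult[OF da] density_class_cmult[OF db])+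
  have r: "coulD f (\<lambda>x. (1/2) * g x) = (1/2) * coulD f g" if "density_class f" "density_class g" for f g
    unfolding coulD_commute[OF that(1) density_class_cmult[OF that(2)]] coulD_cmult_left coulD_commute[OF that] ..
  have "?m = (\<lambda>x. (1/2) * \<rho> x + (1/2) * \<sigma> x)" by (simp add: fun_eq_iff add_divide_distrib)
  then have "coulD ?m ?m = coulD (\<lambda>x. (1/2) * \<rho> x + (1/2) * \<sigma> x) (\<lambda>x. (1/2) * \<rho> x + (1/2) * \<sigma> x)" by simp
  also have "\<dots> = (coulD \<rho> \<rho> + 2 * coulD \<sigma> \<rho> + coulD \<sigma> \<sigma>) / 4"
    using dh da db by (simp only: coulD_add_left coulD_add_right density_class_add coulD_cmult_left r coulD_commute[of \<rho> \<sigma>]) (simp add: field_simps)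
  finally have "coulD ?m ?m = (coulD \<rho> \<rho> + coulD \<sigma> \<sigma>) / 2 - coulD (\<lambda>x. \<rho> x - \<sigma> x) (\<lambda>x. \<rho> x - \<sigma> x) / 4"
    unfolding coulD_diff_self[OF da db] by (simp add: field_simps)
  moreover have "G \<le> (p - a/2 + (q - b/2)) / 2 - h + Df / 8"
    if "Dm = (a + b) / 2 - Df / 4" "G = (p + q) / 2 - Jm" "h \<le> Jm - Dm / 2" for Dm a b Df G p q Jm :: real
    using that by argo
  ultimately show ?thesis using m(3) En_ge[OF m(1)] unfolding En_def by blast
qed

end

context polytrope_bound
begin

section \<open>Limits of minimizing sequences\<close>

text \<open>Fatou handles the internal energy, while the form is continuous under
  \<open>L\<^sup>1\<close> convergence with bounded \<open>N43\<close>. Together they give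
  \<open>En \<sigma> \<le> h\<close>, and \<open>En_ge\<close> gives the converse.\<close>

lemma L1_limit_minimizer:
  fixes \<rho> :: "nat \<Rightarrow> real^3 \<Rightarrow> real"
  assumes a: "\<And>n. adm M (\<rho> n)" and Eh: "(\<lambda>n. En (\<rho> n)) \<longlonglongrightarrow> h" and N0: "N0 > 0" and N: "\<And>n. N43 (\<rho> n) \<le> N0"
    and cauchy: "\<And>e. e > 0 \<Longrightarrow> \<exists>K. \<forall>i\<ge>K. \<forall>j\<ge>K. (\<integral>x. \<bar>\<rho> i x - \<rho> j x\<bar> \<partial>lborel) < e"
  shows "\<exists>r \<sigma>. strict_mono (r :: nat \<Rightarrow> nat) \<and> adm M \<sigma> \<and> En \<sigma> = h \<and>
     (\<lambda>n. coulD (\<lambda>x. \<rho> (r n) x - \<sigma> x) (\<lambda>x. \<rho> (r n) x - \<sigma> x)) \<longlonglongrightarrow> 0"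
proof -
  note ad = admD[OF a]
  note [measurable] = ad(1)
  obtain r where r: "strict_mono r" and ae: "AE x in lborel. Cauchy (\<lambda>i. \<rho> (r i) x)"
  proof (rule cauchy_L1_AE_cauchy_subseq[of lborel \<rho>])
    show "\<exists>K. \<forall>i\<ge>K. \<forall>j\<ge>K. (LINT x|lborel. norm (\<rho> i x - \<rho> j x)) < e" if "e > 0" for e
      using cauchy[OF that] by simp
  qed (rule ad(3))
  define s where "s n = \<rho> (r n)" for n
  have s: "adm M (s n)" "N43 (s n) \<le> N0" for n using a N by (auto simp: s_def)
  note sd = admD[OF s(1)]
  note [measurable] = sd(1)
  \<comment> \<open>The lower limit is Borel, nonnegative and defined everywhere, with value
    \<open>0\<close> where it is infinite; it agrees with the limit wherever the sequence
    converges.\<close>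
  define \<sigma> where "\<sigma> x = real_of_ereal (liminf (\<lambda>i. ereal (s i x)))" for x
  have [measurable]: "\<sigma> \<in> borel_measurable borel" unfolding \<sigma>_def by measurable
  have \<sigma>0: "0 \<le> \<sigma> x" for x
    unfolding \<sigma>_def by (intro real_of_ereal_pos Liminf_bounded) (auto intro!: always_eventually sd(2))
  have conv: "AE x in lborel. (\<lambda>i. s i x) \<longlonglongrightarrow> \<sigma> x"
    using ae
  proof eventually_elim
    case (elim x)
    then obtain l where l: "(\<lambda>i. s i x) \<longlonglongrightarrow> l" unfolding s_def Cauchy_convergent_iff convergent_def by blast
    then have "liminf (\<lambda>i. ereal (s i x)) = ereal l" by (intro lim_imp_Liminf) auto
    then show ?case using l by (simp add: \<sigma>_def)
  qed
  have scauchy: "\<exists>K. \<forall>i\<ge>K. \<forall>j\<ge>K. (\<integral>x. \<bar>s i x - s j x\<bar> \<partial>lborel) < e" if "e > 0" for e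
    using cauchy[OF that] seq_suble[OF r] unfolding s_def by (meson order_trans)
  \<comment> \<open>Fatou in \<open>j\<close> for fixed \<open>i\<close> turns the Cauchy bound into
    a bound on the distance to the limit.\<close>
  have L1: "\<exists>K. \<forall>i\<ge>K. integrable lborel (\<lambda>x. s i x - \<sigma> x) \<and> (\<integral>x. \<bar>s i x - \<sigma> x\<bar> \<partial>lborel) \<le> e" if e: "e > 0" for e
  proof -
    obtain K where K: "\<And>i j. i \<ge> K \<Longrightarrow> j \<ge> K \<Longrightarrow> (\<integral>x. \<bar>s i x - s j x\<bar> \<partial>lborel) < e" using scauchy[OF e] by blast
    have "integrable lborel (\<lambda>x. s i x - \<sigma> x) \<and> (\<integral>x. \<bar>s i x - \<sigma> x\<bar> \<partial>lborel) \<le> e" if i: "i \<ge> K" for i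
    proof -
      have "(\<integral>\<^sup>+x. ennreal \<bar>s i x - \<sigma> x\<bar> \<partial>lborel) = (\<integral>\<^sup>+x. liminf (\<lambda>j. ennreal \<bar>s i x - s j x\<bar>) \<partial>lborel)"
      proof (rule nn_integral_cong_AE)
        show "AE x in lborel. ennreal \<bar>s i x - \<sigma> x\<bar> = liminf (\<lambda>j. ennreal \<bar>s i x - s j x\<bar>)"
          using conv
        proof eventually_elim
          case (elim x)
          have "(\<lambda>j. ennreal \<bar>s i x - s j x\<bar>) \<longlonglongrightarrow> ennreal \<bar>s i x - \<sigma> x\<bar>"
            by (intro tendsto_ennrealI tendsto_intros elim)
          then show ?case by (intro lim_imp_Liminf[symmetric]) auto
        qed
      qed
      also have "\<dots> \<le> liminf (\<lambda>j. \<integral>\<^sup>+x. ennreal \<bar>s i x - s j x\<bar> \<partial>lborel)"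
        by (rule nn_integral_liminf) measurable
      also have "\<dots> \<le> ennreal e"
      proof (rule Liminf_le)
        show "\<forall>\<^sub>F j in sequentially. (\<integral>\<^sup>+x. ennreal \<bar>s i x - s j x\<bar> \<partial>lborel) \<le> ennreal e"
          using eventually_ge_at_top[of K]
        proof eventually_elim
          case (elim j)
          have "(\<integral>\<^sup>+x. ennreal \<bar>s i x - s j x\<bar> \<partial>lborel) = ennreal (\<integral>x. \<bar>s i x - s j x\<bar> \<partial>lborel)"
            using sd(3) by (intro nn_integral_eq_integral integrable_abs Bochner_Integration.integrable_diff) auto
          then show ?case using K[OF i elim] by (simp add: ennreal_leI)
        qed
      qed simp
      finally have le: "(\<integral>\<^sup>+x. ennreal \<bar>s i x - \<sigma> x\<bar> \<partial>lborel) \<le> ennreal e" .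
      have int: "integrable lborel (\<lambda>x. s i x - \<sigma> x)"
        using le by (intro integrableI_bounded) (auto intro: le_less_trans)
      moreover have "(\<integral>x. \<bar>s i x - \<sigma> x\<bar> \<partial>lborel) \<le> e"
        using le e nn_integral_eq_integral[OF integrable_abs[OF int]] by simp
      ultimately show ?thesis ..
    qed
    then show ?thesis by blast
  qed
  obtain i0 where i0: "integrable lborel (\<lambda>x. s i0 x - \<sigma> x)" using L1[of 1] by auto
  have "integrable lborel (\<lambda>x. s i0 x - (s i0 x - \<sigma> x))" using sd(3) i0 by (rule Bochner_Integration.integrable_diff)
  then have \<sigma>i: "integrable lborel \<sigma>" by simp
  have L1': "(\<lambda>n. \<integral>x. \<bar>s n x - \<sigma> x\<bar> \<partial>lborel) \<longlonglongrightarrow> 0"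
  proof (rule tendstoI)
    fix e :: real assume "e > 0"
    then obtain K where "\<And>i. i \<ge> K \<Longrightarrow> (\<integral>x. \<bar>s i x - \<sigma> x\<bar> \<partial>lborel) \<le> e / 2" using L1[of "e/2"] by auto
    moreover have "0 \<le> (\<integral>x. \<bar>s i x - \<sigma> x\<bar> \<partial>lborel)" for i by simp
    ultimately show "\<forall>\<^sub>F n in sequentially. dist (\<integral>x. \<bar>s n x - \<sigma> x\<bar> \<partial>lborel) 0 < e"
      using \<open>e > 0\<close> by (intro eventually_sequentiallyI[of K]) (simp add: dist_real_def, force)
  qed
  have mass: "(\<integral>x. \<sigma> x \<partial>lborel) = M"
  proof -
    have "(\<lambda>n. \<integral>x. s n x - \<sigma> x \<partial>lborel) \<longlonglongrightarrow> 0"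
      using L1' by (rule Lim_null_comparison[rotated]) (auto intro!: always_eventually integral_norm_bound simp flip: real_norm_def)
    moreover have "(\<integral>x. s n x - \<sigma> x \<partial>lborel) = M - (\<integral>x. \<sigma> x \<partial>lborel)" for n
      using sd(3,5) \<sigma>i by simp
    ultimately show ?thesis by (simp add: LIMSEQ_const_iff)
  qed
  have Phi_conv: "AE x in lborel. (\<lambda>i. \<Phi> (s i x)) \<longlonglongrightarrow> \<Phi> (\<sigma> x)"
    using conv
  proof eventually_elim
    case (elim x)
    show ?case using Phi_cont elim \<sigma>0[of x] sd(2)
      by (auto simp: continuous_on_sequentially comp_def)
  qed
  have Phis [measurable]: "(\<lambda>x. \<Phi> (s i x)) \<in> borel_measurable lborel" for i by (rule Phi_measurable) (use sd in auto)
  have Phi\<sigma> [measurable]: "(\<lambda>x. \<Phi> (\<sigma> x)) \<in> borel_measurable lborel" by (rule Phi_measurable) (use \<sigma>0 in auto)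
  have fatou: "(\<integral>\<^sup>+x. ennreal (\<Phi> (\<sigma> x)) \<partial>lborel) \<le> liminf (\<lambda>i. ennreal (Int_Phi (s i)))"
  proof -
    have "(\<integral>\<^sup>+x. ennreal (\<Phi> (\<sigma> x)) \<partial>lborel) = (\<integral>\<^sup>+x. liminf (\<lambda>i. ennreal (\<Phi> (s i x))) \<partial>lborel)"
    proof (rule nn_integral_cong_AE)
      show "AE x in lborel. ennreal (\<Phi> (\<sigma> x)) = liminf (\<lambda>i. ennreal (\<Phi> (s i x)))"
        using Phi_conv by eventually_elim (intro lim_imp_Liminf[symmetric] tendsto_ennrealI, auto)
    qed
    also have "\<dots> \<le> liminf (\<lambda>i. \<integral>\<^sup>+x. ennreal (\<Phi> (s i x)) \<partial>lborel)"
      by (rule nn_integral_liminf) measurable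
    also have "(\<lambda>i. \<integral>\<^sup>+x. ennreal (\<Phi> (s i x)) \<partial>lborel) = (\<lambda>i. ennreal (Int_Phi (s i)))"
      using sd(4) Phi_nonneg[OF sd(2)] by (simp add: Int_Phi_def nn_integral_eq_integral)
    finally show ?thesis .
  qed
  have Es: "(\<lambda>n. En (s n)) \<longlonglongrightarrow> h" unfolding s_def using LIMSEQ_subseq_LIMSEQ[OF Eh r] by (simp add: o_def)
  obtain B where B: "\<And>\<rho>. adm M \<rho> \<Longrightarrow> Int_Phi \<rho> \<le> 2 * En \<rho> + B" using Int_Phi_le_En[of M] by blast
  \<comment> \<open>Coercivity bounds the internal energies along the sequence, so Fatou yields a
    finite integral.\<close>
  have \<sigma>Phi: "integrable lborel (\<lambda>x. \<Phi> (\<sigma> x))"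
  proof (rule integrableI_nonneg)
    have "liminf (\<lambda>i. ennreal (Int_Phi (s i))) \<le> ennreal (2 * (h + 1) + B)"
    proof (rule Liminf_le)
      have "\<forall>\<^sub>F n in sequentially. En (s n) < h + 1" using Es by (rule order_tendstoD) simp
      then show "\<forall>\<^sub>F n in sequentially. ennreal (Int_Phi (s n)) \<le> ennreal (2 * (h + 1) + B)"
        by eventually_elim (intro ennreal_leI order_trans[OF B[OF s(1)]], simp)
    qed simp
    with fatou have "(\<integral>\<^sup>+x. ennreal (\<Phi> (\<sigma> x)) \<partial>lborel) \<le> ennreal (2 * (h + 1) + B)" by (rule order_trans)
    then show "(\<integral>\<^sup>+x. ennreal (\<Phi> (\<sigma> x)) \<partial>lborel) < \<infinity>" by (auto intro: le_less_trans)
  qed (use Phi\<sigma> \<sigma>0 Phi_nonneg in auto)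
  have \<sigma>a: "adm M \<sigma>" unfolding adm_def using \<sigma>0 \<sigma>i \<sigma>Phi mass by simp
  note ds = adm_density_class[OF s(1)] and d\<sigma> = adm_density_class[OF \<sigma>a]
  define N1 where "N1 = 4 * N0 + 4 * N43 \<sigma>"
  have N1: "N1 > 0" using N0 N43_nonneg[of \<sigma>] by (simp add: N1_def)
  let ?f = "\<lambda>n x. s n x - \<sigma> x"
  have df: "density_class (?f n)" for n by (intro density_class_diff ds d\<sigma>)
  have Nf: "N43 (\<lambda>x. \<bar>?f n x\<bar>) \<le> N1" for n
    using N43_diff[OF ds d\<sigma>, of n] s(2)[of n] by (simp add: N43_def N1_def)
  \<comment> \<open>Used twice: with \<open>g\<close> the absolute difference it gives convergence
    to \<open>\<sigma>\<close> in the form, and with \<open>g\<close> the sum of \<open>s n\<close>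
    and \<open>\<sigma>\<close> it gives convergence of the interaction energies.\<close>
  have tozero: "(\<lambda>n. coulD (\<lambda>x. \<bar>?f n x\<bar>) (g n)) \<longlonglongrightarrow> 0"
    if g: "\<And>n. density_class (g n)" "\<And>n x. 0 \<le> g n x" "\<And>n. N43 (g n) \<le> N1" "\<And>n. (\<integral>x. g n x \<partial>lborel) \<le> 2 * M" for g
  proof (rule tendstoI)
    fix e :: real assume e: "e > 0"
    then have e2: "e / 2 > 0" by simp
    obtain t where t: "t > 0" and *: "\<And>f g. \<lbrakk>density_class f; density_class g; \<And>x. 0 \<le> f x; \<And>x. 0 \<le> g x; N43 f \<le> N1; N43 g \<le> N1\<rbrakk>
       \<Longrightarrow> coulD f g \<le> e / 2 + (\<integral>x. f x \<partial>lborel) * (\<integral>x. g x \<partial>lborel) / t"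
      by (rule coulD_uniform[OF N1 e2]) blast
    have "(\<lambda>n. (\<integral>x. \<bar>?f n x\<bar> \<partial>lborel) * (2 * M) / t) \<longlonglongrightarrow> 0 * (2 * M) / t"
      using t by (intro tendsto_intros L1') auto
    then have "(\<lambda>n. (\<integral>x. \<bar>?f n x\<bar> \<partial>lborel) * (2 * M) / t) \<longlonglongrightarrow> 0" by simp
    then have "\<forall>\<^sub>F n in sequentially. (\<integral>x. \<bar>?f n x\<bar> \<partial>lborel) * (2 * M) / t < e / 2"
      using e2 by (rule order_tendstoD)
    then show "\<forall>\<^sub>F n in sequentially. dist (coulD (\<lambda>x. \<bar>?f n x\<bar>) (g n)) 0 < e"
    proof eventually_elim
      case (elim n)
      have "coulD (\<lambda>x. \<bar>?f n x\<bar>) (g n) \<le> e / 2 + (\<integral>x. \<bar>?f n x\<bar> \<partial>lborel) * (\<integral>x. g n x \<partial>lborel) / t"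
        by (rule *) (auto intro: density_class_abs df g Nf)
      also have "(\<integral>x. \<bar>?f n x\<bar> \<partial>lborel) * (\<integral>x. g n x \<partial>lborel) / t \<le> (\<integral>x. \<bar>?f n x\<bar> \<partial>lborel) * (2 * M) / t"
        using t g(4) by (intro divide_right_mono mult_left_mono) auto
      finally show ?case using elim coulD_nonneg[of "\<lambda>x. \<bar>?f n x\<bar>" "g n"] g(2) by (simp add: dist_real_def)
    qed
  qed
  have absint: "(\<integral>x. \<bar>?f n x\<bar> \<partial>lborel) \<le> 2 * M" for n
  proof -
    have "(\<integral>x. \<bar>?f n x\<bar> \<partial>lborel) \<le> (\<integral>x. s n x + \<sigma> x \<partial>lborel)"
      using sd(2,3) \<sigma>0 \<sigma>i by (intro integral_mono integrable_abs) (auto simp: abs_le_iff)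
    then show ?thesis using sd(3,5) \<sigma>i mass by simp
  qed
  have Df: "(\<lambda>n. coulD (?f n) (?f n)) \<longlonglongrightarrow> 0"
  proof (rule Lim_null_comparison[OF always_eventually tozero])
    show "\<forall>n. norm (coulD (?f n) (?f n)) \<le> coulD (\<lambda>x. \<bar>?f n x\<bar>) (\<lambda>x. \<bar>?f n x\<bar>)"
      using coulD_abs_le by simp
  qed (auto intro: density_class_abs df Nf absint)
  have Dsum: "(\<lambda>n. coulD (?f n) (\<lambda>x. s n x + \<sigma> x)) \<longlonglongrightarrow> 0"
  proof (rule Lim_null_comparison[OF always_eventually tozero])
    have "norm (coulD (?f n) (\<lambda>x. s n x + \<sigma> x)) \<le> coulD (\<lambda>x. \<bar>?f n x\<bar>) (\<lambda>x. s n x + \<sigma> x)" for n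
      using coulD_abs_le[of "?f n" "\<lambda>x. s n x + \<sigma> x"] sd(2) \<sigma>0 by simp
    then show "\<forall>n. norm (coulD (?f n) (\<lambda>x. s n x + \<sigma> x)) \<le> coulD (\<lambda>x. \<bar>?f n x\<bar>) (\<lambda>x. s n x + \<sigma> x)" ..
    show "N43 (\<lambda>x. s n x + \<sigma> x) \<le> N1" for n using N43_add[OF ds d\<sigma>, of n] s(2)[of n] by (simp add: N1_def)
    show "(\<integral>x. s n x + \<sigma> x \<partial>lborel) \<le> 2 * M" for n using sd(3,5) \<sigma>i mass by simp
  qed (auto intro: density_class_add ds d\<sigma> add_nonneg_nonneg sd(2) \<sigma>0)
  have "coulD (?f n) (\<lambda>x. s n x + \<sigma> x) = coulD (s n) (s n) - coulD \<sigma> \<sigma>" for n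
    using ds[of n] d\<sigma> by (simp add: coulD_diff_left coulD_add_right density_class_add coulD_commute[of \<sigma> "s n"])
  with Dsum have "(\<lambda>n. coulD (s n) (s n) - coulD \<sigma> \<sigma>) \<longlonglongrightarrow> 0" by simp
  then have Ds: "(\<lambda>n. coulD (s n) (s n)) \<longlonglongrightarrow> coulD \<sigma> \<sigma>" by (simp add: LIM_zero_iff)
  have "(\<lambda>n. En (s n) + coulD (s n) (s n) / 2) \<longlonglongrightarrow> h + coulD \<sigma> \<sigma> / 2"
    by (intro tendsto_intros Es Ds) simp
  then have Js: "(\<lambda>n. Int_Phi (s n)) \<longlonglongrightarrow> h + coulD \<sigma> \<sigma> / 2" by (simp add: En_def)
  then have "liminf (\<lambda>i. ennreal (Int_Phi (s i))) = ennreal (h + coulD \<sigma> \<sigma> / 2)"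
    by (intro lim_imp_Liminf tendsto_ennrealI) auto
  moreover have "0 \<le> h + coulD \<sigma> \<sigma> / 2"
    using Js by (rule LIMSEQ_le_const) (auto intro: Int_Phi_nonneg[OF s(1)])
  moreover have "(\<integral>\<^sup>+x. ennreal (\<Phi> (\<sigma> x)) \<partial>lborel) = ennreal (Int_Phi \<sigma>)"
    unfolding Int_Phi_def using \<sigma>Phi \<sigma>0 by (intro nn_integral_eq_integral) (auto intro: Phi_nonneg)
  ultimately have "Int_Phi \<sigma> \<le> h + coulD \<sigma> \<sigma> / 2" using fatou by simp
  then have "En \<sigma> = h" using En_ge[OF \<sigma>a] unfolding En_def by linarith
  then show ?thesis using r \<sigma>a Df unfolding s_def by blast
qed

text \<open>The shift by \<open>c n\<close> puts the ball of mass \<open>d\<close> found by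
  \<open>nonvanishing\<close> at the origin, which is the situation in which
  \<open>concentration\<close> yields tightness around one fixed centre.\<close>

lemma minimizing_sequence_compact:
  fixes \<rho> :: "nat \<Rightarrow> real^3 \<Rightarrow> real"
  assumes a: "\<And>n. adm M (\<rho> n)" and Eh: "(\<lambda>n. En (\<rho> n)) \<longlonglongrightarrow> h"
  shows "\<exists>r b \<sigma>. strict_mono (r :: nat \<Rightarrow> nat) \<and> adm M \<sigma> \<and> En \<sigma> = h \<and>
     (\<lambda>n. coulD (\<lambda>x. \<rho> (r n) (x + b n) - \<sigma> x) (\<lambda>x. \<rho> (r n) (x + b n) - \<sigma> x)) \<longlonglongrightarrow> 0"
proof -
  obtain R0 d where R0: "R0 > 0" and d: "d > 0"
    and nv: "\<And>\<rho>. adm M \<rho> \<Longrightarrow> En \<rho> \<le> h / 2 \<Longrightarrow> \<exists>a. d \<le> (\<integral>x. \<rho> x * indicator (ball a R0) x \<partial>lborel)"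
    using nonvanishing by blast
  have "\<forall>\<^sub>F n in sequentially. En (\<rho> n) < h / 2" using Eh by (rule order_tendstoD) (use h_neg in simp)
  then obtain n0 where n0: "\<And>n. n \<ge> n0 \<Longrightarrow> En (\<rho> n) < h / 2" unfolding eventually_sequentially by blast
  \<comment> \<open>Drops initial terms, so that the bound \<open>h / 2\<close> required by
    \<open>nonvanishing\<close> holds for every index.\<close>
  define r0 where "r0 n = n + n0" for n :: nat
  have r0: "strict_mono r0" by (simp add: r0_def strict_mono_def)
  have "\<exists>a. d \<le> (\<integral>x. \<rho> (r0 n) x * indicator (ball a R0) x \<partial>lborel)" for n
    by (rule nv[OF a]) (use n0[of "r0 n"] in \<open>simp add: r0_def\<close>)
  then obtain c where c: "\<And>n. d \<le> (\<integral>x. \<rho> (r0 n) x * indicator (ball (c n) R0) x \<partial>lborel)" by metis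
  define s where "s n = (\<lambda>x. \<rho> (r0 n) (x + c n))" for n
  have s: "adm M (s n)" "En (s n) = En (\<rho> (r0 n))" for n unfolding s_def using adm_shift[OF a] by auto
  note sd = admD[OF s(1)]
  have Es: "(\<lambda>n. En (s n)) \<longlonglongrightarrow> h" unfolding s(2) using LIMSEQ_subseq_LIMSEQ[OF Eh r0] by (simp add: o_def)
  have sh: "(\<integral>x. s n x * indicator (A (0::real^3)) x \<partial>lborel) = (\<integral>x. \<rho> (r0 n) x * indicator (A (c n)) x \<partial>lborel)"
    if "A = (\<lambda>a. ball a R) \<or> A = (\<lambda>a. - ball a R)" for n A R
  proof -
    note [measurable] = admD(1)[OF a]
    have [measurable]: "ball (c n) R \<in> sets borel" by simp
    have [measurable]: "A (c n) \<in> sets borel" using that by auto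
    have "(\<integral>x. \<rho> (r0 n) (x + c n) * indicator (A (c n)) (x + c n) \<partial>lborel) = (\<integral>x. \<rho> (r0 n) x * indicator (A (c n)) x \<partial>lborel)"
      by (intro integral_lborel_shift[of "\<lambda>x. \<rho> (r0 n) x * indicator (A (c n)) x" "c n"]) measurable
    moreover have "indicator (A (c n)) (x + c n) = (indicator (A 0) x :: real)" for x
      using that by (auto simp: indicator_def dist_norm norm_minus_commute)
    ultimately show ?thesis by (simp add: s_def)
  qed
  obtain N0 where N0: "N0 > 0" "\<And>n. N43 (s n) \<le> N0"
  proof -
    obtain N where N: "N > 0" "\<And>\<rho>. adm M \<rho> \<Longrightarrow> En \<rho> \<le> h/2 \<Longrightarrow> N43 \<rho> \<le> N" using N43_bounded[of M "h/2"] by blast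
    have "En (s n) \<le> h / 2" for n using n0[of "r0 n"] s(2)[of n] by (simp add: r0_def)
    then show ?thesis using that[OF N(1)] N(2)[OF s(1)] by blast
  qed
  have tight: "\<exists>R>0. \<exists>K. \<forall>n\<ge>K. (\<integral>x. s n x * indicator (- ball 0 R) x \<partial>lborel) < e" if e: "e > 0" for e
  proof -
    obtain \<eta> R where \<eta>: "\<eta> > 0" and R: "R > 0" and *: "\<And>\<rho> a. adm M \<rho> \<Longrightarrow> En \<rho> < h + \<eta> \<Longrightarrow> d \<le> (\<integral>x. \<rho> x * indicator (ball a R0) x \<partial>lborel)
       \<Longrightarrow> (\<integral>x. \<rho> x * indicator (- ball a R) x \<partial>lborel) < e"
      using concentration[OF R0 d e] by blast
    have "\<forall>\<^sub>F n in sequentially. En (s n) < h + \<eta>" using Es by (rule order_tendstoD) (use \<eta> in simp)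
    then obtain K where K: "\<And>n. n \<ge> K \<Longrightarrow> En (s n) < h + \<eta>" unfolding eventually_sequentially by blast
    have "(\<integral>x. s n x * indicator (- ball 0 R) x \<partial>lborel) < e" if "n \<ge> K" for n
      by (rule *[OF s(1) K[OF that]]) (use c[of n] sh[of "\<lambda>a. ball a R0" R0 n] in simp)
    then show ?thesis using R by blast
  qed
  have "\<exists>r. strict_mono (r :: nat \<Rightarrow> nat) \<and> (\<forall>e>0. \<exists>K. \<forall>i\<ge>K. \<forall>j\<ge>K.
     coulD (\<lambda>x. s (r i) x - s (r j) x) (\<lambda>x. s (r i) x - s (r j) x) < e)"
    by (rule subsequence_coulD_Cauchy[OF adm_density_class[OF s(1)] sd(2) M_pos sd(5) N0]) (rule tight)
  then obtain r1 where r1': "strict_mono (r1 :: nat \<Rightarrow> nat) \<and> (\<forall>e>0. \<exists>K. \<forall>i\<ge>K. \<forall>j\<ge>K.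
     coulD (\<lambda>x. s (r1 i) x - s (r1 j) x) (\<lambda>x. s (r1 i) x - s (r1 j) x) < e)" ..
  note r1 = conjunct1[OF r1'] and Dc = conjunct2[OF r1', rule_format]
  have Es1: "(\<lambda>n. En (s (r1 n))) \<longlonglongrightarrow> h" using LIMSEQ_subseq_LIMSEQ[OF Es r1] by (simp add: o_def)
  have L1c: "\<exists>K. \<forall>i\<ge>K. \<forall>j\<ge>K. (\<integral>x. \<bar>s (r1 i) x - s (r1 j) x\<bar> \<partial>lborel) < e" if e: "e > 0" for e
  proof -
    have e8: "e / 8 > 0" using e by simp
    obtain R K1 where R: "R > 0" and K1: "\<And>n. n \<ge> K1 \<Longrightarrow> (\<integral>x. s n x * indicator (- ball 0 R) x \<partial>lborel) < e / 8"
      using tight[OF e8] by blast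
    obtain q where q: "q > 0" and *: "\<And>\<rho> \<sigma>. adm M \<rho> \<Longrightarrow> adm M \<sigma> \<Longrightarrow> N43 \<rho> \<le> N0 \<Longrightarrow> N43 \<sigma> \<le> N0
     \<Longrightarrow> (\<integral>x. \<rho> x * indicator (- ball 0 R) x \<partial>lborel) < e/8 \<Longrightarrow> (\<integral>x. \<sigma> x * indicator (- ball 0 R) x \<partial>lborel) < e/8
     \<Longrightarrow> (\<integral>x. gap (\<rho> x) (\<sigma> x) \<partial>lborel) < q \<Longrightarrow> (\<integral>x. \<bar>\<rho> x - \<sigma> x\<bar> \<partial>lborel) < e"
      using L1_estimate[OF N0(1) e R, of M] by blast
    \<comment> \<open>Energies below \<open>h + q / 2\<close> and a form below \<open>q\<close> make
      the gap integral less than \<open>q / 2 + q / 8\<close>.\<close>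
    have "\<forall>\<^sub>F n in sequentially. En (s (r1 n)) < h + q / 2" using Es1 by (rule order_tendstoD) (use q in simp)
    then obtain K2 where K2: "\<And>n. n \<ge> K2 \<Longrightarrow> En (s (r1 n)) < h + q / 2" unfolding eventually_sequentially by blast
    obtain K3 where K3: "\<And>i j. i \<ge> K3 \<Longrightarrow> j \<ge> K3 \<Longrightarrow> coulD (\<lambda>x. s (r1 i) x - s (r1 j) x) (\<lambda>x. s (r1 i) x - s (r1 j) x) < q"
      using Dc[OF q] by blast
    have "(\<integral>x. \<bar>s (r1 i) x - s (r1 j) x\<bar> \<partial>lborel) < e" if ij: "i \<ge> max K1 (max K2 K3)" "j \<ge> max K1 (max K2 K3)" for i j
    proof (rule *[OF s(1) s(1) N0(2) N0(2)])
      show "(\<integral>x. s (r1 i) x * indicator (- ball 0 R) x \<partial>lborel) < e / 8"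
        using K1 ij(1) seq_suble[OF r1, of i] by simp
      show "(\<integral>x. s (r1 j) x * indicator (- ball 0 R) x \<partial>lborel) < e / 8"
        using K1 ij(2) seq_suble[OF r1, of j] by simp
      have "(\<integral>x. gap (s (r1 i) x) (s (r1 j) x) \<partial>lborel) \<le> (En (s (r1 i)) + En (s (r1 j))) / 2 - h
          + coulD (\<lambda>x. s (r1 i) x - s (r1 j) x) (\<lambda>x. s (r1 i) x - s (r1 j) x) / 8"
        by (rule midpoint_gap[OF s(1) s(1)])
      also have "\<dots> < q"
      proof -
        have "(u + v) / 2 - h + w / 8 < q" if "u < h + q / 2" "v < h + q / 2" "w < q" for u v w :: real
          using that q by argo
        then show ?thesis using K2[of i] K2[of j] K3[of i j] ij by auto
      qed
      finally show "(\<integral>x. gap (s (r1 i) x) (s (r1 j) x) \<partial>lborel) < q" .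
    qed
    then show ?thesis by blast
  qed
  have "\<exists>r \<sigma>. strict_mono (r :: nat \<Rightarrow> nat) \<and> adm M \<sigma> \<and> En \<sigma> = h \<and>
     (\<lambda>n. coulD (\<lambda>x. s (r1 (r n)) x - \<sigma> x) (\<lambda>x. s (r1 (r n)) x - \<sigma> x)) \<longlonglongrightarrow> 0"
    by (rule L1_limit_minimizer[OF s(1) Es1 N0]) (rule L1c)
  then obtain r2 \<sigma> where r2': "strict_mono (r2 :: nat \<Rightarrow> nat) \<and> adm M \<sigma> \<and> En \<sigma> = h \<and>
     (\<lambda>n. coulD (\<lambda>x. s (r1 (r2 n)) x - \<sigma> x) (\<lambda>x. s (r1 (r2 n)) x - \<sigma> x)) \<longlonglongrightarrow> 0" by (elim exE) (rule that)
  have "strict_mono (\<lambda>n. r0 (r1 (r2 n)))"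
    using strict_mono_o[OF r0 strict_mono_o[OF r1 conjunct1[OF r2']]] by (simp add: o_def)
  with r2' have "strict_mono (\<lambda>n. r0 (r1 (r2 n))) \<and> adm M \<sigma> \<and> En \<sigma> = h \<and>
     (\<lambda>n. coulD (\<lambda>x. \<rho> (r0 (r1 (r2 n))) (x + c (r1 (r2 n))) - \<sigma> x)
       (\<lambda>x. \<rho> (r0 (r1 (r2 n))) (x + c (r1 (r2 n))) - \<sigma> x)) \<longlonglongrightarrow> 0"
    unfolding s_def by blast
  then show ?thesis
    by (intro exI[of _ "\<lambda>n. r0 (r1 (r2 n))"] exI[of _ "\<lambda>n. c (r1 (r2 n))"] exI[of _ \<sigma>])
qed

end

section \<open>Stability\<close>

lemma lebesgue_lborel_transfer:
  fixes F G :: "real^3 \<Rightarrow> real"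
  assumes G: "G \<in> borel_measurable borel" and ae: "AE x in lborel. F x = G x"
  shows "F \<in> borel_measurable lebesgue" "integral\<^sup>L lebesgue F = integral\<^sup>L lborel G"
    "integrable lebesgue F \<longleftrightarrow> integrable lborel G"
proof -
  have G': "G \<in> borel_measurable lebesgue" using G by (simp add: measurable_completion)
  have ae': "AE x in lebesgue. G x = F x" using ae by (simp add: AE_completion_iff eq_commute)
  show F: "F \<in> borel_measurable lebesgue" by (rule borel_measurable_AE[OF G' ae'])
  have "integral\<^sup>L lebesgue F = integral\<^sup>L lebesgue G"
    using ae' F G' by (intro integral_cong_AE) (auto elim: eventually_mono)
  then show "integral\<^sup>L lebesgue F = integral\<^sup>L lborel G" using integral_completion[of G lborel] G by simp
  have "integrable lebesgue F \<longleftrightarrow> integrable lebesgue G"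
    using ae' F G' by (intro integrable_cong_AE) (auto elim: eventually_mono)
  then show "integrable lebesgue F \<longleftrightarrow> integrable lborel G" using integrable_completion[of G lborel] G by simp
qed

lemma newton_measurable [measurable]:
  assumes [measurable]: "f \<in> borel_measurable borel" shows "newton f \<in> borel_measurable borel"
  unfolding newton_def by measurable

lemma coulD_self_cong_AE:
  assumes f: "density_class f" and g: "density_class g" and ae: "AE x in lborel. f x = g x"
  shows "coulD f f = coulD g g"
proof -
  note [measurable] = density_classD[OF f] density_classD[OF g]
  have "(\<integral>y. f y / dist x y \<partial>lborel) = (\<integral>y. g y / dist x y \<partial>lborel)" for x
    by (rule integral_cong_AE) (use ae in auto)
  then show ?thesis
    unfolding coulD_iterated(1)[OF f f] coulD_iterated(1)[OF g g]
    by (intro integral_cong_AE) (use ae in \<open>auto elim: eventually_mono\<close>)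
qed

text \<open>Equality holds at every point, because each value of the potential is an integral that
  ignores null sets; the pointwise gradients therefore agree as well.\<close>

lemma Vpot_eq_newton:
  assumes g [measurable]: "g \<in> borel_measurable borel" and ae: "AE x in lborel. \<rho> x = g x"
  shows "Vpot \<rho> = newton g"
proof
  fix x
  have "(\<integral>y. \<rho> y / dist x y \<partial>lebesgue) = (\<integral>y. g y / dist x y \<partial>lborel)"
    by (rule lebesgue_lborel_transfer) (use ae in auto)
  then show "Vpot \<rho> x = newton g x" by (simp add: Vpot_def newton_def)
qed

lemma Ekin_nonneg: "(\<And>x. 0 \<le> \<rho> x) \<Longrightarrow> Ekin \<rho> u \<ge> 0"
  unfolding Ekin_def by (intro mult_nonneg_nonneg Bochner_Integration.integral_nonneg) auto

context polytrope
begin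

definition rep :: "real \<Rightarrow> (real^3 \<Rightarrow> real) \<Rightarrow> (real^3 \<Rightarrow> real) \<Rightarrow> bool" where
  "rep m \<rho> g \<longleftrightarrow> adm m g \<and> (AE x in lborel. \<rho> x = g x)"

lemma rep_exists:
  assumes "\<rho> \<in> FM \<Phi> m" shows "\<exists>g. rep m \<rho> g"
proof -
  have \<rho>: "integrable lebesgue \<rho>" "\<And>x. 0 \<le> \<rho> x" "integrable lebesgue (\<lambda>x. \<Phi> (\<rho> x))" "(\<integral>x. \<rho> x \<partial>lebesgue) = m"
    using assms by (auto simp: FM_def)
  obtain g' where g' [measurable]: "g' \<in> borel_measurable lborel" and ae: "AE x in lborel. \<rho> x = g' x"
    using completion_ex_borel_measurable_real[of \<rho> lborel] \<rho>(1) by auto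
  \<comment> \<open>\<open>max 0\<close> makes the representative nonnegative everywhere instead of
    almost everywhere.\<close>
  define g where "g x = max 0 (g' x)" for x
  have [measurable]: "g \<in> borel_measurable borel" unfolding g_def using g' by simp
  have ae': "AE x in lborel. \<rho> x = g x" using ae by eventually_elim (use \<rho>(2) in \<open>simp add: g_def max_def\<close>, metis)
  have g0: "0 \<le> g x" for x by (simp add: g_def)
  have Pm: "(\<lambda>x. \<Phi> (g x)) \<in> borel_measurable borel" by (rule Phi_measurable) (use g0 in auto)
  have aeP: "AE x in lborel. \<Phi> (\<rho> x) = \<Phi> (g x)" using ae' by eventually_elim simp
  have "adm m g"
    unfolding adm_def using lebesgue_lborel_transfer[OF _ ae'] lebesgue_lborel_transfer[OF Pm aeP] \<rho> g0 by auto
  then show ?thesis using ae' unfolding rep_def by blast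
qed

lemma rep_self: "adm m g \<Longrightarrow> rep m g g" by (simp add: rep_def)

lemma adm_FM:
  assumes "adm m g" shows "g \<in> FM \<Phi> m"
proof -
  note ad = admD[OF assms]
  have Pm: "(\<lambda>x. \<Phi> (g x)) \<in> borel_measurable borel" by (rule Phi_measurable) (use ad in auto)
  show ?thesis unfolding FM_def
    using ad lebesgue_lborel_transfer[OF ad(1), of g] lebesgue_lborel_transfer[OF Pm, of "\<lambda>x. \<Phi> (g x)"] by simp
qed

lemma rep_shift:
  assumes "rep m \<rho> g" shows "rep m (shift a \<rho>) (\<lambda>x. g (x + a))"
proof -
  from assms have g: "adm m g" and ae: "AE x in lborel. \<rho> x = g x" by (auto simp: rep_def)
  have "adm m (\<lambda>x. g (x + a))" by (rule adm_shift[OF g])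
  moreover have "AE x in lborel. shift a \<rho> x = g (x + a)"
    using AE_lborel_shift[OF ae, of a] by (simp add: shift_def)
  ultimately show ?thesis by (simp add: rep_def)
qed

lemma rep_Int_Phi:
  assumes "rep m \<rho> g"
  shows "(\<integral>x. \<Phi> (\<rho> x) \<partial>lebesgue) = Int_Phi g"
proof -
  from assms have g: "adm m g" and ae: "AE x in lborel. \<rho> x = g x" by (auto simp: rep_def)
  have Pm: "(\<lambda>x. \<Phi> (g x)) \<in> borel_measurable borel" by (rule Phi_measurable) (use admD[OF g] in auto)
  show ?thesis unfolding Int_Phi_def
    by (rule lebesgue_lborel_transfer(2)[OF Pm]) (use ae in \<open>auto elim: eventually_mono\<close>)
qed

lemma rep_Epot:
  assumes "rep m \<rho> g"
  shows "Epot \<rho> = - coulD g g / 2"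
proof -
  from assms have g: "adm m g" and ae: "AE x in lborel. \<rho> x = g x" by (auto simp: rep_def)
  note [measurable] = admD(1)[OF g]
  note dc = adm_density_class[OF g]
  have "(\<integral>y. \<rho> x * \<rho> y / dist x y \<partial>lebesgue) = \<rho> x * (\<integral>y. g y / dist x y \<partial>lborel)" for x
  proof -
    have "(\<integral>y. \<rho> x * \<rho> y / dist x y \<partial>lebesgue) = (\<integral>y. \<rho> x * (g y / dist x y) \<partial>lborel)"
      by (rule lebesgue_lborel_transfer) (use ae in \<open>auto elim: eventually_mono\<close>)
    then show ?thesis by (simp flip: Bochner_Integration.integral_mult_right_zero)
  qed
  then have "(\<integral>x. (\<integral>y. \<rho> x * \<rho> y / dist x y \<partial>lebesgue) \<partial>lebesgue) = (\<integral>x. \<rho> x * (\<integral>y. g y / dist x y \<partial>lborel) \<partial>lebesgue)"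
    by simp
  also have "\<dots> = (\<integral>x. g x * (\<integral>y. g y / dist x y \<partial>lborel) \<partial>lborel)"
    by (rule lebesgue_lborel_transfer) (use ae in \<open>auto elim: eventually_mono\<close>)
  also have "\<dots> = coulD g g" using coulD_iterated(1)[OF dc dc] by simp
  finally show ?thesis unfolding Epot_def by simp
qed

lemma rep_Hr: "rep m \<rho> g \<Longrightarrow> Hr \<Phi> \<rho> = En g"
  unfolding Hr_def En_def by (simp add: rep_Int_Phi rep_Epot)

lemma rep_Henergy: "rep m \<rho> g \<Longrightarrow> Henergy \<Phi> \<rho> u = Ekin \<rho> u + En g"
  unfolding Henergy_def En_def by (simp add: rep_Int_Phi rep_Epot)

text \<open>The potential term contributes \<open>- coulD (g - f) f\<close>, which is exactly the
  cross term in the expansion of the form of \<open>g - f\<close>. The constant \<open>E0\<close>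
  multiplies the difference of the masses, which is \<open>0\<close>.\<close>

lemma rep_dfun:
  assumes r: "rep m \<rho> g" and s: "rep m \<sigma> f"
  shows "dfun \<Phi> E0 \<rho> \<sigma> = En g - En f + coulD (\<lambda>x. g x - f x) (\<lambda>x. g x - f x) / 2"
proof -
  from r s have g: "adm m g" and aeg: "AE x in lborel. \<rho> x = g x"
    and f: "adm m f" and aef: "AE x in lborel. \<sigma> x = f x" by (auto simp: rep_def)
  note gd = admD[OF g] and fd = admD[OF f]
  note dg = adm_density_class[OF g] and df = adm_density_class[OF f]
  have [measurable]: "(\<lambda>x. \<Phi> (g x)) \<in> borel_measurable borel" "(\<lambda>x. \<Phi> (f x)) \<in> borel_measurable borel"
    using gd fd by (auto intro!: Phi_measurable)
  note [measurable] = gd(1) fd(1)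
  note V = Vpot_eq_newton[OF fd(1) aef]
  let ?k = "\<lambda>x. g x - f x"
  have dk: "density_class ?k" by (rule density_class_diff[OF dg df])
  have N: "?k x * newton f x = - (?k x * (\<integral>y. f y / dist x y \<partial>lborel))" for x by (simp add: newton_def)
  have i: "integrable lborel (\<lambda>x. ?k x * newton f x)" unfolding N using coulD_iterated(2)[OF dk df] by simp
  have e: "(\<integral>x. ?k x * newton f x \<partial>lborel) = - coulD ?k f" unfolding N coulD_iterated(1)[OF dk df] by simp
  have "dfun \<Phi> E0 \<rho> \<sigma> = (\<integral>x. \<Phi> (g x) - \<Phi> (f x) + (newton f x - E0) * (g x - f x) \<partial>lborel)"
    unfolding dfun_def V
  proof (rule lebesgue_lborel_transfer(2))
    show "AE x in lborel. \<Phi> (\<rho> x) - \<Phi> (\<sigma> x) + (newton f x - E0) * (\<rho> x - \<sigma> x)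
      = \<Phi> (g x) - \<Phi> (f x) + (newton f x - E0) * (g x - f x)"
      using aeg aef by eventually_elim simp
  qed measurable
  also have "\<dots> = (\<integral>x. (\<Phi> (g x) - \<Phi> (f x)) + (?k x * newton f x - E0 * ?k x) \<partial>lborel)"
    by (intro Bochner_Integration.integral_cong) (auto simp: algebra_simps)
  also have "\<dots> = (Int_Phi g - Int_Phi f) + (- coulD ?k f - E0 * 0)"
  proof -
    have k: "integrable lborel ?k" "(\<integral>x. ?k x \<partial>lborel) = 0" using gd fd by simp_all
    have "(\<integral>x. \<Phi> (g x) - \<Phi> (f x) \<partial>lborel) = Int_Phi g - Int_Phi f"
      using gd fd by (simp add: Int_Phi_def)
    moreover have "(\<integral>x. ?k x * newton f x - E0 * ?k x \<partial>lborel) = - coulD ?k f - E0 * 0"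
      using i e k by (subst Bochner_Integration.integral_diff) auto
    moreover have "integrable lborel (\<lambda>x. ?k x * newton f x - E0 * ?k x)"
      using i k(1) by (intro Bochner_Integration.integrable_diff) auto
    ultimately show ?thesis using gd fd by (subst Bochner_Integration.integral_add) auto
  qed
  also have "\<dots> = En g - En f + coulD ?k ?k / 2"
    unfolding coulD_diff_self[OF dg df] En_def coulD_diff_left[OF dg df df] coulD_commute[OF df dg]
    by (simp add: field_simps)
  finally show ?thesis .
qed

text \<open>The half from \<open>rep_dfun\<close> and the field energy combine into one coefficient
  of the form, equal to \<open>1\<close> for the classical value \<open>4 * pi\<close> of
  \<open>gradC\<close>. The rest is the excess energy, which is conserved.\<close>

lemma rep_stabq:
  assumes r: "rep m \<rho> g" and s: "rep m \<sigma> f"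
  shows "stabq \<Phi> E0 \<sigma> \<rho> u = Henergy \<Phi> \<rho> u - En f + (1/2 + gradC / (8 * pi)) * coulD (\<lambda>x. g x - f x) (\<lambda>x. g x - f x)"
    and "L2sq (\<lambda>x. grad (Vpot \<rho>) x - grad (Vpot \<sigma>) x) = gradC * coulD (\<lambda>x. g x - f x) (\<lambda>x. g x - f x)"
proof -
  from r s have g: "adm m g" and aeg: "AE x in lborel. \<rho> x = g x"
    and f: "adm m f" and aef: "AE x in lborel. \<sigma> x = f x" by (auto simp: rep_def)
  show L: "L2sq (\<lambda>x. grad (Vpot \<rho>) x - grad (Vpot \<sigma>) x) = gradC * coulD (\<lambda>x. g x - f x) (\<lambda>x. g x - f x)"
    unfolding Vpot_eq_newton[OF admD(1)[OF g] aeg] Vpot_eq_newton[OF admD(1)[OF f] aef]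
    by (rule L2sq_grad_newton_diff[OF adm_density_class[OF g] adm_density_class[OF f]])
  show "stabq \<Phi> E0 \<sigma> \<rho> u = Henergy \<Phi> \<rho> u - En f + (1/2 + gradC / (8 * pi)) * coulD (\<lambda>x. g x - f x) (\<lambda>x. g x - f x)"
    unfolding stabq_def L rep_dfun[OF r s] rep_Henergy[OF r] by (simp add: algebra_simps)
qed

end

section \<open>From the hypotheses on \<open>\<Phi>\<close> to the locale\<close>

text \<open>A negative value at \<open>r\<close> would by convexity force the difference quotients
  at \<open>0\<close> below \<open>\<Phi> r / r < 0\<close>, against \<open>\<Phi>' 0 = 0\<close>.
  For \<open>Phi_super\<close>, the growth hypothesis beats \<open>r powr (4/3)\<close> by a factor
  \<open>r powr b\<close> beyond \<open>R1\<close>, and below \<open>R1\<close> the power is at most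
  \<open>R1 powr (1/3) * r\<close>.\<close>

lemma polytropeI:
  fixes \<Phi> \<Phi>' :: "real \<Rightarrow> real"
  assumes der: "\<forall>r\<ge>0. (\<Phi> has_real_derivative \<Phi>' r) (at r within {0..})"
    and Phi_0: "\<Phi> 0 = 0" "\<Phi>' 0 = 0"
    and convex: "strictly_convex_on {0..} \<Phi>"
    and large: "\<exists>C>0. \<exists>n. 0 < n \<and> n < 3 \<and> (\<exists>R. \<forall>r\<ge>R. C * r powr (1 + 1/n) \<le> \<Phi> r)"
    and small: "\<exists>C>0. \<exists>n'. 0 < n' \<and> n' < 3 \<and>
                      (\<exists>r0>0. \<forall>r. 0 \<le> r \<and> r \<le> r0 \<longrightarrow> \<Phi> r \<le> C * r powr (1 + 1/n'))"
  shows "polytrope \<Phi>"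
proof
  show "continuous_on {0..} \<Phi>"
    by (rule DERIV_continuous_on[where D = \<Phi>']) (use der in auto)
  show nonneg: "\<Phi> r \<ge> 0" if r: "r \<ge> 0" for r
  proof (rule ccontr)
    assume "\<not> \<Phi> r \<ge> 0"
    then have neg: "\<Phi> r < 0" by simp
    then have r0: "r > 0" using r Phi_0 by (cases "r = 0") auto
    have "((\<lambda>y. (\<Phi> y - \<Phi> 0) / (y - 0)) \<longlongrightarrow> 0) (at 0 within {0..})"
      using der Phi_0 unfolding has_field_derivative_iff by force
    then have "\<forall>\<^sub>F y in at 0 within {0..}. dist (\<Phi> y / y) 0 < - \<Phi> r / r"
      using Phi_0 neg r0 by (intro tendstoD) (auto simp: divide_neg_pos)
    then obtain d where d: "d > 0" "\<And>y. y \<in> {0..} \<Longrightarrow> y \<noteq> 0 \<Longrightarrow> dist y 0 < d \<Longrightarrow> dist (\<Phi> y / y) 0 < - \<Phi> r / r"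
      unfolding eventually_at by blast
    define y where "y = min (d/2) (r/2)"
    have y: "0 < y" "y < d" "y < r" using d r0 by (auto simp: y_def)
    have t: "0 < y / r" "y / r < 1" using y r0 by auto
    have "\<Phi> ((1 - y/r) * 0 + (y/r) * r) < (1 - y/r) * \<Phi> 0 + (y/r) * \<Phi> r"
      using convex t r0 unfolding strictly_convex_on_def by (metis atLeast_iff order_refl r less_irrefl)
    then have "\<Phi> y < (y/r) * \<Phi> r" using r0 Phi_0 by simp
    then have "\<Phi> y / y < \<Phi> r / r" using y r0 by (simp add: field_simps)
    moreover have "\<bar>\<Phi> y / y\<bar> < - \<Phi> r / r" using d(2)[of y] y by (simp add: dist_real_def)
    ultimately show False by linarith
  qed
  show "\<exists>C\<ge>0. \<forall>r\<ge>0. r powr (4/3) \<le> e * \<Phi> r + C * r" if e: "e > 0" for e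
  proof -
    obtain C n R where C: "C > 0" and n: "0 < n" "n < 3" and R: "\<And>r. r \<ge> R \<Longrightarrow> C * r powr (1 + 1/n) \<le> \<Phi> r"
      using large by blast
    define b where "b = 1/n - 1/3"
    have b: "b > 0" using n by (simp add: b_def field_simps)
    \<comment> \<open>Large enough that \<open>e * C * r powr b \<ge> 1\<close> for
      \<open>r \<ge> R1\<close>.\<close>
    define R1 where "R1 = max R (max 1 ((1 / (e * C)) powr (1/b)))"
    have R1: "R1 \<ge> 1" "R1 \<ge> R" "R1 \<ge> (1 / (e * C)) powr (1/b)" by (auto simp: R1_def)
    have "r powr (4/3) \<le> e * \<Phi> r + R1 powr (1/3) * r" if r: "r \<ge> 0" for r
    proof (cases "r \<ge> R1")
      case True
      then have r0: "r > 0" using R1 by linarith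
      have "1 / (e * C) = ((1 / (e * C)) powr (1/b)) powr b" using b e C by (simp add: powr_powr)
      also have "\<dots> \<le> r powr b" using True R1 b by (intro powr_mono2) auto
      finally have "1 \<le> e * C * r powr b" using e C by (simp add: field_simps)
      then have "r powr (4/3) * 1 \<le> r powr (4/3) * (e * C * r powr b)" by (rule mult_left_mono) simp
      also have "\<dots> = e * (C * r powr (4/3 + b))" using r0 by (simp add: powr_add)
      also have "4/3 + b = 1 + 1/n" by (simp add: b_def)
      also have "e * (C * r powr (1 + 1/n)) \<le> e * \<Phi> r" using R[of r] True R1 e by (intro mult_left_mono) auto
      finally have "r powr (4/3) \<le> e * \<Phi> r" by simp
      moreover have "0 \<le> R1 powr (1/3) * r" using r by simp
      ultimately show ?thesis by linarith
    next
      case False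
      have "r powr (4/3) = r powr (1/3) * r"
        using r powr_add[of r "1/3" 1] by (cases "r = 0") auto
      also have "\<dots> \<le> R1 powr (1/3) * r" using False r by (intro mult_right_mono powr_mono2) auto
      finally have "r powr (4/3) \<le> R1 powr (1/3) * r" .
      moreover have "0 \<le> e * \<Phi> r" using e nonneg[OF r] by simp
      ultimately show ?thesis by linarith
    qed
    then show ?thesis by (intro exI[of _ "R1 powr (1/3)"]) auto
  qed
qed (use Phi_0 convex small in auto)

context polytrope_bound
begin

section \<open>Stability of near-minimizing states\<close>

text \<open>Since \<open>Ekin\<close> is nonnegative, the representatives form a minimizing
  sequence. Along a subsequence, and after shifts, compactness makes the form vanish, and the excess
  energy vanishes by \<open>H\<close>; these are the two summands in
  \<open>rep_stabq\<close>.\<close>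

lemma stabq_small:
  assumes unique: "\<And>\<sigma>. adm M \<sigma> \<Longrightarrow> En \<sigma> = h \<Longrightarrow> \<exists>a. AE x in lborel. \<sigma> x = shift a \<rho>0 x"
    and r0: "rep M \<rho>0 g0" and h: "En g0 = h"
    and \<rho>: "\<And>n::nat. \<rho> n \<in> FM \<Phi> M" and H: "\<And>n. Henergy \<Phi> (\<rho> n) (u n) < h + 1 / real (Suc n)" and \<epsilon>: "\<epsilon> > 0"
  shows "\<exists>n a. stabq \<Phi> E0 (shift a \<rho>0) (\<rho> n) (u n) < \<epsilon>"
proof -
  obtain g where g: "\<And>n. rep M (\<rho> n) (g n)" using rep_exists[OF \<rho>] by metis
  have ga: "adm M (g n)" for n using g[of n] by (simp add: rep_def)
  have g0a: "adm M g0" using r0 by (simp add: rep_def)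
  have \<rho>0: "0 \<le> \<rho> n x" for n x using \<rho>[of n] by (simp add: FM_def)
  have "En (g n) \<le> h + 1 / real (Suc n)" for n
    using H[of n] rep_Henergy[OF g, of n "u n"] Ekin_nonneg[of "\<rho> n" "u n", OF \<rho>0] by linarith
  note up = this
  have Eh: "(\<lambda>n. En (g n)) \<longlonglongrightarrow> h"
  proof (rule tendsto_sandwich[of "\<lambda>n. h" "\<lambda>n. En (g n)" sequentially "\<lambda>n. h + 1 / real (Suc n)"])
    show "\<forall>\<^sub>F n in sequentially. h \<le> En (g n)" by (intro always_eventually allI En_ge ga)
    show "\<forall>\<^sub>F n in sequentially. En (g n) \<le> h + 1 / real (Suc n)" by (intro always_eventually allI up)
    have "(\<lambda>n. 1 / real (Suc n)) \<longlonglongrightarrow> 0" using LIMSEQ_Suc[OF lim_1_over_n] by simp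
    from tendsto_add[OF tendsto_const[of h] this] show "(\<lambda>n. h + 1 / real (Suc n)) \<longlonglongrightarrow> h" by simp
  qed simp
  have "\<exists>r b \<sigma>. strict_mono (r :: nat \<Rightarrow> nat) \<and> adm M \<sigma> \<and> En \<sigma> = h \<and>
     (\<lambda>n. coulD (\<lambda>x. g (r n) (x + b n) - \<sigma> x) (\<lambda>x. g (r n) (x + b n) - \<sigma> x)) \<longlonglongrightarrow> 0"
    by (rule minimizing_sequence_compact[OF ga Eh])
  then obtain r b \<sigma> where r: "strict_mono (r :: nat \<Rightarrow> nat) \<and> adm M \<sigma> \<and> En \<sigma> = h \<and>
     (\<lambda>n. coulD (\<lambda>x. g (r n) (x + b n) - \<sigma> x) (\<lambda>x. g (r n) (x + b n) - \<sigma> x)) \<longlonglongrightarrow> 0"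
    by (elim exE) (rule that)
  then obtain a where a: "AE x in lborel. \<sigma> x = shift a \<rho>0 x" using unique by blast
  have "AE x in lborel. shift a \<rho>0 x = g0 (x + a)" using rep_shift[OF r0, of a] by (simp add: rep_def)
  with a have \<sigma>: "AE x in lborel. \<sigma> x = g0 (x + a)" by eventually_elim simp
  have dg: "density_class (g n)" and d0: "density_class g0" and d\<sigma>: "density_class \<sigma>" for n
    using adm_density_class ga g0a r by blast+
  \<comment> \<open>Translation invariance moves the shift \<open>b n\<close> from the sequence to
    the minimizer, where it combines with \<open>a\<close> into \<open>a - b n\<close>.\<close>
  define D where "D n = coulD (\<lambda>x. g (r n) x - g0 (x + (a - b n))) (\<lambda>x. g (r n) x - g0 (x + (a - b n)))" for n
  have "D n = coulD (\<lambda>x. g (r n) (x + b n) - \<sigma> x) (\<lambda>x. g (r n) (x + b n) - \<sigma> x)" for n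
  proof -
    have d: "density_class (\<lambda>x. g (r n) x - g0 (x + (a - b n)))"
      by (intro density_class_diff dg density_class_shift d0)
    have "D n = coulD (\<lambda>x. g (r n) (x + b n) - g0 (x + b n + (a - b n))) (\<lambda>x. g (r n) (x + b n) - g0 (x + b n + (a - b n)))"
      unfolding D_def by (rule coulD_shift[OF d d, symmetric])
    also have "\<dots> = coulD (\<lambda>x. g (r n) (x + b n) - g0 (x + a)) (\<lambda>x. g (r n) (x + b n) - g0 (x + a))"
      by (simp add: algebra_simps)
    also have "\<dots> = coulD (\<lambda>x. g (r n) (x + b n) - \<sigma> x) (\<lambda>x. g (r n) (x + b n) - \<sigma> x)"
      by (rule coulD_self_cong_AE) (use \<sigma> in \<open>auto intro!: density_class_diff density_class_shift dg d0 d\<sigma> elim: eventually_mono\<close>)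
    finally show ?thesis .
  qed
  then have "D = (\<lambda>n. coulD (\<lambda>x. g (r n) (x + b n) - \<sigma> x) (\<lambda>x. g (r n) (x + b n) - \<sigma> x))" by (rule ext)
  with r have D: "D \<longlonglongrightarrow> 0" by (simp only:)
  let ?c = "1/2 + gradC / (8 * pi)"
  have "(\<lambda>n. 1 / real (Suc (r n)) + ?c * D n) \<longlonglongrightarrow> 0 + ?c * 0"
  proof (intro tendsto_add tendsto_mult tendsto_const D)
    show "(\<lambda>n. 1 / real (Suc (r n))) \<longlonglongrightarrow> 0"
      using LIMSEQ_subseq_LIMSEQ[OF LIMSEQ_Suc[OF lim_1_over_n] conjunct1[OF r]] by (simp add: o_def)
  qed
  then have "(\<lambda>n. 1 / real (Suc (r n)) + ?c * D n) \<longlonglongrightarrow> 0" by simp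
  then have "\<forall>\<^sub>F n in sequentially. 1 / real (Suc (r n)) + ?c * D n < \<epsilon>" using \<epsilon> by (rule order_tendstoD)
  then obtain n where n: "1 / real (Suc (r n)) + ?c * D n < \<epsilon>" using eventually_happens'[OF sequentially_bot] by blast
  have "stabq \<Phi> E0 (shift (a - b n) \<rho>0) (\<rho> (r n)) (u (r n)) = Henergy \<Phi> (\<rho> (r n)) (u (r n)) - h + ?c * D n"
    using rep_stabq(1)[OF g rep_shift[OF r0]] unfolding D_def adm_shift(2)[OF g0a] h by blast
  also have "\<dots> < \<epsilon>" using H[of "r n"] n by linarith
  finally show ?thesis by blast
qed

text \<open>A failure for every tolerance \<open>1 / real (Suc n)\<close> would supply a sequence
  contradicting \<open>stabq_small\<close>. The statement concerns single states, so one
  \<open>\<delta>\<close> serves all solutions and all times.\<close>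

lemma stabq_stable:
  assumes unique: "\<And>\<sigma>. adm M \<sigma> \<Longrightarrow> En \<sigma> = h \<Longrightarrow> \<exists>a. AE x in lborel. \<sigma> x = shift a \<rho>0 x"
    and r0: "rep M \<rho>0 g0" and h: "En g0 = h" and \<epsilon>: "\<epsilon> > 0"
  shows "\<exists>\<delta>>0. \<forall>\<rho> u. \<rho> \<in> FM \<Phi> M \<longrightarrow> Henergy \<Phi> \<rho> u < h + \<delta> \<longrightarrow> (\<exists>a. stabq \<Phi> E0 (shift a \<rho>0) \<rho> u < \<epsilon>)"
proof (rule ccontr)
  assume neg: "\<not> ?thesis"
  have "\<exists>p. fst p \<in> FM \<Phi> M \<and> Henergy \<Phi> (fst p) (snd p) < h + 1 / real (Suc n)
      \<and> \<not> (\<exists>a. stabq \<Phi> E0 (shift a \<rho>0) (fst p) (snd p) < \<epsilon>)" for n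
  proof -
    have "1 / real (Suc n) > 0" by simp
    with neg obtain \<rho> u where "\<rho> \<in> FM \<Phi> M" "Henergy \<Phi> \<rho> u < h + 1 / real (Suc n)"
      "\<not> (\<exists>a. stabq \<Phi> E0 (shift a \<rho>0) \<rho> u < \<epsilon>)" by blast
    then show ?thesis by (intro exI[of _ "(\<rho>, u)"]) simp
  qed
  then have "\<exists>p. \<forall>n. fst (p n) \<in> FM \<Phi> M \<and> Henergy \<Phi> (fst (p n)) (snd (p n)) < h + 1 / real (Suc n)
      \<and> \<not> (\<exists>a. stabq \<Phi> E0 (shift a \<rho>0) (fst (p n)) (snd (p n)) < \<epsilon>)"
    by (intro choice allI)
  then obtain p where p: "\<forall>n. fst (p n) \<in> FM \<Phi> M \<and> Henergy \<Phi> (fst (p n)) (snd (p n)) < h + 1 / real (Suc n)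
      \<and> \<not> (\<exists>a. stabq \<Phi> E0 (shift a \<rho>0) (fst (p n)) (snd (p n)) < \<epsilon>)" ..
  have "\<exists>n a. stabq \<Phi> E0 (shift a \<rho>0) (fst (p n)) (snd (p n)) < \<epsilon>"
    by (rule stabq_small[OF unique r0 h _ _ \<epsilon>]) (use p in blast)+
  with p show False by blast
qed

end

theorem theorem3:
  fixes \<Phi> \<Phi>' \<Phi>'' :: "real \<Rightarrow> real" and M E0 :: real and \<rho>0 :: "real^3 \<Rightarrow> real"
  assumes M_pos: "M > 0"
    and Phi_C1: "continuous_on {0..} \<Phi>'"
      "\<forall>r\<ge>0. (\<Phi> has_real_derivative \<Phi>' r) (at r within {0..})"
    and Phi_C2: "continuous_on {0<..} \<Phi>''"
      "\<forall>r>0. (\<Phi>' has_real_derivative \<Phi>'' r) (at r)"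
    and Phi_0: "\<Phi> 0 = 0" "\<Phi>' 0 = 0"
    and Phi_convex: "strictly_convex_on {0..} \<Phi>"
    and Phi_large: "\<exists>C>0. \<exists>n. 0 < n \<and> n < 3 \<and> (\<exists>R. \<forall>r\<ge>R. C * r powr (1 + 1/n) \<le> \<Phi> r)"
    and Phi_small: "\<exists>C>0. \<exists>n'. 0 < n' \<and> n' < 3 \<and>
                      (\<exists>r0>0. \<forall>r. 0 \<le> r \<and> r \<le> r0 \<longrightarrow> \<Phi> r \<le> C * r powr (1 + 1/n'))"
    and minimizer: "\<rho>0 \<in> FM \<Phi> M" "\<forall>\<rho>\<in>FM \<Phi> M. Hr \<Phi> \<rho>0 \<le> Hr \<Phi> \<rho>"
    and unique: "\<forall>\<sigma>\<in>FM \<Phi> M. Hr \<Phi> \<sigma> = Hr \<Phi> \<rho>0 \<longrightarrow>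
                    (\<exists>a. AE x in lebesgue. \<sigma> x = shift a \<rho>0 x)"
    and E0: "E0 \<le> 0"
      "\<forall>x. Vpot \<rho>0 x < E0 \<longrightarrow> \<Phi>' (\<rho>0 x) = E0 - Vpot \<rho>0 x"
      "\<forall>x. E0 \<le> Vpot \<rho>0 x \<longrightarrow> \<rho>0 x = 0"
  shows "\<forall>\<epsilon>>0. \<exists>\<delta>>0. \<forall>(I::real set) \<rho> u.
           is_interval I \<and> 0 \<in> I \<and> I \<subseteq> {0..}
           \<and> EP_solution \<Phi>'' I \<rho> u
           \<and> \<rho> 0 \<in> FM \<Phi> M
           \<and> preserves_mass_energy \<Phi> I \<rho> u
           \<and> stabq \<Phi> E0 \<rho>0 (\<rho> 0) (u 0) < \<delta>
           \<longrightarrow> (\<forall>t\<in>I. \<exists>a. stabq \<Phi> E0 (shift a \<rho>0) (\<rho> t) (u t) < \<epsilon>)"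
proof -
  interpret polytrope \<Phi>
    by (rule polytropeI[OF Phi_C1(2) Phi_0 Phi_convex Phi_large Phi_small])
  obtain g0 where g0: "rep M \<rho>0 g0" using rep_exists[OF minimizer(1)] by blast
  define h where "h = En g0"
  have Hr0: "Hr \<Phi> \<rho>0 = h" using rep_Hr[OF g0] by (simp add: h_def)
  interpret polytrope_bound \<Phi> M h
  proof
    show "h \<le> En \<sigma>" if "adm M \<sigma>" for \<sigma>
      using minimizer(2) adm_FM[OF that] rep_Hr[OF rep_self[OF that]] Hr0 by metis
  qed (rule M_pos)
  have uniq: "\<exists>a. AE x in lborel. \<sigma> x = shift a \<rho>0 x" if "adm M \<sigma>" "En \<sigma> = h" for \<sigma>
    using unique[rule_format, OF adm_FM[OF that(1)]] rep_Hr[OF rep_self[OF that(1)]] Hr0 that(2)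
    by (simp add: AE_completion_iff)
  show ?thesis
  proof (intro allI impI)
    fix \<epsilon> :: real assume "\<epsilon> > 0"
    then obtain \<delta> where \<delta>: "\<delta> > 0"
      and stable: "\<forall>\<rho> u. \<rho> \<in> FM \<Phi> M \<longrightarrow> Henergy \<Phi> \<rho> u < h + \<delta> \<longrightarrow> (\<exists>a. stabq \<Phi> E0 (shift a \<rho>0) \<rho> u < \<epsilon>)"
      using stabq_stable[OF uniq g0 h_def[symmetric]] by blast
    have "\<exists>a. stabq \<Phi> E0 (shift a \<rho>0) (\<rho> t) (u t) < \<epsilon>"
      if r: "\<rho> 0 \<in> FM \<Phi> M" and p: "preserves_mass_energy \<Phi> I \<rho> u"
        and s: "stabq \<Phi> E0 \<rho>0 (\<rho> 0) (u 0) < \<delta>" and t: "t \<in> I" for I \<rho> u t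
    proof -
      obtain g where g: "rep M (\<rho> 0) g" using rep_exists[OF r] by blast
      have ga: "adm M g" "adm M g0" using g g0 by (auto simp: rep_def)
      let ?D = "coulD (\<lambda>x. g x - g0 x) (\<lambda>x. g x - g0 x)"
      have "?D \<ge> 0" by (intro coulD_self_nonneg density_class_diff adm_density_class[OF ga(1)] adm_density_class[OF ga(2)])
      \<comment> \<open>The sign is read off from \<open>L2sq\<close>, an integral of squares equal
        to \<open>gradC * ?D\<close>.\<close>
      moreover have "gradC * ?D \<ge> 0"
        unfolding rep_stabq(2)[OF g g0, symmetric] L2sq_def by (intro Bochner_Integration.integral_nonneg) auto
      ultimately have "0 \<le> (1/2 + gradC / (8 * pi)) * ?D" by (simp add: distrib_right)
      \<comment> \<open>The form enters \<open>stabq\<close> with a nonnegative contribution, so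
        initial smallness of \<open>stabq\<close> bounds the excess energy.\<close>
      then have "Henergy \<Phi> (\<rho> 0) (u 0) < h + \<delta>"
        using s unfolding rep_stabq(1)[OF g g0] h_def by linarith
      \<comment> \<open>Conservation carries the energy bound and membership in
        \<open>FM \<Phi> M\<close> from time \<open>0\<close> to time \<open>t\<close>, where the
        statement on single states is applied.\<close>
      moreover have "Henergy \<Phi> (\<rho> t) (u t) = Henergy \<Phi> (\<rho> 0) (u 0)" and "\<rho> t \<in> FM \<Phi> M"
        using p t r unfolding preserves_mass_energy_def FM_def by auto
      ultimately show ?thesis using stable by simp
    qed
    then show "\<exists>\<delta>>0. \<forall>(I::real set) \<rho> u.
           is_interval I \<and> 0 \<in> I \<and> I \<subseteq> {0..}
           \<and> EP_solution \<Phi>'' I \<rho> u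
           \<and> \<rho> 0 \<in> FM \<Phi> M
           \<and> preserves_mass_energy \<Phi> I \<rho> u
           \<and> stabq \<Phi> E0 \<rho>0 (\<rho> 0) (u 0) < \<delta>
           \<longrightarrow> (\<forall>t\<in>I. \<exists>a. stabq \<Phi> E0 (shift a \<rho>0) (\<rho> t) (u t) < \<epsilon>)"
      using \<delta> by blast
  qed
qed

end
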